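(* Let $p$ be a prime. The product-free measures of the additive groups $\mathbb Z_p$ ($p$-adic integers) and $\mathbb F_p[[t]]$ (formal power series over $\mathbb F_p$) are \[ \mathrm{pf}(\mathbb Z_p)=\begin{cases}\frac13+\frac1{3p} & \text{if } p\equiv 2 \pmod 3,\\ \frac13 & \text{otherwise,}\end{cases} \] \[ \mathrm{pf}(\mathbb F_p[[t]])=\begin{cases}\frac13+\frac1{3p} & \text{if } p\equiv 2 \pmod 3,\\ \frac13 & \text{if } p=3,\\ \frac13-\frac1{3p} & \text{if } p\equiv 1\pmod 3.\end{cases} \]
   Context: Both groups are taken with addition as the group operation and with the profinite topology. For a compact group $G$ with normalized Haar measure $\mu$ ($\mu(G)=1$), the product-free measure is the supremum of $\mu(A)$ over all measurable $A\subseteq G$ that are product-free; in additive notation, product-free means that there are no $x,y,z\in A$ with $x+y=z$. *)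

theory Defs
  imports "HOL-Analysis.Analysis" "HOL-Number_Theory.Number_Theory"
begin

section \<open>Haar measure and product-free measure of a compact group\<close>

text \<open>
  A compact Hausdorff group is a group \<open>G\<close> with a topology \<open>T\<close> on its carrier. Its normalized
  Haar measure is the unique regular left-invariant probability measure on the Borel sets
  of \<open>T\<close>. As the total mass is finite, regularity amounts to inner regularity on all Borel sets.
\<close>

definition normalized_haar :: "('a, 'm) monoid_scheme \<Rightarrow> 'a topology \<Rightarrow> 'a measure \<Rightarrow> bool" where
  "normalized_haar G T M \<longleftrightarrow>
     space M = topspace T \<and>
     sets M = sigma_sets (topspace T) {U. openin T U} \<and>
     emeasure M (space M) = 1 \<and>
     (\<forall>g\<in>carrier G. \<forall>A\<in>sets M. emeasure M (g <#\<^bsub>G\<^esub> A) = emeasure M A) \<and>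
     (\<forall>A\<in>sets M. emeasure M A = (SUP K\<in>{K. compactin T K \<and> K \<subseteq> A}. emeasure M K))"

definition haar_measure :: "('a, 'm) monoid_scheme \<Rightarrow> 'a topology \<Rightarrow> 'a measure" where
  "haar_measure G T = (THE M. normalized_haar G T M)"

definition product_free :: "('a, 'm) monoid_scheme \<Rightarrow> 'a set \<Rightarrow> bool" where
  "product_free G A \<longleftrightarrow>
     A \<subseteq> carrier G \<and> \<not> (\<exists>x\<in>A. \<exists>y\<in>A. \<exists>z\<in>A. x \<otimes>\<^bsub>G\<^esub> y = z)"

definition product_free_measure :: "('a, 'm) monoid_scheme \<Rightarrow> 'a topology \<Rightarrow> real" where
  "product_free_measure G T =
     (SUP A\<in>{A \<in> sets (haar_measure G T). product_free G A}. measure (haar_measure G T) A)"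


section \<open>The \<open>p\<close>-adic integers\<close>

text \<open>
  The inverse limit of the rings \<open>\<int>/p\<^sup>n\<int>\<close> for \<open>n \<ge> 1\<close>: the entry at index \<open>n\<close> is
  the residue modulo \<open>p\<close> to the power \<open>Suc n\<close>. (The trivial quotient is left out because
  \<^term>\<open>residue_ring 1\<close> has a unit element outside its carrier.)
  The profinite topology is the subspace topology from the product of the finite discrete
  quotients.
\<close>

definition padic_int_ring :: "nat \<Rightarrow> (nat \<Rightarrow> int) ring" where
  "padic_int_ring p =
     \<lparr>carrier = {x. \<forall>n. x n \<in> carrier (residue_ring (int p ^ Suc n)) \<and>
                         x (Suc n) mod (int p ^ Suc n) = x n},
      monoid.mult = \<lambda>x y n. x n \<otimes>\<^bsub>residue_ring (int p ^ Suc n)\<^esub> y n,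
      one = \<lambda>n. \<one>\<^bsub>residue_ring (int p ^ Suc n)\<^esub>,
      zero = \<lambda>n. \<zero>\<^bsub>residue_ring (int p ^ Suc n)\<^esub>,
      add = \<lambda>x y n. x n \<oplus>\<^bsub>residue_ring (int p ^ Suc n)\<^esub> y n\<rparr>"

definition padic_int_topology :: "nat \<Rightarrow> (nat \<Rightarrow> int) topology" where
  "padic_int_topology p =
     subtopology
       (product_topology (\<lambda>n. discrete_topology (carrier (residue_ring (int p ^ Suc n)))) UNIV)
       (carrier (padic_int_ring p))"


section \<open>Formal power series over a ring\<close>

text \<open>
  A power series is its sequence of coefficients. The type \<open>'a fps\<close> of the library takes
  coefficients from a whole type, so it does not apply to coefficients in
  \<^term>\<open>residue_ring (int p)\<close> for a variable \<open>p\<close>.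
  For a finite \<open>R\<close>, the product of the discrete topologies on the coefficients is the profinite
  topology, that is, the inverse limit topology of the finite discrete quotients \<open>R[t]/(t\<^sup>n)\<close>.
\<close>

definition power_series_ring :: "('a, 'm) ring_scheme \<Rightarrow> (nat \<Rightarrow> 'a) ring" where
  "power_series_ring R =
     \<lparr>carrier = {f. \<forall>n. f n \<in> carrier R},
      monoid.mult = \<lambda>f g n. \<Oplus>\<^bsub>R\<^esub>i\<in>{..n}. f i \<otimes>\<^bsub>R\<^esub> g (n - i),
      one = \<lambda>n. if n = 0 then \<one>\<^bsub>R\<^esub> else \<zero>\<^bsub>R\<^esub>,
      zero = \<lambda>n. \<zero>\<^bsub>R\<^esub>,
      add = \<lambda>f g n. f n \<oplus>\<^bsub>R\<^esub> g n\<rparr>"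

definition power_series_topology :: "('a, 'm) ring_scheme \<Rightarrow> (nat \<Rightarrow> 'a) topology" where
  "power_series_topology R = product_topology (\<lambda>n. discrete_topology (carrier R)) UNIV"


section \<open>Basic facts\<close>

lemma topspace_padic_int_topology: "topspace (padic_int_topology p) = carrier (padic_int_ring p)"
  by (auto simp: padic_int_topology_def padic_int_ring_def)

lemma topspace_power_series_topology:
  "topspace (power_series_topology R) = carrier (power_series_ring R)"
  by (auto simp: power_series_topology_def power_series_ring_def)

lemma cring_padic_int_ring:
  assumes "p > 1"
  shows "cring (padic_int_ring p)"
proof -
  have gt: "int p ^ Suc n > 1" for n
    using assms by (metis less_imp_of_nat_less of_nat_1 one_less_power zero_less_Suc)
  have gt0: "int p ^ n > 0" for n
    using assms by simp
  have dv: "(a mod (int p * (int p * int p ^ n))) mod (int p * int p ^ n) = a mod (int p * int p ^ n)"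
    for a n by (simp add: mod_mod_cancel)
  have carr: "x \<in> carrier (padic_int_ring p) \<longleftrightarrow>
      (\<forall>n. 0 \<le> x n \<and> x n < int p ^ Suc n \<and> x (Suc n) mod (int p ^ Suc n) = x n)" for x
    by (auto simp: padic_int_ring_def residue_ring_def)
  have c: "(\<lambda>n. f n mod int p ^ Suc n) \<in> carrier (padic_int_ring p)"
    if "\<And>n. f (Suc n) mod int p ^ Suc n = f n mod int p ^ Suc n" for f :: "nat \<Rightarrow> int"
    using that gt0[of "Suc _"] by (auto simp: carr dv)
  note ops = padic_int_ring_def residue_ring_def
  have add: "x \<oplus>\<^bsub>padic_int_ring p\<^esub> y = (\<lambda>n. (x n + y n) mod int p ^ Suc n)" for x y
    by (simp add: ops)
  have mul: "x \<otimes>\<^bsub>padic_int_ring p\<^esub> y = (\<lambda>n. (x n * y n) mod int p ^ Suc n)" for x y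
    by (simp add: ops)
  have zero: "\<zero>\<^bsub>padic_int_ring p\<^esub> = (\<lambda>n. 0)" and one: "\<one>\<^bsub>padic_int_ring p\<^esub> = (\<lambda>n. 1)"
    by (simp_all add: ops)
  have cadd: "x \<oplus>\<^bsub>padic_int_ring p\<^esub> y \<in> carrier (padic_int_ring p)"
    if "x \<in> carrier (padic_int_ring p)" "y \<in> carrier (padic_int_ring p)" for x y
    unfolding add by (rule c) (metis that carr mod_add_eq)
  have cmul: "x \<otimes>\<^bsub>padic_int_ring p\<^esub> y \<in> carrier (padic_int_ring p)"
    if "x \<in> carrier (padic_int_ring p)" "y \<in> carrier (padic_int_ring p)" for x y
    unfolding mul by (rule c) (metis that carr mod_mult_eq)
  have czero: "\<zero>\<^bsub>padic_int_ring p\<^esub> \<in> carrier (padic_int_ring p)"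
    unfolding zero carr using gt0[of "Suc _"] by auto
  have cone: "\<one>\<^bsub>padic_int_ring p\<^esub> \<in> carrier (padic_int_ring p)"
    unfolding one carr using gt by auto
  have cneg: "(\<lambda>n. (- x n) mod int p ^ Suc n) \<in> carrier (padic_int_ring p)"
    if "x \<in> carrier (padic_int_ring p)" for x
    by (rule c) (metis that carr mod_minus_eq)
  show ?thesis
  proof (rule cringI)
    show "abelian_group (padic_int_ring p)"
    proof (rule abelian_groupI)
      fix x assume x: "x \<in> carrier (padic_int_ring p)"
      show "\<exists>y\<in>carrier (padic_int_ring p). y \<oplus>\<^bsub>padic_int_ring p\<^esub> x = \<zero>\<^bsub>padic_int_ring p\<^esub>"
        by (rule bexI[OF _ cneg[OF x]]) (simp add: add zero mod_add_left_eq)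
      show "\<zero>\<^bsub>padic_int_ring p\<^esub> \<oplus>\<^bsub>padic_int_ring p\<^esub> x = x"
        using x unfolding add zero carr by (auto simp: fun_eq_iff)
    qed (use cadd czero in \<open>auto simp: add mod_add_left_eq mod_add_right_eq ac_simps\<close>)
    show "Group.comm_monoid (padic_int_ring p)"
    proof (rule comm_monoidI)
      fix x assume x: "x \<in> carrier (padic_int_ring p)"
      show "\<one>\<^bsub>padic_int_ring p\<^esub> \<otimes>\<^bsub>padic_int_ring p\<^esub> x = x"
        using x unfolding mul one carr by (auto simp: fun_eq_iff)
    qed (use cmul cone in \<open>auto simp: mul mod_mult_left_eq mod_mult_right_eq ac_simps\<close>)
  qed (auto simp: add mul mod_mult_left_eq mod_add_eq distrib_right)
qed

lemma abelian_group_power_series_ring: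
  assumes "abelian_group R"
  shows "abelian_group (power_series_ring R)"
proof -
  interpret abelian_group R by fact
  show ?thesis
  proof (rule abelian_groupI)
    fix f assume f: "f \<in> carrier (power_series_ring R)"
    show "\<exists>g\<in>carrier (power_series_ring R). g \<oplus>\<^bsub>power_series_ring R\<^esub> f = \<zero>\<^bsub>power_series_ring R\<^esub>"
      using f by (intro bexI[of _ "\<lambda>n. \<ominus>\<^bsub>R\<^esub> f n"]) (auto simp: power_series_ring_def l_neg)
  qed (auto simp: power_series_ring_def a_ac)
qed

end

theory Submission
  imports Defs "HOL-Probability.Infinite_Product_Measure"
begin

text \<open>
  Both lower bounds come from middle thirds. If \<open>b < 2 a\<close> and \<open>2 b < N + a\<close>, then no two of the
  residues \<open>a, \<dots>, b\<close> modulo \<open>N\<close> add up to a third, and the preimage of these residues in the group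
  is open and product-free. In \<open>\<int>\<^sub>p\<close> every power of \<open>p\<close> can serve as \<open>N\<close>, whereas the
  cyclic quotients of \<open>F\<^sub>p[[t]]\<close> have at most \<open>p\<close> elements; this is what separates the two
  answers when \<open>p\<close> is 1 modulo 3.

  Upper bound in \<open>\<int>\<^sub>p\<close>. By inner regularity it is enough to bound a closed product-free set, and by
  compactness its image in some \<open>\<int>/p\<^sup>n\<close> is still sum-free (\<open>closed_product_free_separated\<close>). The
  subgroups of \<open>\<int>/p\<^sup>n\<close> form a chain, which makes Kneser's theorem easy there
  (\<open>kneser_prime_power\<close>). For a sum-free set, divided out by the stabilizer of its sumset, it says
  that three times the size is at most the order \<open>p\<^sup>i\<close> of the quotient plus 1
  (\<open>count_sumfree_prime_power\<close>); the theorem's values are then a matter of residues modulo 3.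

  Upper bound in \<open>F\<^sub>p[[t]]\<close>. With \<open>K\<close> the integer part of \<open>(p + 1)/3\<close>, the claim is that a
  product-free set \<open>A\<close> has measure at most \<open>K/p\<close>. By Cauchy-Davenport a line through the origin
  meets \<open>A\<close> in at most \<open>K\<close> points. If every line meets \<open>A\<close> in fewer points, averaging over
  the lines is enough. Otherwise some line, spanned by \<open>v\<close>, meets \<open>A\<close> in exactly \<open>K\<close>
  points. Then every plane through this line meets \<open>A\<close> in at most \<open>K p\<close> points
  (\<open>plane_bound\<close>), and the bound follows by averaging over the planes spanned by \<open>v\<close> and a
  variable \<open>w\<close>.

  In such a plane consider the translates of the line, the rows. Unless \<open>p = 3 k + 1\<close>,
  Cauchy-Davenport applied to row 0 and another row bounds each row by \<open>K\<close>. If \<open>p = 3 k + 1\<close>, a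
  row can have \<open>k + 1\<close> points, but the indices of such rows form a sum-free set, so there are at most
  \<open>k\<close> of them; this suffices if one of the rows is empty. If none is empty but some row has
  \<open>k + 1\<close> points, that row is an arithmetic progression by Vosper's theorem (\<open>vosper\<close>), and
  coordinates can be chosen in which it is the interval from 0 to \<open>k\<close>. Then every row lies in an
  interval of length at most \<open>k + 1\<close>, these intervals wind around the circle \<open>\<int>/p\<close> at a nearly
  constant speed, and a parity obstruction to closing up after \<open>p\<close> steps forces the average length down to
  \<open>k\<close> (\<open>winding_bound\<close>).

  Haar measure. The elements of both groups are sequences, and the cosets of a neighbourhood basis of open
  subgroups are the cylinders fixing finitely many entries. A Borel probability measure is the normalized
  Haar measure exactly if all cylinders of the same level have the same mass
  (\<open>equidistributed_iff_normalized_haar\<close>). This yields uniqueness, existence as an image of the product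
  measure on digit sequences, and invariance under every map that permutes the cylinders of each level, such
  as multiplication of power series by a nonzero scalar.
\<close>

section \<open>Periodic sets of integers\<close>

text \<open>
  Subsets of \<open>\<int>/N\<close> are represented by \<open>N\<close>-periodic sets of integers. Sumsets and translates are
  then those of \<open>\<int>\<close>, and one set can be viewed modulo each of its periods.
\<close>

definition periodic :: "int \<Rightarrow> int set \<Rightarrow> bool" where
  "periodic N A \<longleftrightarrow> (\<forall>x. x + N \<in> A \<longleftrightarrow> x \<in> A)"

definition count_mod :: "int \<Rightarrow> int set \<Rightarrow> nat" where
  "count_mod N A = card (A \<inter> {0..<N})"

lemma periodic_add_mult:
  assumes "periodic N A"
  shows "x + N * i \<in> A \<longleftrightarrow> x \<in> A"
proof (induction i rule: int_induct[where k = 0])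
  case (step1 i)
  have "x + N * (i + 1) = (x + N * i) + N" by (simp add: algebra_simps)
  then show ?case using step1 assms unfolding periodic_def by metis
next
  case (step2 i)
  have "x + N * i = (x + N * (i - 1)) + N" by (simp add: algebra_simps)
  then show ?case using step2 assms unfolding periodic_def by metis
qed simp

lemma periodic_mod: "periodic N A \<Longrightarrow> x mod N \<in> A \<longleftrightarrow> x \<in> A"
  by (metis periodic_add_mult mod_mult_div_eq)

lemma periodic_cong: "periodic N A \<Longrightarrow> x mod N = y mod N \<Longrightarrow> x \<in> A \<longleftrightarrow> y \<in> A"
  by (metis periodic_mod)

lemma periodic_transfer: "periodic N A \<Longrightarrow> x \<in> A \<Longrightarrow> x mod N = y mod N \<Longrightarrow> y \<in> A"
  using periodic_cong by blast

lemma periodic_dvd: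
  assumes "periodic d A" "d dvd N"
  shows "periodic N A"
proof -
  obtain i where "N = d * i" using assms(2) by (auto simp: dvd_def)
  then show ?thesis using periodic_add_mult[OF assms(1)] unfolding periodic_def by blast
qed

lemma periodic_gcd:
  assumes "periodic d A" "periodic e A"
  shows "periodic (gcd d e) A"
proof -
  obtain u v where uv: "u * d + v * e = gcd d e" using bezout_int by blast
  have "x + gcd d e = (x + d * u) + e * v" for x by (simp add: uv[symmetric] algebra_simps)
  then show ?thesis
    unfolding periodic_def by (metis assms periodic_add_mult)
qed

lemma periodic_Un: "periodic N A \<Longrightarrow> periodic N B \<Longrightarrow> periodic N (A \<union> B)"
  and periodic_Int: "periodic N A \<Longrightarrow> periodic N B \<Longrightarrow> periodic N (A \<inter> B)"
  and periodic_Compl: "periodic N A \<Longrightarrow> periodic N (- A)"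
  by (auto simp: periodic_def)

lemma periodic_affine:
  assumes "periodic N A"
  shows "periodic N {x. c * x + t \<in> A}"
proof -
  have "c * (x + N) + t \<in> A \<longleftrightarrow> c * x + t \<in> A" for x
    using periodic_add_mult[OF assms, of "c * x + t" c] by (simp add: algebra_simps)
  then show ?thesis by (simp add: periodic_def)
qed

lemma periodic_shift: "periodic N A \<Longrightarrow> periodic N {x. x + t \<in> A}"
  using periodic_affine[of N A 1 t] by simp

lemma mem_sumset_iff: "x \<in> A + B \<longleftrightarrow> (\<exists>b\<in>B. x - b \<in> A)" for x :: int
proof
  assume "x \<in> A + B"
  then obtain a b where "a \<in> A" "b \<in> B" "x = a + b" by (auto simp: set_plus_def)
  then show "\<exists>b\<in>B. x - b \<in> A" by (intro bexI[of _ b]) auto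
next
  assume "\<exists>b\<in>B. x - b \<in> A"
  then obtain b where "b \<in> B" "x - b \<in> A" by auto
  then show "x \<in> A + B" using set_plus_intro[of "x - b" A b B] by simp
qed

lemma periodic_sumset:
  assumes "periodic N A"
  shows "periodic N (A + B)"
proof -
  have "x + N - b \<in> A \<longleftrightarrow> x - b \<in> A" for x b
    using assms unfolding periodic_def by (metis add_diff_eq diff_add_eq)
  then show ?thesis by (simp add: periodic_def mem_sumset_iff)
qed

lemma periodic_extend:
  "periodic d {x. \<exists>i. x + d * i \<in> A}"
proof -
  have "(\<exists>i. x + d + d * i \<in> A) \<longleftrightarrow> (\<exists>i. x + d * i \<in> A)" for x
  proof
    assume "\<exists>i. x + d + d * i \<in> A"
    then obtain i where "x + d * (i + 1) \<in> A" by (auto simp: algebra_simps)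
    then show "\<exists>i. x + d * i \<in> A" by blast
  next
    assume "\<exists>i. x + d * i \<in> A"
    then obtain i where "x + d * i \<in> A" by auto
    then have "x + d + d * (i - 1) \<in> A" by (simp add: algebra_simps)
    then show "\<exists>i. x + d + d * i \<in> A" by blast
  qed
  then show ?thesis by (simp add: periodic_def)
qed

lemma count_mod_mono: "A \<subseteq> B \<Longrightarrow> count_mod N A \<le> count_mod N B"
  unfolding count_mod_def by (intro card_mono) auto

lemma count_mod_Un_Int: "count_mod N (A \<union> B) + count_mod N (A \<inter> B) = count_mod N A + count_mod N B"
  unfolding count_mod_def
  using card_Un_Int[of "A \<inter> {0..<N}" "B \<inter> {0..<N}"] by (simp add: Int_Un_distrib2 Int_ac)

lemma count_mod_UNIV: "N > 0 \<Longrightarrow> count_mod N UNIV = nat N"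
  by (simp add: count_mod_def)

lemma count_mod_Compl:
  assumes "N > 0" shows "count_mod N A + count_mod N (- A) = nat N"
  using count_mod_Un_Int[of N A "- A"] count_mod_UNIV[OF assms] by (simp add: count_mod_def)

lemma count_mod_disjoint:
  assumes "N > 0" "A \<inter> B = {}" shows "count_mod N A + count_mod N B \<le> nat N"
  using count_mod_Compl[OF assms(1), of A] count_mod_mono[of B "- A" N] assms(2)
  by (fastforce simp: disjoint_eq_subset_Compl)

lemma count_mod_eq_imp_eq:
  assumes "N > 0" "periodic N A" "periodic N B" "A \<subseteq> B" "count_mod N B \<le> count_mod N A"
  shows "A = B"
proof -
  have "A \<inter> {0..<N} = B \<inter> {0..<N}"
    using assms unfolding count_mod_def by (intro card_seteq) auto
  then have "x mod N \<in> A \<longleftrightarrow> x mod N \<in> B" for x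
    using assms(1) by (metis IntE IntI atLeastLessThan_iff pos_mod_bound pos_mod_sign)
  then show ?thesis using periodic_mod assms(2,3) by blast
qed

lemma count_mod_pos:
  assumes "N > 0" "periodic N A" "A \<noteq> {}"
  shows "count_mod N A > 0"
  using count_mod_eq_imp_eq[of N "{}" A] assms by (auto simp: periodic_def count_mod_def)

text \<open>
  The substitution permutes the residues modulo \<open>N\<close>. Translations, reflections and dilations of
  \<open>\<int>/N\<close> are the instances in use.
\<close>

lemma count_mod_affine:
  assumes N: "N > 0" and A: "periodic N A" and c: "coprime c N"
  shows "count_mod N {x. c * x + t \<in> A} = count_mod N A"
proof -
  define f where "f x = (c * x + t) mod N" for x
  have inj: "inj_on f {0..<N}"
  proof (rule inj_onI)
    fix x y assume xy: "x \<in> {0..<N}" "y \<in> {0..<N}" "f x = f y"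
    then have "[c * x = c * y] (mod N)"
      unfolding f_def by (metis cong_add_rcancel cong_def)
    then have "[x = y] (mod N)" using c by (simp add: cong_mult_lcancel)
    then show "x = y" using xy by (simp add: cong_def)
  qed
  have im: "f ` {0..<N} = {0..<N}"
    by (rule endo_inj_surj[OF _ _ inj]) (use N in \<open>auto simp: f_def\<close>)
  have fA: "f x \<in> A \<longleftrightarrow> c * x + t \<in> A" for x by (simp add: f_def periodic_mod[OF A])
  have "f ` ({x. c * x + t \<in> A} \<inter> {0..<N}) = A \<inter> {0..<N}"
  proof (intro equalityI subsetI)
    fix y assume "y \<in> f ` ({x. c * x + t \<in> A} \<inter> {0..<N})"
    then show "y \<in> A \<inter> {0..<N}" using fA im by blast
  next
    fix y assume y: "y \<in> A \<inter> {0..<N}"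
    then obtain x where "x \<in> {0..<N}" "y = f x" using im by blast
    then show "y \<in> f ` ({x. c * x + t \<in> A} \<inter> {0..<N})" using y fA by blast
  qed
  then show ?thesis unfolding count_mod_def
    by (metis card_image inf_le2 inj inj_on_subset)
qed

lemma count_mod_shift: "N > 0 \<Longrightarrow> periodic N A \<Longrightarrow> count_mod N {x. x + t \<in> A} = count_mod N A"
  using count_mod_affine[of N A 1 t] by simp

lemma count_mod_times:
  assumes d: "d > 0" and A: "periodic d A"
  shows "count_mod (d * int m) A = m * count_mod d A"
proof (induction m)
  case (Suc m)
  have "{0..<d * int (Suc m)} = {0..<d * int m} \<union> {d * int m..<d * int m + d}"
    using d ivl_disj_un_two(3)[of 0 "d * int m" "d * int m + d"] by (simp add: algebra_simps)
  then have split: "A \<inter> {0..<d * int (Suc m)} = A \<inter> {0..<d * int m} \<union> A \<inter> {d * int m..<d * int m + d}"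
    by (simp add: Int_Un_distrib)
  have "bij_betw (\<lambda>x. x + d * int m) (A \<inter> {0..<d}) (A \<inter> {d * int m..<d * int m + d})"
  proof (rule bij_betwI[where g = "\<lambda>x. x - d * int m"])
    show "(\<lambda>x. x - d * int m) \<in> A \<inter> {d * int m..<d * int m + d} \<rightarrow> A \<inter> {0..<d}"
      using periodic_add_mult[OF A, of "_ - d * int m" "int m"] by auto
  qed (use periodic_add_mult[OF A, of _ "int m"] in auto)
  then have "card (A \<inter> {d * int m..<d * int m + d}) = count_mod d A"
    unfolding count_mod_def by (simp add: bij_betw_same_card)
  moreover have "card (A \<inter> {0..<d * int (Suc m)})
      = card (A \<inter> {0..<d * int m}) + card (A \<inter> {d * int m..<d * int m + d})"
    unfolding split by (rule card_Un_disjoint) auto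
  ultimately show ?case using Suc by (simp add: count_mod_def)
qed (simp add: count_mod_def)

text \<open>
  The periods of \<open>A\<close> form a subgroup of \<open>\<int>\<close>; its generator is the stabilizer of \<open>A\<close> in
  \<open>\<int>/N\<close>.
\<close>

lemma least_period:
  assumes "N > 0" "periodic N A"
  obtains d where "d > 0" "periodic d A" "\<And>t. periodic t A \<Longrightarrow> d dvd t"
proof -
  define m where "m = (LEAST m::nat. m > 0 \<and> periodic (int m) A)"
  have ex: "nat N > 0 \<and> periodic (int (nat N)) A" using assms by simp
  have m: "m > 0" "periodic (int m) A" using LeastI[of "\<lambda>m. m > 0 \<and> periodic (int m) A", OF ex]
    by (auto simp: m_def)
  have "int m dvd t" if t: "periodic t A" for t
  proof -
    have g: "gcd (int m) t > 0" using m by simp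
    have "periodic (int (nat (gcd (int m) t))) A" using periodic_gcd[OF m(2) t] g by simp
    then have "m \<le> nat (gcd (int m) t)"
      using g unfolding m_def by (intro Least_le) auto
    moreover have "gcd (int m) t \<le> int m" using m(1) by (intro zdvd_imp_le) auto
    ultimately have "gcd (int m) t = int m" using g by (intro antisym) (auto simp: le_nat_iff)
    then show ?thesis using gcd_dvd2[of "int m" t] by simp
  qed
  then show ?thesis using that[of "int m"] m by auto
qed

section \<open>Kneser's theorem modulo a prime power\<close>

lemma count_mod_residue_class:
  assumes "d > 0" shows "count_mod d {x. d dvd x - b} = 1"
proof -
  have per: "periodic d {x. d dvd x}" by (simp add: periodic_def)
  have "{x. d dvd x} \<inter> {0..<d} = {0}" using assms by (auto dest: zdvd_imp_le)
  then have "count_mod d {x. d dvd x} = 1" by (simp add: count_mod_def)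
  moreover have "{x. d dvd x - b} = {x. x + - b \<in> {x. d dvd x}}" by auto
  ultimately show ?thesis using count_mod_shift[OF assms per, of "- b"] by simp
qed

text \<open>
  The local step of Kneser's theorem, by Dyson's transform. Replacing \<open>A\<close> and \<open>B\<close> by the union
  and the intersection of \<open>A\<close> with a translate of \<open>B\<close> keeps the sum of the counts, keeps
  \<open>A + B\<close> inside the original sumset, and keeps \<open>a\<close> and \<open>b\<close>, while \<open>B\<close> shrinks. When no
  transform shrinks \<open>B\<close>, all differences \<open>y - b\<close> with \<open>y \<in> B\<close> are periods of \<open>A\<close>, and the
  translate \<open>C = A + b\<close> is the piece: \<open>B\<close> lies in one coset of the stabilizer of \<open>A\<close>, whose order
  is \<open>N div d\<close>.
\<close>

lemma sumset_contains_periodic_piece: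
  assumes N: "N > 0" and A: "periodic N A" and B: "periodic N B" and a: "a \<in> A" and b: "b \<in> B"
  shows "\<exists>C d. d > 0 \<and> d dvd N \<and> periodic d C \<and> a + b \<in> C \<and> C \<subseteq> A + B \<and>
           count_mod N A + count_mod N B \<le> count_mod N C + nat (N div d)"
  using A B a b
proof (induction "count_mod N B" arbitrary: A B rule: less_induct)
  case less
  note A = less.prems(1) and B = less.prems(2) and a = less.prems(3) and b = less.prems(4)
  show ?case
  proof (cases "\<forall>a'\<in>A. \<forall>y\<in>B. y + (a' - b) \<in> A")
    case True
    obtain d where d: "d > 0" "periodic d A" and dvd: "\<And>t. periodic t A \<Longrightarrow> d dvd t"
      using least_period[OF N A] by blast
    have "d dvd N" using dvd A by blast
    define C where "C = {x. x + - b \<in> A}"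
    have sub: "B \<subseteq> {x. d dvd x - b}"
    proof
      fix y assume y: "y \<in> B"
      have "y + (x - b) \<in> A \<Longrightarrow> x + (y - b) \<in> A" for x by (simp add: algebra_simps)
      then have "A \<subseteq> {x. x + (y - b) \<in> A}" using True y by blast
      then have "A = {x. x + (y - b) \<in> A}"
        by (intro count_mod_eq_imp_eq[OF N A periodic_shift[OF A]])
          (use count_mod_shift[OF N A, of "y - b"] in auto)
      then have "periodic (y - b) A" by (auto simp: periodic_def)
      then show "y \<in> {x. d dvd x - b}" using dvd by simp
    qed
    have "x + d - b = (x - b) + d" for x by simp
    then have per: "periodic d {x. d dvd x - b}" unfolding periodic_def by (metis dvd_add_triv_right_iff mem_Collect_eq)
    obtain k where k: "N = d * k" using \<open>d dvd N\<close> by (auto simp: dvd_def)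
    with N d have "k > 0" by (simp add: zero_less_mult_iff)
    have "count_mod N {x. d dvd x - b} = nat (N div d)"
      using count_mod_times[OF d(1) per, of "nat k"] d \<open>k > 0\<close> count_mod_residue_class[OF d(1), of b]
      by (simp add: k)
    then have "count_mod N B \<le> nat (N div d)" using count_mod_mono[OF sub, of N] by simp
    moreover have "count_mod N C = count_mod N A" unfolding C_def by (rule count_mod_shift[OF N A])
    moreover have "periodic d C" unfolding C_def by (rule periodic_shift[OF d(2)])
    moreover have "C \<subseteq> A + B" using b by (auto simp: C_def mem_sumset_iff)
    moreover have "a + b \<in> C" using a by (simp add: C_def)
    ultimately show ?thesis using d(1) \<open>d dvd N\<close> by (intro exI[of _ C] exI[of _ d]) auto
  next
    case False
    then obtain a' y where ay: "a' \<in> A" "y \<in> B" "y + (a' - b) \<notin> A" by blast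
    \<comment> \<open>The choice of \<open>e\<close> keeps \<open>b\<close> in the intersection and removes \<open>y\<close> from it.\<close>
    define e where "e = a' - b"
    define A1 where "A1 = A \<union> {x. x + - e \<in> B}"
    define B1 where "B1 = B \<inter> {x. x + e \<in> A}"
    have pA: "periodic N A1" and pB: "periodic N B1"
      unfolding A1_def B1_def by (intro periodic_Un periodic_Int periodic_shift A B)+
    have "B1 = {x. x + e \<in> A \<inter> {x. x + - e \<in> B}}" by (auto simp: B1_def)
    then have "count_mod N B1 = count_mod N (A \<inter> {x. x + - e \<in> B})"
      using count_mod_shift[OF N periodic_Int[OF A periodic_shift[OF B, of "- e"]], of e] by metis
    then have cnt: "count_mod N A1 + count_mod N B1 = count_mod N A + count_mod N B"
      using count_mod_Un_Int[of N A "{x. x + - e \<in> B}"] count_mod_shift[OF N B, of "- e"]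
      by (simp add: A1_def)
    have "B1 \<noteq> B" using ay by (auto simp: B1_def e_def)
    then have "count_mod N B1 < count_mod N B"
      using count_mod_eq_imp_eq[OF N pB B] by (force simp: B1_def not_le[symmetric])
    moreover have "a \<in> A1" "b \<in> B1" using a b ay by (auto simp: A1_def B1_def e_def)
    ultimately obtain C d where Cd: "d > 0" "d dvd N" "periodic d C" "a + b \<in> C" "C \<subseteq> A1 + B1"
        "count_mod N A1 + count_mod N B1 \<le> count_mod N C + nat (N div d)"
      using less.hyps[of B1 A1] pA pB by blast
    have "A1 + B1 \<subseteq> A + B"
    proof
      fix z assume "z \<in> A1 + B1"
      then obtain x y where xy: "x \<in> A1" "y \<in> B1" "z = x + y" by (auto simp: set_plus_def)
      consider "x \<in> A" | "x - e \<in> B" using xy by (auto simp: A1_def)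
      then show "z \<in> A + B"
      proof cases
        case 1 then show ?thesis using xy by (auto simp: B1_def)
      next
        case 2
        then have "(y + e) + (x - e) \<in> A + B" using xy by (intro set_plus_intro) (auto simp: B1_def)
        then show ?thesis using xy by (simp add: algebra_simps)
      qed
    qed
    then show ?thesis using Cd cnt by (intro exI[of _ C] exI[of _ d]) auto
  qed
qed

lemma divisor_prime_power:
  fixes p m :: nat and d :: int
  assumes "prime p" "d > 0" "d dvd int p ^ m"
  obtains i where "i \<le> m" "d = int p ^ i"
proof -
  have "prime (int p)" using assms(1) by simp
  obtain i where i: "i \<le> m" "normalize d = int p ^ i"
    by (rule divides_primepow[OF \<open>prime (int p)\<close> assms(3)])
  then have "d = int p ^ i" using assms(2) by simp
  then show ?thesis using that i(1) by blast
qed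

text \<open>
  In general the pieces around the elements of \<open>A + B\<close> have incomparable stabilizers, and combining them
  is the hard part of Kneser's theorem. Modulo a prime power the stabilizers form a chain, so the smallest of
  them stabilizes every piece, hence also the union \<open>A + B\<close>.
\<close>

theorem kneser_prime_power:
  fixes p m :: nat
  assumes p: "prime p" and N: "N = int p ^ m" and A: "periodic N A" "A \<noteq> {}" and B: "periodic N B" "B \<noteq> {}"
  obtains d where "d > 0" "d dvd N" "periodic d (A + B)"
    "count_mod N A + count_mod N B \<le> count_mod N (A + B) + nat (N div d)"
proof -
  have N0: "N > 0" using p N by (simp add: prime_gt_0_nat)
  have "\<exists>C d. d > 0 \<and> d dvd N \<and> periodic d C \<and> c \<in> C \<and> C \<subseteq> A + B \<and>
           count_mod N A + count_mod N B \<le> count_mod N C + nat (N div d)" if "c \<in> A + B" for c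
  proof -
    from that obtain a b where "a \<in> A" "b \<in> B" "c = a + b" by (auto simp: set_plus_def)
    then show ?thesis using sumset_contains_periodic_piece[OF N0 A(1) B(1), of a b] by simp
  qed
  then obtain C D where CD: "\<And>c. c \<in> A + B \<Longrightarrow> D c > 0 \<and> D c dvd N \<and> periodic (D c) (C c) \<and> c \<in> C c
      \<and> C c \<subseteq> A + B \<and> count_mod N A + count_mod N B \<le> count_mod N (C c) + nat (N div D c)"
    by metis
  have "D ` (A + B) \<subseteq> {0..N}" using CD N0 by (force dest: zdvd_imp_le)
  then have fin: "finite (D ` (A + B))" by (rule finite_subset) simp
  have "A + B \<noteq> {}" using A B by (auto simp: set_plus_def)
  then have "Max (D ` (A + B)) \<in> D ` (A + B)" using fin by (intro Max_in) auto
  then obtain c0 where c0: "c0 \<in> A + B" "D c0 = Max (D ` (A + B))" by fastforce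
  \<comment> \<open>The divisors of \<open>N\<close> form a chain, so every piece has the largest of the periods.\<close>
  have "periodic (D c0) (C c)" if c: "c \<in> A + B" for c
  proof -
    obtain i where i: "D c = int p ^ i" using divisor_prime_power[OF p, of "D c" m] CD[OF c] N by blast
    obtain j where j: "D c0 = int p ^ j" using divisor_prime_power[OF p, of "D c0" m] CD[OF c0(1)] N by blast
    have "D c \<le> D c0" using c c0 fin by simp
    then have "i \<le> j" using i j prime_gt_1_nat[OF p] by (simp flip: of_nat_power)
    then have "D c dvd D c0" unfolding i j by (rule le_imp_power_dvd)
    then show ?thesis using CD[OF c] periodic_dvd by blast
  qed
  then have "periodic (D c0) (\<Union>c\<in>A + B. C c)" by (auto simp: periodic_def)
  moreover have "(\<Union>c\<in>A + B. C c) = A + B" using CD by blast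
  ultimately have "periodic (D c0) (A + B)" by simp
  moreover have "count_mod N (C c0) \<le> count_mod N (A + B)" using CD c0 by (intro count_mod_mono) auto
  ultimately show ?thesis using that[of "D c0"] CD[OF c0(1)] by auto
qed

text \<open>
  The case of Kneser's theorem in which the only proper subgroup is trivial.
\<close>

theorem cauchy_davenport:
  assumes p: "prime p" and A: "periodic (int p) A" "A \<noteq> {}" and B: "periodic (int p) B" "B \<noteq> {}"
    and ne: "A + B \<noteq> UNIV"
  shows "count_mod (int p) A + count_mod (int p) B \<le> count_mod (int p) (A + B) + 1"
proof -
  obtain d where d: "d > 0" "d dvd int p" "periodic d (A + B)"
    "count_mod (int p) A + count_mod (int p) B \<le> count_mod (int p) (A + B) + nat (int p div d)"
    using kneser_prime_power[OF p _ A B, of 1] by auto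
  obtain i where i: "i \<le> 1" "d = int p ^ i" using divisor_prime_power[OF p d(1), of 1] d(2) by auto
  have "A + B \<noteq> {}" using A B by (auto simp: set_plus_def)
  have "d \<noteq> 1"
  proof
    assume "d = 1"
    with d \<open>A + B \<noteq> {}\<close> obtain x where "periodic 1 (A + B)" "x \<in> A + B" by auto
    then have "y \<in> A + B" for y using periodic_add_mult[of 1 "A + B" x "y - x"] by simp
    with ne show False by auto
  qed
  then have "d = int p" using i by (cases i) auto
  then show ?thesis using d prime_gt_0_nat[OF p] by simp
qed

lemma cauchy_davenport_avoiding:
  assumes p: "prime p" and A: "periodic (int p) A" "A \<noteq> {}" and B: "periodic (int p) B" "B \<noteq> {}"
    and D: "D \<noteq> {}" "(A + B) \<inter> D = {}"
  shows "count_mod (int p) A + count_mod (int p) B + count_mod (int p) D \<le> p + 1"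
proof -
  have "count_mod (int p) (A + B) + count_mod (int p) D \<le> p"
    using count_mod_disjoint[OF _ D(2), of "int p"] prime_gt_0_nat[OF p] by simp
  then show ?thesis using cauchy_davenport[OF p A B] D by fastforce
qed

text \<open>
  Let \<open>d\<close> be the least period of \<open>A + A\<close>. Enlarging \<open>A\<close> to the union \<open>A'\<close> of the classes
  modulo \<open>d\<close> that it meets does not change \<open>A + A\<close>, so \<open>A'\<close> is still sum-free. The period that
  Kneser's theorem gives for \<open>A' + A'\<close> is a multiple of \<open>d\<close>, so in \<open>\<int>/d\<close> the sumset of
  \<open>A'\<close> misses only one of the elements expected from \<open>2 |A'|\<close>, and disjointness from \<open>A'\<close> bounds
  \<open>3 |A'|\<close>. The exponent \<open>i\<close> is positive because otherwise \<open>A'\<close> would be everything.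
\<close>

lemma count_sumfree_prime_power:
  fixes p m :: nat
  assumes p: "prime p" and N: "N = int p ^ m" and A: "periodic N A" "A \<noteq> {}" and free: "(A + A) \<inter> A = {}"
  obtains i c :: nat where "1 \<le> i" "i \<le> m" "3 * c \<le> p ^ i + 1" "count_mod N A \<le> p ^ (m - i) * c"
proof -
  have N0: "N > 0" using p N by (simp add: prime_gt_0_nat)
  obtain d where d: "d > 0" "periodic d (A + A)" and dvd: "\<And>t. periodic t (A + A) \<Longrightarrow> d dvd t"
    using least_period[OF N0 periodic_sumset[OF A(1)]] by blast
  have "d dvd N" using dvd periodic_sumset[OF A(1)] by blast
  then obtain i where i: "i \<le> m" "d = int p ^ i" using divisor_prime_power[OF p d(1), of m] N by auto
  have Nd: "N = d * int (p ^ (m - i))" unfolding N i using i by (simp flip: power_add)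
  define A' where "A' = {x. \<exists>i. x + d * i \<in> A}"
  have perd: "periodic d A'" unfolding A'_def by (rule periodic_extend)
  have perN: "periodic N A'" using periodic_dvd[OF perd \<open>d dvd N\<close>] .
  have sub: "A \<subseteq> A'" unfolding A'_def by (auto intro: exI[of _ 0])
  have sum: "A' + A' = A + A"
  proof
    show "A' + A' \<subseteq> A + A"
    proof
      fix z assume "z \<in> A' + A'"
      then obtain x y i j where "z = x + y" "x + d * i \<in> A" "y + d * j \<in> A"
        by (auto simp: set_plus_def A'_def)
      then have "z + d * (i + j) \<in> A + A"
        using set_plus_intro[of "x + d * i" A "y + d * j" A] by (simp add: algebra_simps)
      then show "z \<in> A + A" using periodic_add_mult[OF d(2)] by blast
    qed
    show "A + A \<subseteq> A' + A'" by (rule set_plus_mono2[OF sub sub])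
  qed
  have free': "(A' + A') \<inter> A' = {}"
    unfolding sum using free periodic_add_mult[OF d(2)] by (auto simp: A'_def)
  have A'ne: "A' \<noteq> {}" using sub A by auto
  obtain d' where d': "d' > 0" "d' dvd N" "periodic d' (A' + A')"
     "count_mod N A' + count_mod N A' \<le> count_mod N (A' + A') + nat (N div d')"
    using kneser_prime_power[OF p N perN A'ne perN A'ne] by blast
  have "d dvd d'" using dvd d'(3) sum by simp
  then have "d \<le> d'" using d' by (intro zdvd_imp_le)
  have "N div d' \<le> N div d" using \<open>d \<le> d'\<close> d(1) N0 by (intro zdiv_mono2) auto
  also have "\<dots> = int (p ^ (m - i))" using d(1) by (simp add: Nd)
  finally have "nat (N div d') \<le> p ^ (m - i)" using nat_le_iff by blast
  moreover have "count_mod N (A' + A') + count_mod N A' \<le> nat N" by (rule count_mod_disjoint[OF N0 free'])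
  ultimately have "3 * count_mod N A' \<le> nat N + p ^ (m - i)" using d'(4) by linarith
  moreover have cA': "count_mod N A' = p ^ (m - i) * count_mod d A'"
    unfolding Nd by (rule count_mod_times[OF d(1) perd])
  moreover have "nat N = p ^ (m - i) * p ^ i" using i by (simp add: N nat_power_eq flip: power_add)
  ultimately have "p ^ (m - i) * (3 * count_mod d A') \<le> p ^ (m - i) * (p ^ i + 1)" by (simp add: algebra_simps)
  then have c: "3 * count_mod d A' \<le> p ^ i + 1"
    using prime_gt_0_nat[OF p] by (simp only: mult_le_cancel1 zero_less_power simp_thms)
  have "i \<noteq> 0"
  proof
    assume "i = 0"
    then have per1: "periodic 1 A'" using perd i by simp
    obtain x where x: "x \<in> A'" using A'ne by auto
    have "y \<in> A'" for y using periodic_add_mult[OF per1, of x "y - x"] x by simp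
    then have "x + x \<in> A'" by blast
    moreover have "x + x \<in> A' + A'" using x by (intro set_plus_intro)
    ultimately show False using free' by blast
  qed
  then show ?thesis using that[of i "count_mod d A'"] i c cA' count_mod_mono[OF sub, of N] by simp
qed

section \<open>Arithmetic progressions modulo a prime and Vosper's theorem\<close>

text \<open>
  Arithmetic progressions in \<open>\<int>/N\<close> whose difference is prime to \<open>N\<close>, as affine images of initial
  intervals. With \<open>n \<le> 0\<close> or \<open>n \<ge> N\<close> this includes the empty set and the whole of \<open>\<int>/N\<close>, which
  saves side conditions on \<open>n\<close>.
\<close>

definition interval_like :: "int \<Rightarrow> int set \<Rightarrow> bool" where
  "interval_like N X \<longleftrightarrow> (\<exists>d a n. coprime d N \<and> (\<forall>x. d * x + a \<in> X \<longleftrightarrow> x mod N < n))"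

lemma count_mod_interval:
  assumes "N > 0" "0 \<le> n" "n \<le> N" shows "count_mod N {x. x mod N < n} = nat n"
proof -
  have "{x. x mod N < n} \<inter> {0..<N} = {0..<n}" using assms by auto
  then show ?thesis by (simp add: count_mod_def)
qed

lemma periodic_residues: "periodic N {x. P (x mod N)}"
  by (simp add: periodic_def)

lemma affine_surj_mod:
  assumes "coprime c (N::int)" obtains x where "(c * x + t) mod N = u mod N"
proof -
  obtain y where y: "[c * y = 1] (mod N)" using assms cong_solve_coprime_int by blast
  have "[c * y * (u - t) = 1 * (u - t)] (mod N)" by (rule cong_mult[OF y cong_refl])
  then have "[c * (y * (u - t)) + t = (u - t) + t] (mod N)" by (intro cong_add) (auto simp: mult.assoc)
  then show ?thesis using that by (auto simp: cong_def)
qed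

lemma sumset_affine:
  assumes c: "coprime c N" and A: "periodic N A" and B: "periodic N B"
  shows "{x. c * x + (a + b) \<in> A + B} = {x. c * x + a \<in> A} + {x. c * x + b \<in> B}"
proof (intro equalityI subsetI)
  fix z assume "z \<in> {x. c * x + (a + b) \<in> A + B}"
  then obtain u v where uv: "u \<in> A" "v \<in> B" "c * z + (a + b) = u + v" by (auto simp: set_plus_def)
  obtain x where x: "(c * x + a) mod N = u mod N" using affine_surj_mod[OF c] by blast
  have "c * (z - x) + b = v + u - (c * x + a)" using uv(3) by (simp add: algebra_simps)
  also have "(\<dots>) mod N = v mod N" using x by (metis add_diff_cancel_right' mod_diff_right_eq)
  finally have "c * (z - x) + b \<in> B" using uv periodic_cong[OF B] by blast
  moreover have "c * x + a \<in> A" using x uv periodic_cong[OF A] by blast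
  ultimately show "z \<in> {x. c * x + a \<in> A} + {x. c * x + b \<in> B}"
    using set_plus_intro[of x "{x. c * x + a \<in> A}" "z - x" "{x. c * x + b \<in> B}"] by simp
next
  fix z assume "z \<in> {x. c * x + a \<in> A} + {x. c * x + b \<in> B}"
  then obtain x y where "c * x + a \<in> A" "c * y + b \<in> B" "z = x + y" by (auto simp: set_plus_def)
  then show "z \<in> {x. c * x + (a + b) \<in> A + B}"
    using set_plus_intro[of "c * x + a" A "c * y + b" B] by (simp add: algebra_simps)
qed

text \<open>
  Each maximal run of consecutive residues in \<open>X\<close> contributes one element to \<open>X + 1\<close> outside
  \<open>X\<close>, so there is only one run.
\<close>

lemma interval_if_small_boundary:
  assumes N: "N > 0" and X: "periodic N X" "X \<noteq> {}"
    and small: "count_mod N (X \<union> {x. x + - 1 \<in> X}) \<le> count_mod N X + 1"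
  obtains a n where "0 < n" "n \<le> N" "\<And>x. x + a \<in> X \<longleftrightarrow> x mod N < n"
proof (cases "X = UNIV")
  case True
  then show ?thesis using that[of N 0] N by simp
next
  case False
  have "\<exists>a. a \<in> X \<and> a - 1 \<notin> X"
  proof (rule ccontr)
    assume "\<not> (\<exists>a. a \<in> X \<and> a - 1 \<notin> X)"
    then have step: "x - 1 \<in> X" if "x \<in> X" for x using that by blast
    obtain x where x: "x \<in> X" using X by auto
    have down: "x - int i \<in> X" for i
      by (induction i) (use x step[of "x - int _"] in \<open>auto simp: algebra_simps\<close>)
    have "y \<in> X" for y
    proof -
      have "x - int (nat ((x - y) mod N)) \<in> X" by (rule down)
      moreover have "(x - int (nat ((x - y) mod N))) mod N = y mod N"
        using N by (simp add: mod_diff_right_eq)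
      ultimately show ?thesis using periodic_cong[OF X(1)] by blast
    qed
    with False show False by auto
  qed
  then obtain a where a: "a \<in> X" "a - 1 \<notin> X" by blast
  define Y where "Y = {x. x + a \<in> X}"
  have pY: "periodic N Y" unfolding Y_def by (rule periodic_shift[OF X(1)])
  have Y0: "0 \<in> Y" "N - 1 \<notin> Y" "-1 \<notin> Y"
    using a periodic_add_mult[OF X(1), of "a - 1" 1] by (auto simp: Y_def algebra_simps)
  define Z where "Z = {x. x + - 1 \<in> Y} - Y"
  have pZ: "periodic N {x. x + - 1 \<in> X}" by (rule periodic_shift[OF X(1)])
  have "count_mod N (Y \<union> Z) + count_mod N (Y \<inter> Z) = count_mod N Y + count_mod N Z" by (rule count_mod_Un_Int)
  moreover have "Y \<inter> Z = {}" by (auto simp: Z_def)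
  moreover have "Y \<union> Z = {x. x + a \<in> X \<union> {x. x + - 1 \<in> X}}" by (auto simp: Y_def Z_def algebra_simps)
  ultimately have "count_mod N Z \<le> 1"
    using small count_mod_shift[OF N periodic_Un[OF X(1) pZ], of a] count_mod_shift[OF N X(1), of a]
    by (simp add: Y_def count_mod_def[of N "{}"])
  then have Z1: "u = v" if "u \<in> Z" "v \<in> Z" "u \<in> {0..<N}" "v \<in> {0..<N}" for u v
    using that card_le_Suc0_iff_eq[of "Z \<inter> {0..<N}"] by (auto simp: count_mod_def)
  \<comment> \<open>Going up from an element of \<open>Y\<close> one leaves \<open>Y\<close> at an element of the boundary \<open>Z\<close>.\<close>
  have exit: "\<exists>m\<in>Z. x < m \<and> m < N \<and> {x..<m} \<subseteq> Y" if x: "x \<in> Y" "0 \<le> x" "x < N" for x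
  proof -
    define m where "m = (LEAST m. x + int m \<notin> Y)"
    have ex: "x + int (nat (N - 1 - x)) \<notin> Y" using Y0 x by simp
    have m: "x + int m \<notin> Y" unfolding m_def using ex by (rule LeastI)
    have le: "m \<le> nat (N - 1 - x)" unfolding m_def using ex by (rule Least_le)
    have less: "x + int i \<in> Y" if "i < m" for i using not_less_Least that unfolding m_def by blast
    have "m > 0" using m x by (cases m) auto
    then have "x + int m \<in> Z" using m less[of "m - 1"] by (auto simp: Z_def of_nat_diff algebra_simps)
    moreover have "{x..<x + int m} \<subseteq> Y"
    proof
      fix y assume "y \<in> {x..<x + int m}"
      then show "y \<in> Y" using less[of "nat (y - x)"] by auto
    qed
    ultimately show ?thesis using \<open>m > 0\<close> le x by (intro bexI[of _ "x + int m"]) auto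
  qed
  obtain m where m: "m \<in> Z" "0 < m" "m < N" "{0..<m} \<subseteq> Y" using exit[OF Y0(1)] N by auto
  have "x \<in> Y \<longleftrightarrow> x < m" if x: "0 \<le> x" "x < N" for x
  proof
    assume xY: "x \<in> Y"
    obtain m' where m': "m' \<in> Z" "x < m'" "m' < N" using exit[OF xY x] by blast
    then show "x < m" using Z1[of m' m] m x by auto
  qed (use m x in auto)
  then have "x + a \<in> X \<longleftrightarrow> x mod N < m" for x
    using periodic_mod[OF pY, of x] N by (simp add: Y_def)
  then show ?thesis using that[of m a] m by simp
qed

lemma interval_boundary:
  assumes "N > 0" "0 < n" "n < N"
  shows "x mod N < n \<or> (x + - 1) mod N < n \<longleftrightarrow> x mod N < n + (1::int)"
proof -
  define r where "r = x mod N"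
  have r: "0 \<le> r" "r < N" using assms by (auto simp: r_def)
  have "(x + - 1) mod N = (r - 1) mod N" by (simp add: r_def mod_diff_left_eq)
  also have "\<dots> = (if r = 0 then N - 1 else r - 1)"
    using r assms zmod_minus1 by (auto simp: mod_pos_pos_trivial)
  finally show ?thesis using r assms by (auto simp: r_def[symmetric])
qed

text \<open>
  The previous lemma for steps of size \<open>d\<close>, by rescaling.
\<close>

lemma count_mod_two_translates:
  assumes N: "N > 0" and d: "coprime d N" and X: "periodic N X" "X \<noteq> {}"
    and small: "count_mod N (X \<union> {x. x + - d \<in> X}) \<le> count_mod N X + 1"
  obtains a n where "0 < n" "n \<le> N" "\<And>x. d * x + a \<in> X \<longleftrightarrow> x mod N < n"
proof -
  define Y where "Y = {x. d * x + 0 \<in> X}"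
  have Y: "periodic N Y" unfolding Y_def by (rule periodic_affine[OF X(1)])
  have cY: "count_mod N Y = count_mod N X" unfolding Y_def by (rule count_mod_affine[OF N X(1) d])
  have "Y \<union> {x. x + - 1 \<in> Y} = {x. d * x + 0 \<in> X \<union> {x. x + - d \<in> X}}"
    by (auto simp: Y_def algebra_simps)
  then have "count_mod N (Y \<union> {x. x + - 1 \<in> Y}) = count_mod N (X \<union> {x. x + - d \<in> X})"
    using count_mod_affine[OF N periodic_Un[OF X(1) periodic_shift[OF X(1)]] d, of 0 "- d"] by simp
  then have small': "count_mod N (Y \<union> {x. x + - 1 \<in> Y}) \<le> count_mod N Y + 1" using small cY by simp
  have "Y \<noteq> {}" using cY count_mod_pos[OF N X] by (auto simp: count_mod_def)
  obtain n a where an: "0 < n" "n \<le> N" "\<And>x. x + a \<in> Y \<longleftrightarrow> x mod N < n"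
    by (rule interval_if_small_boundary[OF N Y \<open>Y \<noteq> {}\<close> small'], blast)
  then show ?thesis using that[of n "d * a"] by (simp add: Y_def algebra_simps)
qed

text \<open>
  A progression of \<open>m\<close> terms is the sum of one of \<open>m - 1\<close> terms and one of 2 terms. If adding the long
  one to \<open>X\<close> enlarges \<open>X\<close> as little as possible, then by Cauchy-Davenport so does adding only the
  two-term one, and \<open>X\<close> consists of a single run.
\<close>

lemma interval_like_summand:
  fixes p :: nat
  assumes p: "prime p" and d: "coprime d (int p)" and D: "\<And>x. d * x + a \<in> D \<longleftrightarrow> x mod int p < m"
    and m: "2 \<le> m" "m \<le> int p" and pD: "periodic (int p) D" and X: "periodic (int p) X" "X \<noteq> {}"
    and small: "count_mod (int p) (D + X) + 1 \<le> nat m + count_mod (int p) X" and ne: "D + X \<noteq> UNIV"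
  shows "\<exists>a' n. \<forall>x. d * x + a' \<in> X \<longleftrightarrow> x mod int p < n"
proof -
  let ?N = "int p"
  have N: "?N > 0" using p by (simp add: prime_gt_0_nat)
  define X1 where "X1 = {x. d * x + 0 \<in> X}"
  have pX1: "periodic ?N X1" unfolding X1_def by (rule periodic_affine[OF X(1)])
  have cX1: "count_mod ?N X1 = count_mod ?N X" unfolding X1_def by (rule count_mod_affine[OF N X(1) d])
  then have X1: "X1 \<noteq> {}" using count_mod_pos[OF N X] by (auto simp: count_mod_def)
  define W where "W = X1 \<union> {x. x + - 1 \<in> X1}"
  have pW: "periodic ?N W" unfolding W_def by (intro periodic_Un periodic_shift pX1)
  define D2 where "D2 = {x. x mod ?N < m - 1}"
  have pD2: "periodic ?N D2" unfolding D2_def by (rule periodic_residues)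
  have cD2: "count_mod ?N D2 = nat (m - 1)" unfolding D2_def using m N by (intro count_mod_interval) auto
  have "{x. d * x + (a + 0) \<in> D + X} = {x. d * x + a \<in> D} + X1"
    unfolding X1_def by (rule sumset_affine[OF d pD X(1)])
  then have pull: "{x. d * x + a \<in> D + X} = {x. x mod ?N < m} + X1" using D by simp
  have sub: "D2 + W \<subseteq> {x. x mod ?N < m} + X1"
  proof
    fix z assume "z \<in> D2 + W"
    then obtain x y where xy: "x \<in> D2" "y \<in> W" "z = x + y" by (auto simp: set_plus_def)
    show "z \<in> {x. x mod ?N < m} + X1"
    proof (cases "y \<in> X1")
      case True then show ?thesis using xy by (auto simp: D2_def)
    next
      case False
      then have "y + - 1 \<in> X1" using xy by (auto simp: W_def)
      moreover have "(x + 1) mod ?N < m"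
      proof -
        have "0 \<le> x mod ?N" "x mod ?N + 1 < m" using xy(1) N by (auto simp: D2_def)
        then have "(x mod ?N + 1) mod ?N = x mod ?N + 1" using m by (intro mod_pos_pos_trivial) auto
        with \<open>x mod ?N + 1 < m\<close> show ?thesis by (simp add: mod_add_left_eq)
      qed
      ultimately have "(x + 1) + (y + - 1) \<in> {x. x mod ?N < m} + X1" by (intro set_plus_intro) auto
      then show ?thesis using xy by simp
    qed
  qed
  have c: "count_mod ?N {x. d * x + a \<in> D + X} = count_mod ?N (D + X)"
    by (rule count_mod_affine[OF N periodic_sumset[OF pD] d])
  have "{x. d * x + a \<in> D + X} \<noteq> UNIV"
  proof
    assume "{x. d * x + a \<in> D + X} = UNIV"
    then have "count_mod ?N UNIV \<le> count_mod ?N (D + X)" using c by simp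
    then have "D + X = UNIV"
      using count_mod_eq_imp_eq[OF N periodic_sumset[OF pD], of UNIV] by (simp add: periodic_def)
    with ne show False by simp
  qed
  then have "D2 + W \<noteq> UNIV" using sub pull by auto
  moreover have "D2 \<noteq> {}" using cD2 m by (auto simp: count_mod_def)
  moreover have "W \<noteq> {}" using X1 by (auto simp: W_def)
  ultimately have "count_mod ?N D2 + count_mod ?N W \<le> count_mod ?N (D2 + W) + 1"
    using cauchy_davenport[OF p pD2 _ pW] by blast
  moreover have "count_mod ?N (D2 + W) \<le> count_mod ?N (D + X)"
    using count_mod_mono[OF sub, of ?N] pull c by simp
  ultimately have "count_mod ?N W \<le> count_mod ?N X1 + 1" using cD2 cX1 small m by linarith
  then have "count_mod ?N (X1 \<union> {x. x + - 1 \<in> X1}) \<le> count_mod ?N X1 + 1" by (simp only: W_def)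
  then obtain n b where "0 < n" "n \<le> ?N" "\<And>x. x + b \<in> X1 \<longleftrightarrow> x mod ?N < n"
    by (rule interval_if_small_boundary[OF N pX1 X1], blast)
  then show ?thesis by (intro exI[of _ "d * b"] exI[of _ n]) (simp add: X1_def algebra_simps)
qed

lemma coprime_prime_int:
  fixes p :: nat assumes "prime p" "\<not> int p dvd d" shows "coprime d (int p)"
  using prime_imp_coprime[of "int p" d] assms by (simp add: coprime_commute)

text \<open>
  A set \<open>Y\<close> of two residues \<open>b\<close> and \<open>b + d\<close> turns \<open>X\<close> into the union of two translates that
  differ by \<open>d\<close>.
\<close>

lemma vosper_sum_two:
  fixes p :: nat
  assumes p: "prime p" and X: "periodic (int p) X" "X \<noteq> {}" and Y: "periodic (int p) Y" "count_mod (int p) Y = 2"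
    and small: "count_mod (int p) (X + Y) \<le> count_mod (int p) X + 1" and lt: "count_mod (int p) X < p"
  shows "interval_like (int p) (X + Y)"
proof -
  let ?N = "int p"
  have N: "?N > 0" using p by (simp add: prime_gt_0_nat)
  obtain b c where bc: "Y \<inter> {0..<?N} = {b, c}" "b \<noteq> c"
    using Y(2) by (auto simp: count_mod_def card_2_iff)
  then have range: "b \<in> {0..<?N}" "c \<in> {0..<?N}" and inY: "b \<in> Y" "c \<in> Y" by blast+
  have Yiff: "y \<in> Y \<longleftrightarrow> y mod ?N = b \<or> y mod ?N = c" for y
  proof -
    have "y \<in> Y \<longleftrightarrow> y mod ?N \<in> Y \<inter> {0..<?N}" using periodic_mod[OF Y(1), of y] N by simp
    then show ?thesis using bc by simp
  qed
  define d where "d = c - b"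
  have "\<not> ?N dvd d"
  proof
    assume "?N dvd d"
    then have "c mod ?N = b mod ?N" by (simp add: d_def mod_eq_dvd_iff)
    then show False using range bc(2) by simp
  qed
  then have d: "coprime d ?N" by (rule coprime_prime_int[OF p])
  define W where "W = X \<union> {x. x + - d \<in> X}"
  have sum: "z \<in> X + Y \<longleftrightarrow> z + - b \<in> W" for z
  proof
    assume "z \<in> X + Y"
    then obtain y where y: "y \<in> Y" "z - y \<in> X" by (auto simp: mem_sumset_iff)
    then consider "y mod ?N = b" | "y mod ?N = c" using Yiff by blast
    then show "z + - b \<in> W"
    proof cases
      case 1
      then have "(z - y) mod ?N = (z - b) mod ?N" by (metis mod_diff_right_eq)
      then have "z - b \<in> X" by (rule periodic_transfer[OF X(1) y(2)])
      then show ?thesis by (simp add: W_def)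
    next
      case 2
      then have "(z - y) mod ?N = (z - c) mod ?N" by (metis mod_diff_right_eq)
      then have "z - c \<in> X" by (rule periodic_transfer[OF X(1) y(2)])
      then show ?thesis by (simp add: W_def d_def)
    qed
  next
    assume "z + - b \<in> W"
    then have "z - b \<in> X \<or> z - c \<in> X" by (simp add: W_def d_def)
    then show "z \<in> X + Y" using inY by (auto simp: mem_sumset_iff)
  qed
  have pW: "periodic ?N W" unfolding W_def by (intro periodic_Un periodic_shift X)
  have "X + Y = {x. x + - b \<in> W}" using sum by blast
  then have "count_mod ?N W \<le> count_mod ?N X + 1" using small count_mod_shift[OF N pW, of "- b"] by simp
  then obtain a n where n: "0 < n" "n \<le> ?N" and an: "\<And>x. d * x + a \<in> X \<longleftrightarrow> x mod ?N < n"
    unfolding W_def by (rule count_mod_two_translates[OF N d X], blast)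
  have "nat n = count_mod ?N X"
    using count_mod_interval[of ?N n] count_mod_affine[OF N X(1) d, of a] n N by (simp add: an)
  then have "n < ?N" using lt n by linarith
  have "d * x + (a + b) \<in> X + Y \<longleftrightarrow> x mod ?N < n + 1" for x
  proof -
    have "d * x + (a + b) \<in> X + Y \<longleftrightarrow> d * x + a \<in> X \<or> d * (x + - 1) + a \<in> X"
      unfolding sum by (simp add: W_def algebra_simps)
    then show ?thesis unfolding an using interval_boundary[OF N n(1) \<open>n < ?N\<close>] by blast
  qed
  then show ?thesis using d unfolding interval_like_def by blast
qed

text \<open>
  Induction on the size of \<open>Y\<close> by Dyson's transform. A transform that leaves at least two but not all
  elements of \<open>Y\<close> does not change the sumset, because Cauchy-Davenport already gives it the full size;
  the induction hypothesis then describes \<open>X + Y\<close>. This is why the conclusion is about the sum and not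
  about \<open>X\<close> and \<open>Y\<close>. If no such transform exists, each \<open>a \<in> X\<close> either keeps all of \<open>Y\<close> (the
  set \<open>E\<close>) or only \<open>b\<close> (the set \<open>F\<close>), and Cauchy-Davenport for \<open>E + Y\<close> and for
  \<open>F + (Y - {b})\<close> is contradictory as soon as \<open>Y\<close> has three elements.
\<close>

lemma vosper_sum:
  fixes p :: nat
  assumes p: "prime p" and "periodic (int p) X" "2 \<le> count_mod (int p) X"
    and "periodic (int p) Y" "2 \<le> count_mod (int p) Y"
    and "count_mod (int p) (X + Y) + 1 \<le> count_mod (int p) X + count_mod (int p) Y"
    and "count_mod (int p) X + count_mod (int p) Y + 1 \<le> p"
  shows "interval_like (int p) (X + Y)"
  using assms(2-)
proof (induction "count_mod (int p) Y" arbitrary: X Y rule: less_induct)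
  case less
  let ?N = "int p"
  let ?c = "count_mod (int p)"
  have N: "?N > 0" using p by (simp add: prime_gt_0_nat)
  note X = less.prems(1,2) and Y = less.prems(3,4) and small = less.prems(5) and big = less.prems(6)
  have X0: "X \<noteq> {}" and Y0: "Y \<noteq> {}" using X Y by (auto simp: count_mod_def)
  have not_UNIV: "S \<noteq> UNIV" if "?c S < p" for S
    using that count_mod_UNIV[OF N] by auto
  show ?case
  proof (cases "?c Y = 2")
    case True
    then show ?thesis using small big by (intro vosper_sum_two p X(1) X0 Y(1)) auto
  next
    case False
    with Y have Y3: "3 \<le> ?c Y" by simp
    obtain b where b: "b \<in> Y" using Y0 by auto
    define U where "U e = X \<union> {x. x + - e \<in> Y}" for e
    define V where "V e = Y \<inter> {x. x + e \<in> X}" for e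
    have pU: "periodic ?N (U e)" and pV: "periodic ?N (V e)" for e
      unfolding U_def V_def by (intro periodic_Un periodic_Int periodic_shift X Y)+
    have cnt: "?c (U e) + ?c (V e) = ?c X + ?c Y" for e
    proof -
      have "V e = {x. x + e \<in> X \<inter> {x. x + - e \<in> Y}}" by (auto simp: V_def)
      then have "?c (V e) = ?c (X \<inter> {x. x + - e \<in> Y})"
        using count_mod_shift[OF N periodic_Int[OF X(1) periodic_shift[OF Y(1), of "- e"]], of e] by metis
      then show ?thesis
        using count_mod_Un_Int[of ?N X "{x. x + - e \<in> Y}"] count_mod_shift[OF N Y(1), of "- e"]
        by (simp add: U_def)
    qed
    have sub: "U e + V e \<subseteq> X + Y" for e
    proof
      fix z assume "z \<in> U e + V e"
      then obtain x y where xy: "x \<in> U e" "y \<in> V e" "z = x + y" by (auto simp: set_plus_def)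
      then consider "x \<in> X" | "x - e \<in> Y" by (auto simp: U_def)
      then show "z \<in> X + Y"
      proof cases
        case 1 then show ?thesis using xy by (auto simp: V_def)
      next
        case 2
        then have "(y + e) + (x - e) \<in> X + Y" using xy by (intro set_plus_intro) (auto simp: V_def)
        moreover have "(y + e) + (x - e) = z" using xy by simp
        ultimately show ?thesis by metis
      qed
    qed
    show ?thesis
    proof (cases "\<exists>a\<in>X. 2 \<le> ?c (V (a - b)) \<and> ?c (V (a - b)) < ?c Y")
      case True
      then obtain e where e: "2 \<le> ?c (V e)" "?c (V e) < ?c Y" by blast
      have XU: "?c X \<le> ?c (U e)" by (intro count_mod_mono) (auto simp: U_def)
      have le: "?c (U e + V e) \<le> ?c (X + Y)" by (rule count_mod_mono[OF sub])
      have "interval_like ?N (U e + V e)"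
        using e XU le X(2) small big cnt[of e] by (intro less.hyps pU pV) auto
      moreover have "U e + V e = X + Y"
      proof (rule count_mod_eq_imp_eq[OF N _ _ sub])
        have "U e \<noteq> {}" "V e \<noteq> {}" using e XU X by (auto simp: count_mod_def)
        then have "?c (U e) + ?c (V e) \<le> ?c (U e + V e) + 1"
          using le small big by (intro cauchy_davenport[OF p pU _ pV] not_UNIV) auto
        then show "?c (X + Y) \<le> ?c (U e + V e)" using small cnt[of e] by simp
      qed (intro periodic_sumset pU X)+
      ultimately show ?thesis by simp
    next
      case False
      define E where "E = {a \<in> X. \<forall>y\<in>Y. y + (a - b) \<in> X}"
      define F where "F = X - E"
      have pE: "periodic ?N E"
      proof -
        have "y + (a + ?N - b) \<in> X \<longleftrightarrow> y + (a - b) \<in> X" for y a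
          using periodic_add_mult[OF X(1), of "y + (a - b)" 1] by (simp add: algebra_simps)
        then show ?thesis using X(1) unfolding E_def periodic_def by simp
      qed
      have pF: "periodic ?N F" unfolding F_def Diff_eq by (intro periodic_Int periodic_Compl pE X)
      have cX: "?c E + ?c F = ?c X"
      proof -
        have "E \<union> F = X" "E \<inter> F = {}" by (auto simp: E_def F_def)
        then show ?thesis using count_mod_Un_Int[of ?N E F] by (simp add: count_mod_def)
      qed
      have F2: "2 \<le> ?c F"
      proof (cases "E = {}")
        case True
        then show ?thesis using cX X by (simp add: count_mod_def)
      next
        case E0: False
        have "E + Y \<subseteq> {x. x + - b \<in> X}"
          by (auto simp: E_def set_plus_def algebra_simps)
        then have le: "?c (E + Y) \<le> ?c X" using count_mod_mono count_mod_shift[OF N X(1), of "- b"] by metis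
        then have "?c E + ?c Y \<le> ?c (E + Y) + 1"
          using big Y by (intro cauchy_davenport[OF p pE E0 Y(1) Y0] not_UNIV) auto
        then show ?thesis using le cX Y3 by linarith
      qed
      define R where "R = {x. ?N dvd x - b}"
      have pR: "periodic ?N R"
      proof -
        have "x + ?N - b = (x - b) + ?N" for x by simp
        then show ?thesis unfolding periodic_def R_def by (metis dvd_add_triv_right_iff mem_Collect_eq)
      qed
      define Y' where "Y' = Y - R"
      have pY': "periodic ?N Y'" unfolding Y'_def Diff_eq by (intro periodic_Int periodic_Compl pR Y)
      have cY': "?c Y' + 1 = ?c Y"
      proof -
        have "R \<subseteq> Y"
        proof
          fix x assume "x \<in> R"
          then have "x mod ?N = b mod ?N" by (simp add: R_def mod_eq_dvd_iff)
          then show "x \<in> Y" using periodic_transfer[OF Y(1) b] by simp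
        qed
        then have "R \<union> Y' = Y" "R \<inter> Y' = {}" by (auto simp: Y'_def)
        then show ?thesis using count_mod_Un_Int[of ?N R Y'] count_mod_residue_class[OF N, of b]
          by (simp add: count_mod_def[of _ "{}"] R_def)
      qed
      \<comment> \<open>For \<open>a \<in> F\<close> the only element of \<open>Y\<close> that the transform keeps is \<open>b\<close>.\<close>
      have single: "y + (a - b) \<notin> X" if a: "a \<in> F" and y: "y \<in> Y'" for a y
      proof
        assume yX: "y + (a - b) \<in> X"
        have aX: "a \<in> X" and aE: "a \<notin> E" using a by (auto simp: F_def)
        have "R \<union> {x. ?N dvd x - y} \<subseteq> V (a - b)"
        proof
          fix x assume "x \<in> R \<union> {x. ?N dvd x - y}"
          then consider "x mod ?N = b mod ?N" | "x mod ?N = y mod ?N" by (auto simp: R_def mod_eq_dvd_iff)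
          then show "x \<in> V (a - b)"
          proof cases
            case 1
            have "x \<in> Y" using 1 periodic_transfer[OF Y(1) b] by simp
            moreover have "(b + (a - b)) mod ?N = (x + (a - b)) mod ?N" using 1 by (metis mod_add_left_eq)
            then have "x + (a - b) \<in> X" using periodic_transfer[OF X(1), of "b + (a - b)"] aX by simp
            ultimately show ?thesis by (simp add: V_def)
          next
            case 2
            have "x \<in> Y" using 2 y periodic_transfer[OF Y(1), of y] by (simp add: Y'_def)
            moreover have "(y + (a - b)) mod ?N = (x + (a - b)) mod ?N" using 2 by (metis mod_add_left_eq)
            then have "x + (a - b) \<in> X" by (rule periodic_transfer[OF X(1) yX])
            ultimately show ?thesis by (simp add: V_def)
          qed
        qed
        then have "?c (R \<union> {x. ?N dvd x - y}) \<le> ?c (V (a - b))" by (rule count_mod_mono)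
        moreover have "R \<inter> {x. ?N dvd x - y} = {}"
        proof -
          have "?N dvd y - b" if "?N dvd x - b" "?N dvd x - y" for x
            using dvd_diff[OF that] by simp
          then show ?thesis using y by (auto simp: R_def Y'_def)
        qed
        then have "?c (R \<union> {x. ?N dvd x - y}) = 2"
          using count_mod_Un_Int[of ?N R "{x. ?N dvd x - y}"] count_mod_residue_class[OF N]
          by (simp add: count_mod_def[of _ "{}"] R_def)
        moreover have "V (a - b) \<subseteq> Y" by (auto simp: V_def)
        moreover have "V (a - b) \<noteq> Y" using aX aE by (auto simp: V_def E_def)
        then have "?c (V (a - b)) < ?c Y"
          using count_mod_eq_imp_eq[OF N pV Y(1) \<open>V (a - b) \<subseteq> Y\<close>] by force
        ultimately show False using False aX by simp
      qed
      have "(F + Y') \<inter> {x. x + - b \<in> X} = {}"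
        using single by (auto simp: set_plus_def algebra_simps)
      moreover have "{x. x + - b \<in> X} \<subseteq> X + Y" using b by (auto simp: mem_sumset_iff)
      moreover have "F + Y' \<subseteq> X + Y" by (intro set_plus_mono2) (auto simp: F_def Y'_def)
      ultimately have "?c (F + Y') + ?c X \<le> ?c (X + Y)"
        using count_mod_Un_Int[of ?N "F + Y'" "{x. x + - b \<in> X}"] count_mod_shift[OF N X(1), of "- b"]
          count_mod_mono[of "(F + Y') \<union> {x. x + - b \<in> X}" "X + Y" ?N]
        by (simp add: count_mod_def[of _ "{}"])
      moreover have "?c F + ?c Y' \<le> ?c (F + Y') + 1"
      proof (intro cauchy_davenport[OF p pF _ pY'] not_UNIV)
        show "F \<noteq> {}" "Y' \<noteq> {}" using F2 cY' Y3 by (auto simp: count_mod_def)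
        show "?c (F + Y') < p" using calculation small big by linarith
      qed
      ultimately show ?thesis using F2 cY' small Y3 by linarith
    qed
  qed
qed

text \<open>
  The complement \<open>D\<close> of \<open>X + Y\<close> is a progression together with \<open>X + Y\<close>. The sum of \<open>D\<close> and
  \<open>-X\<close> avoids \<open>Y\<close>, hence is as small as Cauchy-Davenport allows, so \<open>-X\<close> is a progression by
  \<open>interval_like_summand\<close>.
\<close>

theorem vosper:
  fixes p :: nat
  assumes p: "prime p" and X: "periodic (int p) X" "2 \<le> count_mod (int p) X"
    and Y: "periodic (int p) Y" "2 \<le> count_mod (int p) Y"
    and small: "count_mod (int p) (X + Y) + 1 \<le> count_mod (int p) X + count_mod (int p) Y"
    and big: "count_mod (int p) X + count_mod (int p) Y + 1 \<le> p"
  shows "interval_like (int p) X"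
proof -
  let ?N = "int p"
  let ?c = "count_mod (int p)"
  have N: "?N > 0" using p by (simp add: prime_gt_0_nat)
  have X0: "X \<noteq> {}" and Y0: "Y \<noteq> {}" using X Y by (auto simp: count_mod_def)
  have pXY: "periodic ?N (X + Y)" by (rule periodic_sumset[OF X(1)])
  obtain d a n where d: "coprime d ?N" and an: "\<And>x. d * x + a \<in> X + Y \<longleftrightarrow> x mod ?N < n"
    using vosper_sum[OF assms] by (auto simp: interval_like_def)
  define n' where "n' = max 0 (min ?N n)"
  have n': "0 \<le> n'" "n' \<le> ?N" using N by (auto simp: n'_def)
  have an': "d * x + a \<in> X + Y \<longleftrightarrow> x mod ?N < n'" for x
    unfolding an n'_def using pos_mod_bound[OF N, of x] pos_mod_sign[OF N, of x] by linarith
  have "nat n' = ?c (X + Y)"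
    using count_mod_interval[OF N n'] count_mod_affine[OF N pXY d, of a] by (simp add: an')
  moreover have "?c (X + Y) \<noteq> p" using small big by linarith
  then have "X + Y \<noteq> UNIV" using count_mod_UNIV[OF N] by auto
  then have "?c X + ?c Y \<le> ?c (X + Y) + 1" by (rule cauchy_davenport[OF p X(1) X0 Y(1) Y0])
  ultimately have n: "nat n' + 1 = ?c X + ?c Y" using small by linarith
  define D where "D = - (X + Y)"
  define X' where "X' = {x. (-1) * x + 0 \<in> X}"
  have pX': "periodic ?N X'" unfolding X'_def by (rule periodic_affine[OF X(1)])
  have cX': "?c X' = ?c X" unfolding X'_def by (rule count_mod_affine[OF N X(1)]) simp
  then have X'0: "X' \<noteq> {}" using X by (auto simp: count_mod_def)
  have pD: "periodic ?N D" unfolding D_def by (rule periodic_Compl[OF pXY])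
  have D: "d * x + (a + d * n') \<in> D \<longleftrightarrow> x mod ?N < ?N - n'" for x
  proof -
    define r where "r = x mod ?N"
    have r: "0 \<le> r" "r < ?N" using N by (auto simp: r_def)
    have "d * x + (a + d * n') \<in> D \<longleftrightarrow> \<not> (x + n') mod ?N < n'"
      unfolding D_def Compl_iff using an'[of "x + n'"] by (simp add: algebra_simps)
    moreover have "(x + n') mod ?N = (if r + n' < ?N then r + n' else r + n' - ?N)"
    proof -
      have "(x + n') mod ?N = (r + n') mod ?N" by (simp add: r_def mod_add_left_eq)
      also have "\<dots> = (if r + n' < ?N then r + n' else r + n' - ?N)"
      proof (cases "r + n' < ?N")
        case False
        have "(r + n') mod ?N = (r + n' - ?N) mod ?N" by simp
        then show ?thesis using False r n' by (simp del: minus_mod_self2)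
      qed (use r n' in simp)
      finally show ?thesis .
    qed
    ultimately show ?thesis using r n' unfolding r_def[symmetric] by auto
  qed
  have disj: "(D + X') \<inter> Y = {}"
  proof -
    have False if "u \<in> D" "v \<in> X'" "u + v \<in> Y" for u v
    proof -
      have "- v \<in> X" using that by (simp add: X'_def)
      then have "- v + (u + v) \<in> X + Y" using that by (intro set_plus_intro)
      then show False using that by (simp add: D_def)
    qed
    then show ?thesis by (auto simp: set_plus_def)
  qed
  have "?c (D + X') + ?c Y \<le> p" using count_mod_disjoint[OF N disj] by simp
  then have "?c (D + X') + 1 \<le> nat (?N - n') + ?c X'" using n cX' n' by linarith
  moreover have "D + X' \<noteq> UNIV" using disj Y0 by auto
  ultimately obtain a' k where k: "\<And>x. d * x + a' \<in> X' \<longleftrightarrow> x mod ?N < k"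
    using interval_like_summand[OF p d D _ _ pD pX' X'0] n big n' by fastforce
  have "(- d) * x + (- a') \<in> X \<longleftrightarrow> x mod ?N < k" for x
    using k[of x] by (simp add: X'_def)
  moreover have "coprime (- d) ?N" using d by simp
  ultimately show ?thesis unfolding interval_like_def by blast
qed

section \<open>Sum-free sets in a plane over a prime field\<close>

lemma count_le_hull:
  assumes N: "N > 0" and R: "periodic N R" and uv: "v - u < N"
    and hull: "\<And>x. x \<in> R \<Longrightarrow> \<exists>i. u \<le> x + N * i \<and> x + N * i \<le> v"
  shows "int (count_mod N R) \<le> max 0 (v - u + 1)"
proof -
  have "{x. x + u \<in> R} \<inter> {0..<N} \<subseteq> {0..v - u}"
  proof
    fix x assume x: "x \<in> {x. x + u \<in> R} \<inter> {0..<N}"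
    then obtain i where i: "0 \<le> x + N * i" "x + N * i \<le> v - u" using hull[of "x + u"] by auto
    then have "(x + N * i) mod N = x + N * i" using uv by (intro mod_pos_pos_trivial) auto
    then show "x \<in> {0..v - u}" using x i by simp
  qed
  then have "card ({x. x + u \<in> R} \<inter> {0..<N}) \<le> card {0..v - u}" by (intro card_mono) auto
  moreover have "card ({x. x + u \<in> R} \<inter> {0..<N}) = count_mod N R"
    using count_mod_shift[OF N R, of u] by (simp only: count_mod_def)
  ultimately show ?thesis by simp
qed

lemma window_representative:
  assumes "N > (0::int)" obtains i where "u \<le> x + N * i" "x + N * i < u + N"
proof
  have eq: "x + N * (- ((x - u) div N)) = u + (x - u) mod N"
    by (simp add: minus_mult_div_eq_mod[symmetric] algebra_simps)
  show "u \<le> x + N * (- ((x - u) div N))" "x + N * (- ((x - u) div N)) < u + N"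
    unfolding eq using assms by auto
qed

text \<open>
  Since the differences within a row avoid row 0, which is \<open>{k + 1..2 k}\<close>, all elements of a row fit into an
  interval \<open>{u..v}\<close> with \<open>v - u \<le> k\<close>. Adding row 1, which is \<open>{0..k}\<close>, shows that the next row avoids
  \<open>{u..v + k}\<close>, so it fits into an interval \<open>{u'..v'}\<close> between \<open>v + k + 1\<close> and \<open>u + 3 k\<close>.
  With the slacks \<open>s\<close> and \<open>t\<close> at the two ends, \<open>u + v\<close> grows by \<open>4 k + 1 + s - t\<close> in each
  step, and \<open>s + t\<close> is what the lengths lose. After \<open>p\<close> steps the interval is that of row 0 again, moved
  by a multiple of \<open>p\<close>, so \<open>u + v\<close> has grown by an even multiple of \<open>p\<close>. As
  \<open>p (4 k + 1)\<close> is an odd multiple, the slacks add up to at least \<open>p\<close>.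
\<close>

lemma winding_bound:
  fixes R :: "int \<Rightarrow> int set" and p k :: nat
  assumes p: "p = 3 * k + 1" and k: "k > 0"
    and per: "\<And>j. periodic (int p) (R j)" and index: "R (int p) = R 0"
    and free: "\<And>i j x y. x \<in> R i \<Longrightarrow> y \<in> R j \<Longrightarrow> x + y \<notin> R (i + j)"
    and ne: "\<And>j. R j \<noteq> {}"
    and R1: "\<And>x. x \<in> R 1 \<longleftrightarrow> x mod int p < int k + 1"
    and R0: "count_mod (int p) (R 0) = k"
  shows "(\<Sum>j<p. count_mod (int p) (R (int j))) \<le> k * p"
proof -
  define N where "N = int p"
  define K where "K = int k"
  have N: "N = 3 * K + 1" "N > 0" "K > 0" using p k by (auto simp: N_def K_def)
  note per = per[folded N_def] and R1 = R1[folded N_def K_def] and index = index[folded N_def]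
  have in1: "t \<in> R 1" if "0 \<le> t" "t \<le> K" for t using that N by (simp add: R1)
  have sub0: "K + 1 \<le> x mod N \<and> x mod N \<le> 2 * K" if x: "x \<in> R 0" for x
  proof -
    define r where "r = x mod N"
    have r: "0 \<le> r" "r < N" unfolding r_def using pos_mod_sign[OF N(2)] pos_mod_bound[OF N(2)] by blast+
    have "x \<notin> R 1" using free[OF x in1[of 0]] N by simp
    moreover have "x + K \<notin> R 1" using free[OF x in1[of K]] N by simp
    moreover have "(x + K) mod N < K + 1" if "r > 2 * K"
    proof -
      have "(x + K) mod N = (r + K - N) mod N" by (simp add: r_def mod_add_left_eq mod_diff_left_eq)
      also have "\<dots> = r + K - N" using that r N by (intro mod_pos_pos_trivial) auto
      finally show ?thesis using r N by simp
    qed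
    ultimately have "\<not> r < K + 1" "\<not> r > 2 * K" unfolding R1 r_def[symmetric] by blast+
    then show ?thesis unfolding r_def by simp
  qed
  have R0_iff: "x \<in> R 0 \<longleftrightarrow> K + 1 \<le> x mod N \<and> x mod N \<le> 2 * K" for x
  proof -
    let ?M = "{x. K + 1 \<le> x mod N \<and> x mod N \<le> 2 * K}"
    have "?M \<inter> {0..<N} = {K + 1..2 * K}" using N by auto
    then have "count_mod N ?M = k" by (simp add: count_mod_def K_def)
    then have "R 0 = ?M"
      using sub0 R0 by (intro count_mod_eq_imp_eq[OF N(2) per periodic_residues]) (auto simp: N_def)
    then show ?thesis by blast
  qed
  have in0: "t \<in> R 0" if "K + 1 \<le> t" "t \<le> 2 * K" for t using that N by (simp add: R0_iff)
  have diff: "v - u \<le> K" if "u \<in> R j" "v \<in> R j" "v - u \<le> 2 * K" for u v j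
  proof (rule ccontr)
    assume "\<not> ?thesis"
    then have "v - u \<in> R 0" using that by (intro in0) auto
    then show False using free[of "v - u" 0 u j] that by simp
  qed
  define H where "H j u v \<longleftrightarrow> u \<in> R j \<and> v \<in> R j \<and> u \<le> v \<and> v \<le> u + K \<and>
    (\<forall>x\<in>R j. \<exists>i. u \<le> x + N * i \<and> x + N * i \<le> v)" for j u v
  have step: "\<exists>u' v'. H (j + 1) u' v' \<and> v + K + 1 \<le> u' \<and> v' \<le> u + 3 * K" if "H j u v" for j u v
  proof -
    have uv: "u \<in> R j" "v \<in> R j" "u \<le> v" "v \<le> u + K" using that by (auto simp: H_def)
    define S where "S = R (j + 1) \<inter> {v + K + 1..u + 3 * K}"
    have avoid: "w \<notin> R (j + 1)" if "u \<le> w" "w \<le> v + K" for w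
    proof (cases "w \<le> u + K")
      case True
      then show ?thesis using free[OF uv(1) in1[of "w - u"]] that by simp
    next
      case False
      then show ?thesis using free[OF uv(2) in1[of "w - v"]] that uv by simp
    qed
    have hull: "\<exists>i. x + N * i \<in> S" if x: "x \<in> R (j + 1)" for x
    proof -
      obtain i where i: "u \<le> x + N * i" "x + N * i < u + N" using window_representative[OF N(2)] by blast
      have "x + N * i \<in> R (j + 1)" using x periodic_add_mult[OF per] by simp
      then have "x + N * i \<in> S" using i avoid[of "x + N * i"] N by (force simp: S_def)
      then show ?thesis by blast
    qed
    have "finite S" by (simp add: S_def)
    moreover have "S \<noteq> {}" using hull ne[of "j + 1"] by blast
    ultimately have S: "finite S" "S \<noteq> {}" .
    have mem: "Min S \<in> S" "Max S \<in> S" using S by auto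
    then have *: "Min S \<in> R (j + 1)" "Max S \<in> R (j + 1)" "v + K + 1 \<le> Min S" "Max S \<le> u + 3 * K"
      by (auto simp: S_def)
    have "H (j + 1) (Min S) (Max S)"
      unfolding H_def
    proof (intro conjI ballI)
      show "Max S \<le> Min S + K" using diff[OF *(1,2)] * uv by simp
      show "Min S \<le> Max S" using S mem by simp
      fix x assume "x \<in> R (j + 1)"
      then obtain i where "x + N * i \<in> S" using hull by blast
      then show "\<exists>i. Min S \<le> x + N * i \<and> x + N * i \<le> Max S" using S by (intro exI[of _ i]) auto
    qed (use * in auto)
    then show ?thesis using * by blast
  qed
  \<comment> \<open>The interval around row 0 is unique up to multiples of \<open>p\<close>, so the walk closes up.\<close>
  have H0: "\<exists>i. u = K + 1 + N * i \<and> v = 2 * K + N * i" if "H 0 u v" for u v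
  proof -
    have uv: "u \<in> R 0" "v \<in> R 0" "u \<le> v" "v \<le> u + K"
      and hull: "\<And>x. x \<in> R 0 \<Longrightarrow> \<exists>i. u \<le> x + N * i \<and> x + N * i \<le> v" using that by (auto simp: H_def)
    obtain i where i: "u \<le> K + 1 + N * i" "K + 1 + N * i \<le> v" using hull[OF in0[of "K + 1"]] N by auto
    obtain i' where i': "u \<le> 2 * K + N * i'" "2 * K + N * i' \<le> v" using hull[OF in0[of "2 * K"]] N by auto
    define q where "q = u div N"
    define q' where "q' = v div N"
    have u: "u = u mod N + N * q" "K + 1 \<le> u mod N" "u mod N \<le> 2 * K" using uv R0_iff by (auto simp: q_def)
    have v: "v = v mod N + N * q'" "K + 1 \<le> v mod N" "v mod N \<le> 2 * K" using uv R0_iff by (auto simp: q'_def)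
    have cmp: "a = b" if "- N < N * (a - b)" "N * (a - b) < N" for a b :: int
    proof -
      have "- 1 < a - b" using that(1) N mult_less_cancel_left_pos[of N "- 1" "a - b"] by simp
      moreover have "a - b < 1" using that(2) N mult_less_cancel_left_pos[of N "a - b" 1] by simp
      ultimately show ?thesis by simp
    qed
    have iq: "i = q" using i u uv N by (intro cmp) (auto simp: algebra_simps)
    have i'q: "i' = q'" using i' v uv N by (intro cmp) (auto simp: algebra_simps)
    have "q' = q" using u v uv N by (intro cmp) (auto simp: algebra_simps)
    then have "u = K + 1 + N * q" "v = 2 * K + N * q" using i i' u v iq i'q by auto
    then show ?thesis by blast
  qed
  have "\<exists>f. \<forall>n. H (int n) (fst (f n)) (snd (f n)) \<and>
      (snd (f n) + K + 1 \<le> fst (f (Suc n)) \<and> snd (f (Suc n)) \<le> fst (f n) + 3 * K)"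
  proof (rule dependent_nat_choice)
    have "H 0 (K + 1) (2 * K)"
      unfolding H_def
    proof (intro conjI ballI)
      fix x assume x: "x \<in> R 0"
      have "x + N * (- (x div N)) = x mod N" by (simp add: minus_mult_div_eq_mod)
      then show "\<exists>i. K + 1 \<le> x + N * i \<and> x + N * i \<le> 2 * K"
        using sub0[OF x] by (intro exI[of _ "- (x div N)"]) simp
    qed (use N in0 in auto)
    then show "\<exists>x. H (int 0) (fst x) (snd x)" by (intro exI[of _ "(K + 1, 2 * K)"]) simp
  next
    fix x n assume "H (int n) (fst x) (snd x)"
    from step[OF this] obtain u' v' where "H (int n + 1) u' v'" "snd x + K + 1 \<le> u'" "v' \<le> fst x + 3 * K"
      by blast
    then show "\<exists>y. H (int (Suc n)) (fst y) (snd y) \<and> snd x + K + 1 \<le> fst y \<and> snd y \<le> fst x + 3 * K"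
      by (intro exI[of _ "(u', v')"]) (simp add: add.commute)
  qed
  then obtain f where f: "\<And>n. H (int n) (fst (f n)) (snd (f n))"
    "\<And>n. snd (f n) + K + 1 \<le> fst (f (Suc n))" "\<And>n. snd (f (Suc n)) \<le> fst (f n) + 3 * K"
    by blast
  define u where "u n = fst (f n)" for n
  define v where "v n = snd (f n)" for n
  note f = f[folded u_def v_def]
  define s where "s n = u (Suc n) - v n - K - 1" for n
  define t where "t n = u n + 3 * K - v (Suc n)" for n
  have st: "s n \<ge> 0" "t n \<ge> 0" for n using f(2,3)[of n] by (auto simp: s_def t_def)
  obtain i where i: "u 0 = K + 1 + N * i" "v 0 = 2 * K + N * i" using H0 f(1)[of 0] by auto
  have "H 0 (u p) (v p)" using f(1)[of p] index unfolding H_def N_def by simp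
  then obtain i' where i': "u p = K + 1 + N * i'" "v p = 2 * K + N * i'" using H0 by blast
  have tele: "(\<Sum>n<p. g (Suc n) - g n) = g p - g 0" for g :: "nat \<Rightarrow> int"
    by (rule sum_lessThan_telescope)
  define L where "L = (\<Sum>n<p. v n - u n)"
  \<comment> \<open>Summing \<open>s - t\<close> measures how far the intervals move, summing \<open>s + t\<close> their lengths.\<close>
  have "(\<Sum>n<p. s n - t n) = (\<Sum>n<p. ((u (Suc n) + v (Suc n)) - (u n + v n)) - (4 * K + 1))"
    by (intro sum.cong) (auto simp: s_def t_def)
  also have "\<dots> = (u p + v p) - (u 0 + v 0) - N * (4 * K + 1)"
    by (subst sum_subtractf, subst tele) (simp add: N_def)
  also have "\<dots> = N * (2 * (i' - i - 2 * K) - 1)" by (simp add: i i' algebra_simps)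
  finally have signed: "(\<Sum>n<p. s n - t n) = N * (2 * (i' - i - 2 * K) - 1)" .
  have "(\<Sum>n<p. s n + t n) = (\<Sum>n<p. (2 * K - 1) - 2 * (v n - u n) - ((v (Suc n) - u (Suc n)) - (v n - u n)))"
    by (intro sum.cong) (auto simp: s_def t_def)
  also have "\<dots> = N * (2 * K - 1) - 2 * L - ((v p - u p) - (v 0 - u 0))"
    by (subst sum_subtractf, subst tele) (simp add: sum_subtractf N_def L_def sum_distrib_left)
  also have "\<dots> = N * (2 * K - 1) - 2 * L" by (simp add: i i')
  finally have unsigned: "(\<Sum>n<p. s n + t n) = N * (2 * K - 1) - 2 * L" .
  \<comment> \<open>The signed sum is an odd multiple of \<open>N\<close>, so it cannot vanish.\<close>
  have "N * 1 \<le> N * \<bar>2 * (i' - i - 2 * K) - 1\<bar>" using N by (intro mult_left_mono) presburger+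
  also have "\<dots> = \<bar>\<Sum>n<p. s n - t n\<bar>" unfolding signed using N by (simp add: abs_mult)
  also have "\<dots> \<le> (\<Sum>n<p. \<bar>s n - t n\<bar>)" by (rule sum_abs)
  also have "\<dots> \<le> (\<Sum>n<p. s n + t n)" using st by (intro sum_mono) (simp add: abs_le_iff)
  finally have L: "2 * L + N \<le> N * (2 * K - 1)" unfolding unsigned by simp
  have "int (count_mod N (R (int n))) \<le> v n - u n + 1" for n
    using count_le_hull[OF N(2) per, of "v n" "u n" "int n"] f(1)[of n] N unfolding H_def by force
  then have "int (\<Sum>n<p. count_mod N (R (int n))) \<le> (\<Sum>n<p. v n - u n + 1)"
    by (simp add: sum_mono)
  also have "\<dots> = L + N" by (simp add: L_def sum.distrib N_def)
  also have "\<dots> \<le> K * N" using L by (simp add: algebra_simps)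
  also have "\<dots> = int (k * p)" by (simp add: K_def N_def)
  finally show ?thesis by (simp add: N_def del: of_nat_sum of_nat_mult)
qed

text \<open>
  \<open>A j\<close> is row \<open>j\<close> of a sum-free subset of the plane \<open>(\<int>/p)\<^sup>2\<close>, and row 0 is as large as a sum-free
  subset of \<open>\<int>/p\<close> can be. See the introduction for the cases.
\<close>

lemma plane_bound:
  fixes A :: "int \<Rightarrow> int set" and p k :: nat
  assumes p: "prime p" and k: "k = (p + 1) div 3"
    and per: "\<And>j. periodic (int p) (A j)" and index: "\<And>j. A (j + int p) = A j"
    and free: "\<And>i j x y. x \<in> A i \<Longrightarrow> y \<in> A j \<Longrightarrow> x + y \<notin> A (i + j)"
    and A0: "count_mod (int p) (A 0) = k"
  shows "(\<Sum>j\<in>{0..<int p}. count_mod (int p) (A j)) \<le> k * p"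
proof -
  let ?N = "int p"
  let ?c = "count_mod (int p)"
  have p2: "p \<ge> 2" by (rule prime_ge_2_nat[OF p])
  have N: "?N > 0" using p2 by simp
  have k0: "k > 0" using p2 k by simp
  have A0ne: "A 0 \<noteq> {}" using A0 k0 by (auto simp: count_mod_def)
  have row: "?c (A i) + ?c (A j) + ?c (A (i + j)) \<le> p + 1"
    if "A i \<noteq> {}" "A j \<noteq> {}" "A (i + j) \<noteq> {}" for i j
    using that free by (intro cauchy_davenport_avoiding p per) (auto simp: set_plus_def)
  have le_row: "k + 2 * ?c (A j) \<le> p + 1" for j
  proof (cases "A j = {}")
    case True
    then show ?thesis using k by (simp add: count_mod_def)
  qed (use row[of 0 j] A0 A0ne in simp)
  show ?thesis
  proof (cases "\<forall>j\<in>{0..<?N}. ?c (A j) \<le> k")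
    case True
    then have "(\<Sum>j\<in>{0..<?N}. ?c (A j)) \<le> (\<Sum>j\<in>{0..<?N}. k)" by (intro sum_mono) auto
    then show ?thesis by (simp add: mult.commute)
  next
    case False
    then obtain j1 where "\<not> ?c (A j1) \<le> k" by blast
    then have j1: "?c (A j1) > k" by simp
    then have pk: "p = 3 * k + 1" using le_row[of j1] k by presburger
    then have le: "?c (A j) \<le> k + 1" for j using le_row[of j] by linarith
    define B where "B = {j. ?c (A j) = k + 1}"
    have j1B: "j1 \<in> B" using j1 le[of j1] by (simp add: B_def)
    have pB: "periodic ?N B" by (simp add: periodic_def B_def index)
    have Bne: "A j \<noteq> {}" if "j \<in> B" for j using that by (auto simp: B_def count_mod_def)
    have "(B + B) \<inter> B = {}"
    proof -
      have False if "i \<in> B" "j \<in> B" "i + j \<in> B" for i j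
        using row[of i j] that Bne pk by (simp add: B_def)
      then show ?thesis by (auto simp: set_plus_def)
    qed
    then have "3 * ?c B \<le> p + 1" using cauchy_davenport_avoiding[OF p pB _ pB, of B] j1B by fastforce
    then have cB: "?c B \<le> k" using pk by linarith
    show ?thesis
    proof (cases "\<exists>j\<in>{0..<?N}. A j = {}")
      case True
      then obtain j0 where j0: "j0 \<in> {0..<?N}" "A j0 = {}" by blast
      have "(\<Sum>j\<in>{0..<?N}. ?c (A j)) = (\<Sum>j\<in>{0..<?N} - {j0}. ?c (A j))"
        using j0 by (subst sum.remove[of _ j0]) (auto simp: count_mod_def)
      also have "\<dots> \<le> (\<Sum>j\<in>{0..<?N} - {j0}. k + (if j \<in> B then 1 else 0))"
        using le by (intro sum_mono) (auto simp: B_def le_Suc_eq)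
      also have "\<dots> = k * (p - 1) + card (({0..<?N} - {j0}) \<inter> B)"
        using j0 by (simp add: sum.distrib sum.If_cases mult.commute)
      also have "card (({0..<?N} - {j0}) \<inter> B) \<le> ?c B"
        unfolding count_mod_def by (intro card_mono) auto
      also have "k * (p - 1) + ?c B \<le> k * (p - 1) + k" using cB by simp
      also have "\<dots> = k * p" using p2 by (cases p) auto
      finally show ?thesis by simp
    next
      case nonempty: False
      have index': "A (j + ?N * i) = A j" for i j
      proof -
        have "periodic ?N {j. A j = X}" for X by (simp add: periodic_def index)
        from periodic_add_mult[OF this, of j i "A j"] show ?thesis by simp
      qed
      have index_mod: "A (j mod ?N) = A j" for j using index'[of "j mod ?N" "j div ?N"] by simp
      have ne: "A j \<noteq> {}" for j
      proof -
        have "A (j mod ?N) = A j" by (rule index_mod)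
        then show ?thesis using nonempty N by (metis atLeastLessThan_iff pos_mod_bound pos_mod_sign)
      qed
      have "\<not> ?N dvd j1"
      proof
        assume "?N dvd j1"
        then obtain i where "j1 = 0 + ?N * i" by (auto simp: dvd_def)
        then have "A j1 = A 0" using index'[of 0 i] by simp
        then show False using j1 A0 by simp
      qed
      then have cop: "coprime j1 ?N" by (rule coprime_prime_int[OF p])
      have "k \<noteq> 1" using p pk by auto
      then have k2: "k \<ge> 2" using k0 by simp
      have c1: "?c (A j1) = k + 1" using j1B by (simp add: B_def)
      have "(A j1 + A 0) \<inter> A j1 = {}" using free[of _ j1 _ 0] by (auto simp: set_plus_def)
      then have "?c (A j1 + A 0) + ?c (A j1) \<le> p" using count_mod_disjoint[OF N] by fastforce
      then have "interval_like ?N (A j1)"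
        using c1 A0 k2 pk by (intro vosper[OF p per _ per[of 0]]) auto
      then obtain d a n where d: "coprime d ?N" and an: "\<And>x. d * x + a \<in> A j1 \<longleftrightarrow> x mod ?N < n"
        by (auto simp: interval_like_def)
      define n' where "n' = max 0 (min ?N n)"
      have n': "0 \<le> n'" "n' \<le> ?N" using N by (auto simp: n'_def)
      have an': "d * x + a \<in> A j1 \<longleftrightarrow> x mod ?N < n'" for x
        unfolding an n'_def using pos_mod_bound[OF N, of x] pos_mod_sign[OF N, of x] by linarith
      have "nat n' = k + 1"
        using count_mod_interval[OF N n'] count_mod_affine[OF N per d, of a j1] c1 by (simp add: an')
      then have n'k: "n' = int k + 1" by simp
      \<comment> \<open>In these coordinates of the plane the row of index 1 is \<open>{0..k}\<close>.\<close>
      define R where "R j = {x. d * x + a * j \<in> A (j1 * j)}" for j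
      have cR: "?c (R j) = ?c (A (j1 * j))" for j
        unfolding R_def by (rule count_mod_affine[OF N per d])
      have "(\<Sum>j<p. ?c (R (int j))) \<le> k * p"
      proof (rule winding_bound[OF pk k0])
        show "periodic ?N (R j)" for j unfolding R_def by (rule periodic_affine[OF per])
        show "R ?N = R 0"
          using periodic_add_mult[OF per, of _ a] index'[of 0 j1] by (auto simp: R_def mult.commute)
        show "x + y \<notin> R (i + j)" if "x \<in> R i" "y \<in> R j" for i j x y
        proof
          assume "x + y \<in> R (i + j)"
          then have "(d * x + a * i) + (d * y + a * j) \<in> A (j1 * i + j1 * j)"
            by (simp add: R_def algebra_simps)
          then show False using free that unfolding R_def by blast
        qed
        show "R j \<noteq> {}" for j
        proof
          assume "R j = {}"
          then have "?c (A (j1 * j)) = 0" using cR[of j] by (simp add: count_mod_def)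
          then show False using count_mod_pos[OF N per ne, of "j1 * j"] by simp
        qed
        show "x \<in> R 1 \<longleftrightarrow> x mod ?N < int k + 1" for x using an'[of x] by (simp add: R_def n'k)
        show "?c (R 0) = k" using cR[of 0] A0 by simp
      qed
      also have "(\<Sum>j<p. ?c (R (int j))) = (\<Sum>j\<in>{0..<?N}. ?c (R j))"
        by (rule sum.reindex_bij_witness[of _ nat int]) auto
      also have "\<dots> = (\<Sum>j\<in>{0..<?N}. ?c (A ((j1 * j) mod ?N)))"
        by (simp only: cR index_mod)
      also have "\<dots> = (\<Sum>j\<in>{0..<?N}. ?c (A j))"
      proof (rule sum.reindex_bij_betw)
        have inj: "inj_on (\<lambda>j. (j1 * j) mod ?N) {0..<?N}"
        proof (rule inj_onI)
          fix x y assume xy: "x \<in> {0..<?N}" "y \<in> {0..<?N}" "(j1 * x) mod ?N = (j1 * y) mod ?N"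
          then have "[x = y] (mod ?N)" using cop cong_mult_lcancel[of j1 ?N x y] by (simp add: cong_def)
          then show "x = y" using xy by (simp add: cong_def)
        qed
        moreover have "(\<lambda>j. (j1 * j) mod ?N) ` {0..<?N} = {0..<?N}"
          by (rule endo_inj_surj[OF _ _ inj]) (use N in auto)
        ultimately show "bij_betw (\<lambda>j. (j1 * j) mod ?N) {0..<?N} {0..<?N}" by (simp add: bij_betw_def)
      qed
      finally show ?thesis .
    qed
  qed
qed

section \<open>Haar measure on groups of digit sequences\<close>

definition cylinder :: "(nat \<Rightarrow> 'a) set \<Rightarrow> nat \<Rightarrow> (nat \<Rightarrow> 'a) \<Rightarrow> (nat \<Rightarrow> 'a) set" where
  "cylinder X n x = {y \<in> X. \<forall>i\<le>n. y i = x i}"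

lemma cylinder_subset: "cylinder X n x \<subseteq> X"
  and mem_cylinder_self: "x \<in> X \<Longrightarrow> x \<in> cylinder X n x"
  and cylinder_antimono: "m \<le> n \<Longrightarrow> cylinder X n x \<subseteq> cylinder X m x"
  and cylinder_eq: "y \<in> cylinder X n x \<Longrightarrow> cylinder X n y = cylinder X n x"
  by (auto simp: cylinder_def)

lemma cylinder_Int:
  assumes "m \<le> n" "cylinder X m x \<inter> cylinder X n y \<noteq> {}"
  shows "cylinder X m x \<inter> cylinder X n y = cylinder X n y"
proof -
  obtain z where z: "z \<in> cylinder X m x" "z \<in> cylinder X n y" using assms by auto
  have "cylinder X n y \<subseteq> cylinder X m x"
    using cylinder_eq[OF z(1)] cylinder_eq[OF z(2)] cylinder_antimono[OF assms(1), of X z] by simp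
  then show ?thesis by auto
qed

text \<open>
  In a product of discrete spaces indexed by the naturals the cylinders form a basis.
\<close>

lemma openin_prefix_topology:
  assumes X: "X \<subseteq> {x. \<forall>n. x n \<in> S n}"
  shows "openin (subtopology (product_topology (\<lambda>n. discrete_topology (S n)) UNIV) X) U \<longleftrightarrow>
    U \<subseteq> X \<and> (\<forall>x\<in>U. \<exists>n. cylinder X n x \<subseteq> U)" (is "openin (subtopology ?P X) U \<longleftrightarrow> _")
proof
  assume "openin (subtopology ?P X) U"
  then obtain V where V: "openin ?P V" "U = V \<inter> X" by (auto simp: openin_subtopology)
  have "\<exists>n. cylinder X n x \<subseteq> U" if x: "x \<in> U" for x
  proof -
    have "x \<in> V" using x V by auto
    with V(1) obtain F where F: "finite {i. F i \<noteq> S i}" "x \<in> Pi\<^sub>E UNIV F" "Pi\<^sub>E UNIV F \<subseteq> V"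
      unfolding openin_product_topology_alt by (auto simp: PiE_UNIV_domain)
    obtain n where n: "\<And>i. F i \<noteq> S i \<Longrightarrow> i \<le> n"
      using F(1) by (auto simp: finite_nat_set_iff_bounded_le)
    have "cylinder X n x \<subseteq> Pi\<^sub>E UNIV F"
    proof
      fix y assume y: "y \<in> cylinder X n x"
      have "y i \<in> F i" for i
      proof (cases "i \<le> n")
        case True then show ?thesis using y F(2) by (auto simp: cylinder_def PiE_UNIV_domain)
      next
        case False then show ?thesis using y n[of i] X by (auto simp: cylinder_def)
      qed
      then show "y \<in> Pi\<^sub>E UNIV F" by (auto simp: PiE_UNIV_domain)
    qed
    then show ?thesis using F V cylinder_subset[of X n x] by blast
  qed
  then show "U \<subseteq> X \<and> (\<forall>x\<in>U. \<exists>n. cylinder X n x \<subseteq> U)" using V by auto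
next
  assume U: "U \<subseteq> X \<and> (\<forall>x\<in>U. \<exists>n. cylinder X n x \<subseteq> U)"
  have cyl: "openin (subtopology ?P X) (cylinder X n x)" if "x \<in> X" for n x
  proof -
    define F where "F i = (if i \<le> n then {x i} else S i)" for i
    have "openin ?P (Pi\<^sub>E UNIV F)"
    proof (rule product_topology_basis)
      show "openin (discrete_topology (S i)) (F i)" for i using that X by (auto simp: F_def)
      show "finite {i. F i \<noteq> topspace (discrete_topology (S i))}"
        by (rule finite_subset[of _ "{..n}"]) (auto simp: F_def)
    qed
    moreover have "cylinder X n x = Pi\<^sub>E UNIV F \<inter> X"
      using X by (auto simp: cylinder_def F_def PiE_UNIV_domain Pi_iff split: if_splits)
    ultimately show ?thesis by (auto simp: openin_subtopology)
  qed
  show "openin (subtopology ?P X) U"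
  proof (subst openin_subopen, intro ballI)
    fix x assume x: "x \<in> U"
    then obtain n where "cylinder X n x \<subseteq> U" "x \<in> X" using U by blast
    then show "\<exists>T. openin (subtopology ?P X) T \<and> x \<in> T \<and> T \<subseteq> U"
      using cyl mem_cylinder_self by (intro exI[of _ "cylinder X n x"]) auto
  qed
qed

lemma compact_prefix_topology:
  assumes X: "X \<subseteq> {x. \<forall>n. x n \<in> S n}" and fin: "\<And>n. finite (S n)"
    and closed: "\<And>x. (\<forall>n. x n \<in> S n) \<Longrightarrow> x \<notin> X \<Longrightarrow> \<exists>n. cylinder X n x = {}"
  shows "compact_space (subtopology (product_topology (\<lambda>n. discrete_topology (S n)) UNIV) X)"
proof -
  let ?Q = "{x. \<forall>n. x n \<in> S n}"
  let ?P = "product_topology (\<lambda>n. discrete_topology (S n)) UNIV"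
  have top: "topspace ?P = ?Q" by (auto simp: PiE_UNIV_domain)
  have "compact_space ?P" using fin by (simp add: compact_space_product_topology compact_space_discrete_topology)
  moreover have "closedin ?P X"
  proof -
    have "openin (subtopology ?P ?Q) (?Q - X)"
      unfolding openin_prefix_topology[OF order.refl]
    proof (intro conjI ballI)
      fix x assume "x \<in> ?Q - X"
      then obtain n where n: "cylinder X n x = {}" using closed by blast
      then have "cylinder ?Q n x \<subseteq> ?Q - X" by (auto simp: cylinder_def)
      then show "\<exists>n. cylinder ?Q n x \<subseteq> ?Q - X" by blast
    qed auto
    moreover have "subtopology ?P ?Q = ?P" using top by (metis subtopology_topspace)
    ultimately show ?thesis using X top by (simp add: closedin_def)
  qed
  ultimately have "compactin ?P X" by (rule closedin_compact_space)
  then show ?thesis by (simp add: compact_space_subtopology)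
qed

text \<open>
  The common features of \<open>\<int>\<^sub>p\<close> and \<open>F\<^sub>p[[t]]\<close>: the elements are sequences, the cylinders are a basis of the
  topology, and translations map cylinders to cylinders. The map \<open>\<phi>\<close> produces a group element from a
  sequence of digits in such a way that the first \<open>n + 1\<close> digits determine, and are determined by, the
  cylinder of level \<open>n\<close>; it carries the product measure to the Haar measure. The bounds \<open>B\<close> on the
  entries make the number of cylinders of each level finite.
\<close>

locale digit_group = comm_group G for G :: "(nat \<Rightarrow> int, 'm) monoid_scheme" (structure) +
  fixes T :: "(nat \<Rightarrow> int) topology" and p :: nat and B :: "nat \<Rightarrow> int"
    and \<phi> :: "(nat \<Rightarrow> int) \<Rightarrow> nat \<Rightarrow> int"
  assumes p_pos: "p > 0"
    and bounded: "x \<in> carrier G \<Longrightarrow> x n \<in> {0..<B n}"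
    and openin_T: "openin T U \<longleftrightarrow> U \<subseteq> carrier G \<and> (\<forall>x\<in>U. \<exists>n. cylinder (carrier G) n x \<subseteq> U)"
    and compact_T: "compact_space T"
    and mult_cylinder: "g \<in> carrier G \<Longrightarrow> x \<in> carrier G \<Longrightarrow> y \<in> cylinder (carrier G) n x \<Longrightarrow>
          g \<otimes> y \<in> cylinder (carrier G) n (g \<otimes> x)"
    and digits_closed: "(\<And>i. d i \<in> {0..<int p}) \<Longrightarrow> \<phi> d \<in> carrier G"
    and digits: "x \<in> carrier G \<Longrightarrow> \<exists>d. (\<forall>i. d i \<in> {0..<int p}) \<and>
          (\<forall>y. (\<forall>i. y i \<in> {0..<int p}) \<longrightarrow> (\<phi> y \<in> cylinder (carrier G) n x \<longleftrightarrow> (\<forall>i\<le>n. y i = d i)))"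
begin

abbreviation "X \<equiv> carrier G"
abbreviation "cyl n x \<equiv> cylinder X n x"

lemma topspace_T: "topspace T = X"
proof -
  have "openin T X" using openin_T cylinder_subset by blast
  then show ?thesis using openin_T[of "topspace T"] openin_subset[of T X] by auto
qed

lemma openin_cylinder: "openin T (cyl n x)"
  unfolding openin_T using cylinder_subset cylinder_eq by blast

definition cyls :: "nat \<Rightarrow> (nat \<Rightarrow> int) set set" where "cyls n = cyl n ` X"

lemma finite_cyls: "finite (cyls n)"
proof -
  have "cyls n \<subseteq> cyl n ` (Pi\<^sub>E {..n} (\<lambda>i. {0..<B i}))"
  proof
    fix C assume "C \<in> cyls n"
    then obtain x where x: "x \<in> X" "C = cyl n x" by (auto simp: cyls_def)
    have "C = cyl n (restrict x {..n})" unfolding x by (auto simp: cylinder_def)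
    moreover have "restrict x {..n} \<in> Pi\<^sub>E {..n} (\<lambda>i. {0..<B i})" using bounded[OF x(1)] by auto
    ultimately show "C \<in> cyl n ` (Pi\<^sub>E {..n} (\<lambda>i. {0..<B i}))" by blast
  qed
  then show ?thesis by (rule finite_subset) (intro finite_imageI finite_PiE, auto)
qed

lemma Union_cyls: "\<Union>(cyls n) = X"
  using mem_cylinder_self cylinder_subset by (fastforce simp: cyls_def)

lemma disjoint_cyls: "disjoint_family_on (\<lambda>C. C) (cyls n)"
  unfolding disjoint_family_on_def cyls_def by (auto simp: cylinder_def)

text \<open>
  The cylinders, made stable under intersection and together with the whole space.
\<close>

definition gen :: "(nat \<Rightarrow> int) set set" where "gen = insert {} (insert X (\<Union>n. cyls n))"

lemma gen_subset: "gen \<subseteq> Pow X"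
  using cylinder_subset by (auto simp: gen_def cyls_def)

lemma borel_eq_sigma_gen: "sigma_sets X {U. openin T U} = sigma_sets X gen"
proof
  have "gen \<subseteq> {U. openin T U}"
    using openin_cylinder topspace_T openin_topspace[of T] by (auto simp: gen_def cyls_def)
  then show "sigma_sets X gen \<subseteq> sigma_sets X {U. openin T U}" by (rule sigma_sets_mono')
  interpret S: sigma_algebra X "sigma_sets X gen" by (rule sigma_algebra_sigma_sets[OF gen_subset])
  have "U \<in> sigma_sets X gen" if U: "openin T U" for U
  proof -
    have "U = \<Union>{C \<in> (\<Union>n. cyls n). C \<subseteq> U}"
    proof
      show "U \<subseteq> \<Union>{C \<in> (\<Union>n. cyls n). C \<subseteq> U}"
      proof
        fix x assume x: "x \<in> U"
        then obtain n where "cyl n x \<subseteq> U" "x \<in> X" using U openin_T by blast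
        then have "cyl n x \<in> {C \<in> (\<Union>n. cyls n). C \<subseteq> U}" by (auto simp: cyls_def)
        then show "x \<in> \<Union>{C \<in> (\<Union>n. cyls n). C \<subseteq> U}"
          using mem_cylinder_self[OF \<open>x \<in> X\<close>] by blast
      qed
    qed auto
    moreover have ctb: "countable {C \<in> (\<Union>n. cyls n). C \<subseteq> U}"
      by (rule countable_subset[of _ "\<Union>n. cyls n"]) (auto intro: countable_finite finite_cyls)
    moreover have "{C \<in> (\<Union>n. cyls n). C \<subseteq> U} \<subseteq> sigma_sets X gen" by (auto simp: gen_def)
    then have "\<Union>{C \<in> (\<Union>n. cyls n). C \<subseteq> U} \<in> sigma_sets X gen" by (rule S.countable_Union[OF ctb])
    ultimately show ?thesis by simp
  qed
  then have "{U. openin T U} \<subseteq> sigma_sets X gen" by blast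
  then show "sigma_sets X {U. openin T U} \<subseteq> sigma_sets X gen" by (rule sigma_sets_mono)
qed

lemma Int_stable_gen: "Int_stable gen"
proof (rule Int_stableI)
  have sub: "C \<subseteq> X" if "C \<in> cyls n" for C n using that cylinder_subset by (auto simp: cyls_def)
  have two: "a \<inter> b \<in> gen" if ab: "a \<in> cyls m" "b \<in> cyls n" for a b m n
  proof (cases "a \<inter> b = {}")
    case False
    obtain x where x: "x \<in> X" "a = cyl m x" using ab(1) by (auto simp: cyls_def)
    obtain y where y: "y \<in> X" "b = cyl n y" using ab(2) by (auto simp: cyls_def)
    note xy = x y
    have "a \<inter> b = b \<or> b \<inter> a = a"
    proof (cases "m \<le> n")
      case True
      then show ?thesis using cylinder_Int[OF True, of X x y] False xy by simp
    next
      case nle: False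
      then have "n \<le> m" by simp
      then show ?thesis using cylinder_Int[OF \<open>n \<le> m\<close>, of X y x] False xy by (simp add: Int_commute)
    qed
    then have "a \<inter> b = b \<or> a \<inter> b = a" by (simp add: Int_commute)
    then show ?thesis
    proof
      assume "a \<inter> b = b" then show ?thesis using ab(2) by (auto simp: gen_def)
    next
      assume "a \<inter> b = a" then show ?thesis using ab(1) by (auto simp: gen_def)
    qed
  qed (simp add: gen_def)
  fix a b assume "a \<in> gen" "b \<in> gen"
  then consider "a = {} \<or> b = {}" | "a = X" "b \<in> gen" | "b = X" "a \<in> gen" | m n where "a \<in> cyls m" "b \<in> cyls n"
    by (auto simp: gen_def)
  then show "a \<inter> b \<in> gen"
  proof cases
    case 1 then show ?thesis by (auto simp: gen_def)
  next
    case 2 then show ?thesis using gen_subset by (metis Int_absorb1 PowD subsetD)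
  next
    case 3 then show ?thesis using gen_subset by (metis Int_absorb2 PowD subsetD)
  next
    case 4 then show ?thesis by (rule two)
  qed
qed

text \<open>
  The characterization of Haar measure that the proofs work with.
\<close>

definition equidistributed :: "(nat \<Rightarrow> int) measure \<Rightarrow> bool" where
  "equidistributed M \<longleftrightarrow> space M = X \<and> sets M = sigma_sets X gen \<and> emeasure M X = 1 \<and>
     (\<forall>n. \<forall>x\<in>X. \<forall>y\<in>X. emeasure M (cyl n x) = emeasure M (cyl n y))"

lemma equidistributed_prob: "equidistributed M \<Longrightarrow> prob_space M"
  by (auto simp: equidistributed_def intro: prob_spaceI)

lemma cyl_in_sigma: "x \<in> X \<Longrightarrow> cyl n x \<in> sigma_sets X gen"
  by (rule sigma_sets.Basic) (auto simp: gen_def cyls_def)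

text \<open>
  The cylinders of level \<open>n\<close> are a finite partition into sets of equal mass.
\<close>

lemma equidistributed_cylinder:
  assumes M: "equidistributed M" and x: "x \<in> X"
  shows "measure M (cyl n x) = 1 / real (card (cyls n))"
proof -
  interpret prob_space M by (rule equidistributed_prob[OF M])
  have sets: "sets M = sigma_sets X gen" using M by (simp add: equidistributed_def)
  have "1 = measure M (\<Union>C\<in>cyls n. C)"
    using M Union_cyls[of n] by (simp add: equidistributed_def measure_def)
  also have "\<dots> = (\<Sum>C\<in>cyls n. measure M C)"
    by (rule finite_measure_finite_Union)
      (use finite_cyls disjoint_cyls cyl_in_sigma sets in \<open>auto simp: cyls_def\<close>)
  also have "\<dots> = (\<Sum>C\<in>cyls n. measure M (cyl n x))"
  proof (rule sum.cong[OF refl])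
    fix C assume "C \<in> cyls n"
    then obtain y where y: "y \<in> X" "C = cyl n y" by (auto simp: cyls_def)
    then have "emeasure M C = emeasure M (cyl n x)" using M x unfolding equidistributed_def by blast
    then show "measure M C = measure M (cyl n x)" by (simp add: measure_def)
  qed
  also have "\<dots> = real (card (cyls n)) * measure M (cyl n x)" by simp
  finally have one: "1 = real (card (cyls n)) * measure M (cyl n x)" .
  then have "real (card (cyls n)) \<noteq> 0" by (metis mult_zero_left zero_neq_one)
  with one show ?thesis by (simp only: eq_divide_eq mult.commute) simp
qed

lemma equidistributed_unique:
  assumes M: "equidistributed M" and N: "equidistributed N"
  shows "M = N"
proof -
  interpret M: prob_space M by (rule equidistributed_prob[OF M])
  interpret N: prob_space N by (rule equidistributed_prob[OF N])
  show ?thesis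
  proof (rule measure_eqI_generator_eq[OF Int_stable_gen gen_subset])
    show "sets M = sigma_sets X gen" "sets N = sigma_sets X gen" using M N by (auto simp: equidistributed_def)
    show "range (\<lambda>_. X) \<subseteq> gen" by (simp add: gen_def)
    show "emeasure M C = emeasure N C" if "C \<in> gen" for C
    proof -
      have "emeasure M X = emeasure N X" using M N by (simp add: equidistributed_def)
      then show ?thesis
        using that equidistributed_cylinder[OF M] equidistributed_cylinder[OF N]
        by (auto simp: gen_def cyls_def M.emeasure_eq_measure N.emeasure_eq_measure)
    qed
  qed auto
qed

text \<open>
  The image measure is again equidistributed, so uniqueness applies.
\<close>

lemma equidistributed_map:
  assumes M: "equidistributed M" and f: "\<And>x. x \<in> X \<Longrightarrow> f x \<in> X"
    and pre: "\<And>n x. x \<in> X \<Longrightarrow> \<exists>x'\<in>X. \<forall>y\<in>X. f y \<in> cyl n x \<longleftrightarrow> y \<in> cyl n x'"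
  shows "f \<in> measurable M M" "distr M M f = M"
proof -
  have sp: "space M = X" and sets: "sets M = sigma_sets X gen" using M by (auto simp: equidistributed_def)
  have pre': "\<exists>x'\<in>X. f -` cyl n x \<inter> space M = cyl n x'" if x: "x \<in> X" for n x
  proof -
    obtain x' where "x' \<in> X" "\<forall>y\<in>X. f y \<in> cyl n x \<longleftrightarrow> y \<in> cyl n x'" using pre[OF x] by blast
    then show ?thesis using cylinder_subset[of X n x'] sp by (intro bexI[of _ x']) auto
  qed
  show meas: "f \<in> measurable M M"
  proof (rule measurable_sigma_sets[OF sets gen_subset])
    show "f \<in> space M \<rightarrow> X" using f sp by auto
    fix C assume "C \<in> gen"
    then consider "C = {}" | "C = X" | n x where "x \<in> X" "C = cyl n x" by (auto simp: gen_def cyls_def)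
    then show "f -` C \<inter> space M \<in> sets M"
    proof cases
      case 2
      then have "f -` C \<inter> space M = space M" using f sp by auto
      then show ?thesis by simp
    next
      case (3 n x)
      obtain x' where x': "x' \<in> X" "f -` cyl n x \<inter> space M = cyl n x'" using pre'[OF 3(1), of n] by blast
      show ?thesis unfolding 3(2) x'(2) sets by (rule cyl_in_sigma[OF x'(1)])
    qed simp
  qed
  have "equidistributed (distr M M f)"
    unfolding equidistributed_def
  proof (intro conjI allI ballI)
    have "f -` X \<inter> space M = X" using f sp by auto
    moreover have "X \<in> sets M" using sp by (metis sets.top)
    ultimately show "emeasure (distr M M f) X = 1"
      using M meas by (simp add: emeasure_distr equidistributed_def)
    fix n x y assume xy: "x \<in> X" "y \<in> X"
    obtain x' where x': "x' \<in> X" "f -` cyl n x \<inter> space M = cyl n x'" using pre'[OF xy(1)] by blast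
    obtain y' where y': "y' \<in> X" "f -` cyl n y \<inter> space M = cyl n y'" using pre'[OF xy(2)] by blast
    show "emeasure (distr M M f) (cyl n x) = emeasure (distr M M f) (cyl n y)"
    proof -
      have "emeasure (distr M M f) (cyl n x) = emeasure M (cyl n x')"
        using cyl_in_sigma[OF xy(1)] by (subst emeasure_distr[OF meas]) (auto simp: sets x')
      moreover have "emeasure (distr M M f) (cyl n y) = emeasure M (cyl n y')"
        using cyl_in_sigma[OF xy(2)] by (subst emeasure_distr[OF meas]) (auto simp: sets y')
      moreover have "emeasure M (cyl n x') = emeasure M (cyl n y')"
        using M x'(1) y'(1) unfolding equidistributed_def by blast
      ultimately show ?thesis by simp
    qed
  qed (use sp sets in auto)
  then show "distr M M f = M" by (rule equidistributed_unique[OF _ M])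
qed

lemma translation_cylinder:
  assumes "g \<in> X" "x \<in> X" "y \<in> X"
  shows "g \<otimes> y \<in> cyl n x \<longleftrightarrow> y \<in> cyl n (inv g \<otimes> x)"
proof
  assume "g \<otimes> y \<in> cyl n x"
  then have "inv g \<otimes> (g \<otimes> y) \<in> cyl n (inv g \<otimes> x)" using assms by (intro mult_cylinder) auto
  then show "y \<in> cyl n (inv g \<otimes> x)" using assms by (simp flip: m_assoc)
next
  assume "y \<in> cyl n (inv g \<otimes> x)"
  then have "g \<otimes> y \<in> cyl n (g \<otimes> (inv g \<otimes> x))" using assms by (intro mult_cylinder) auto
  then show "g \<otimes> y \<in> cyl n x" using assms by (simp flip: m_assoc)
qed

lemma equidistributed_translate:
  assumes M: "equidistributed M" and g: "g \<in> X"
  shows "(\<lambda>x. g \<otimes> x) \<in> measurable M M" "distr M M (\<lambda>x. g \<otimes> x) = M"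
proof -
  have "\<exists>x'\<in>X. \<forall>y\<in>X. g \<otimes> y \<in> cyl n x \<longleftrightarrow> y \<in> cyl n x'" if "x \<in> X" for n x
    using translation_cylinder[OF g that] g that by (intro bexI[of _ "inv g \<otimes> x"]) auto
  then show "(\<lambda>x. g \<otimes> x) \<in> measurable M M" "distr M M (\<lambda>x. g \<otimes> x) = M"
    using equidistributed_map[OF M, of "\<lambda>x. g \<otimes> x"] g by auto
qed

lemma l_coset_vimage:
  assumes "g \<in> X" "A \<subseteq> X" shows "g <# A = (\<lambda>x. inv g \<otimes> x) -` A \<inter> X"
proof (intro equalityI subsetI)
  fix x assume "x \<in> g <# A"
  then obtain a where "a \<in> A" "x = g \<otimes> a" by (auto simp: l_coset_def)
  then show "x \<in> (\<lambda>x. inv g \<otimes> x) -` A \<inter> X" using assms by (auto simp flip: m_assoc)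
next
  fix x assume x: "x \<in> (\<lambda>x. inv g \<otimes> x) -` A \<inter> X"
  then have "g \<otimes> (inv g \<otimes> x) = x" using assms by (simp flip: m_assoc)
  moreover have "g \<otimes> (inv g \<otimes> x) \<in> g <# A" using x unfolding l_coset_def by blast
  ultimately show "x \<in> g <# A" by simp
qed

lemma equidistributed_l_coset:
  assumes M: "equidistributed M" and g: "g \<in> X" and A: "A \<in> sets M"
  shows "emeasure M (g <# A) = emeasure M A"
proof -
  have sp: "space M = X" using M by (simp add: equidistributed_def)
  have "A \<subseteq> X" using sets.sets_into_space[OF A] sp by simp
  have "emeasure M A = emeasure (distr M M (\<lambda>x. inv g \<otimes> x)) A"
    using equidistributed_translate(2)[OF M, of "inv g"] g by simp
  also have "\<dots> = emeasure M (g <# A)"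
    using equidistributed_translate(1)[OF M, of "inv g"] g A
    by (simp add: emeasure_distr l_coset_vimage[OF g \<open>A \<subseteq> X\<close>] sp)
  finally show ?thesis by simp
qed

text \<open>
  The sets that can be squeezed between a closed and an open set form a \<open>\<sigma>\<close>-algebra containing the
  cylinders, which are both closed and open. For countable unions, finitely many of the closed sets suffice
  by continuity of the measure.
\<close>

lemma equidistributed_approx:
  assumes M: "equidistributed M" and A: "A \<in> sigma_sets X gen" and e: "e > 0"
  shows "\<exists>K U. closedin T K \<and> openin T U \<and> K \<subseteq> A \<and> A \<subseteq> U \<and> measure M (U - K) < e"
  using A e
proof (induction arbitrary: e rule: sigma_sets.induct)
  case (Basic a)
  have op: "openin T a" using Basic(1) openin_cylinder topspace_T openin_topspace[of T]
    by (auto simp: gen_def cyls_def)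
  have "closedin T a"
  proof -
    consider "a = {}" | "a = X" | n x where "a = cyl n x" using Basic(1) by (auto simp: gen_def cyls_def)
    then show ?thesis
    proof cases
      case (3 n x)
      have "openin T (X - a)" unfolding openin_T
      proof (intro conjI ballI)
        fix y assume "y \<in> X - a"
        then have "cyl n y \<subseteq> X - a" unfolding 3 by (auto simp: cylinder_def)
        then show "\<exists>n. cyl n y \<subseteq> X - a" by blast
      qed auto
      then show ?thesis using op openin_subset[OF op] topspace_T by (simp add: closedin_def)
    qed (use closedin_topspace[of T] topspace_T in auto)
  qed
  then show ?case using op Basic(2) by (intro exI[of _ a]) auto
next
  case Empty
  then show ?case by (intro exI[of _ "{}"]) auto
next
  case (Compl a)
  obtain K U where KU: "closedin T K" "openin T U" "K \<subseteq> a" "a \<subseteq> U" "measure M (U - K) < e"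
    using Compl.IH[OF Compl.prems] by blast
  have "U \<subseteq> X" "K \<subseteq> X"
    using openin_subset[OF KU(2)] closedin_subset[OF KU(1)] topspace_T by simp_all
  then have "(X - K) - (X - U) = U - K" by auto
  moreover have "closedin T (X - U)" "openin T (X - K)"
    using KU(1,2) topspace_T openin_diff[OF openin_topspace] closedin_diff[OF closedin_topspace] by metis+
  ultimately have "closedin T (X - U) \<and> openin T (X - K) \<and> X - U \<subseteq> X - a \<and> X - a \<subseteq> X - K \<and>
      measure M ((X - K) - (X - U)) < e" using KU(3-5) by auto
  then show ?case by blast
next
  case (Union a)
  interpret prob_space M by (rule equidistributed_prob[OF M])
  have sets: "sets M = sigma_sets X {U. openin T U}"
    using M borel_eq_sigma_gen by (simp add: equidistributed_def)
  have openM: "U \<in> sets M" if "openin T U" for U unfolding sets using that by (intro sigma_sets.Basic) simp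
  have closedM: "K \<in> sets M" if "closedin T K" for K
  proof -
    have "X - K \<in> sets M" using that topspace_T by (intro openM) (auto simp: closedin_def)
    then have "space M - (X - K) \<in> sets M" by auto
    moreover have "space M - (X - K) = K"
      using M closedin_subset[OF that] topspace_T by (auto simp: equidistributed_def)
    ultimately show ?thesis by simp
  qed
  \<comment> \<open>The errors \<open>c i\<close> add up to \<open>e / 2\<close>; the other half pays for the truncation of the union of the
    closed sets.\<close>
  define c where "c i = e / 2 * (1 / 2) ^ Suc i" for i
  have "c i > 0" for i using Union.prems by (simp add: c_def)
  then have "\<exists>K U. closedin T K \<and> openin T U \<and> K \<subseteq> a i \<and> a i \<subseteq> U \<and> measure M (U - K) < c i" for i
    using Union.IH by blast
  then obtain K U where KU: "\<And>i. closedin T (K i)" "\<And>i. openin T (U i)" "\<And>i. K i \<subseteq> a i" "\<And>i. a i \<subseteq> U i"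
    "\<And>i. measure M (U i - K i) < c i" by metis
  have c: "c sums (e / 2)" unfolding c_def using sums_mult[OF power_half_series, of "e / 2"] by simp
  define UU where "UU = (\<Union>i. U i)"
  have UK: "U i - K i \<in> sets M" for i using openM closedM KU by blast
  have sm: "summable (\<lambda>i. measure M (U i - K i))"
    by (rule summable_comparison_test'[OF sums_summable[OF c], of 0]) (use KU(5) in \<open>auto intro: less_imp_le\<close>)
  have "measure M (\<Union>i. U i - K i) \<le> (\<Sum>i. measure M (U i - K i))"
    using UK sm by (intro finite_measure_subadditive_countably) auto
  also have "\<dots> \<le> (\<Sum>i. c i)"
    using KU(5) sm sums_summable[OF c] by (intro suminf_le) (auto intro: less_imp_le)
  also have "\<dots> = e / 2" using c by (rule sums_unique[symmetric])
  finally have le: "measure M (\<Union>i. U i - K i) \<le> e / 2" .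
  define W where "W n = UU - (\<Union>i<n. K i)" for n
  have WM: "W n \<in> sets M" for n unfolding W_def UU_def using openM closedM KU by auto
  have lim: "(\<lambda>n. measure M (W n)) \<longlonglongrightarrow> measure M (\<Inter>n. W n)"
    using WM by (intro finite_Lim_measure_decseq) (fastforce simp: W_def decseq_def)+
  have "measure M (\<Inter>n. W n) \<le> e / 2"
  proof -
    have "(\<Inter>n. W n) \<subseteq> (\<Union>i. U i - K i)"
    proof
      fix x assume x: "x \<in> (\<Inter>n. W n)"
      then obtain i where "x \<in> U i" by (auto simp: W_def UU_def)
      moreover have "x \<in> W (Suc i)" using x by blast
      then have "x \<notin> K i" unfolding W_def by blast
      ultimately show "x \<in> (\<Union>i. U i - K i)" by blast
    qed
    then have "measure M (\<Inter>n. W n) \<le> measure M (\<Union>i. U i - K i)" using UK by (intro finite_measure_mono) auto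
    then show ?thesis using le by simp
  qed
  then have "measure M (\<Inter>n. W n) < e" using Union.prems by simp
  with lim have "eventually (\<lambda>n. measure M (W n) < e) sequentially" by (rule order_tendstoD(2))
  then obtain n where n: "measure M (W n) < e" by (auto simp: eventually_sequentially)
  show ?case
  proof (intro exI conjI)
    show "closedin T (\<Union>i<n. K i)" using KU by (intro closedin_Union) auto
    show "openin T UU" unfolding UU_def using KU by auto
    show "measure M (UU - (\<Union>i<n. K i)) < e" using n by (simp add: W_def)
    show "(\<Union>i<n. K i) \<subseteq> (\<Union>i. a i)" using KU(3) by blast
    show "(\<Union>i. a i) \<subseteq> UU" unfolding UU_def using KU(4) by blast
  qed
qed

lemma equidistributed_inner_approx:
  assumes M: "equidistributed M" and A: "A \<in> sets M" and e: "e > 0"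
  shows "\<exists>K. closedin T K \<and> compactin T K \<and> K \<subseteq> A \<and> K \<in> sets M \<and> measure M A \<le> measure M K + e"
proof -
  interpret prob_space M by (rule equidistributed_prob[OF M])
  have sets: "sets M = sigma_sets X gen" using M by (simp add: equidistributed_def)
  obtain K U where KU: "closedin T K" "openin T U" "K \<subseteq> A" "A \<subseteq> U" "measure M (U - K) < e"
    using equidistributed_approx[OF M A[unfolded sets] e] by blast
  have UM: "U \<in> sets M" using KU(2) by (simp add: sets flip: borel_eq_sigma_gen)
  have "X - K \<in> sets M" using KU(1) topspace_T by (simp add: sets closedin_def flip: borel_eq_sigma_gen)
  then have "space M - (X - K) \<in> sets M" by auto
  moreover have "space M - (X - K) = K"
    using M closedin_subset[OF KU(1)] topspace_T by (auto simp: equidistributed_def)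
  ultimately have KM: "K \<in> sets M" by simp
  have "measure M A \<le> measure M (K \<union> (U - K))" using KU UM KM by (intro finite_measure_mono) auto
  also have "\<dots> \<le> measure M K + measure M (U - K)" using UM KM by (intro measure_Un_le) auto
  finally have "measure M A \<le> measure M K + e" using KU by simp
  moreover have "compactin T K" using compact_T KU(1) by (rule closedin_compact_space)
  ultimately show ?thesis using KU KM by blast
qed

text \<open>
  Equal masses follow from translation invariance, because the cylinders of one level are the cosets of one
  subgroup. Conversely translations permute the cylinders of a level, and regularity is
  \<open>equidistributed_inner_approx\<close>.
\<close>

lemma equidistributed_iff_normalized_haar: "normalized_haar G T M \<longleftrightarrow> equidistributed M"
proof
  assume M: "normalized_haar G T M"
  have sets: "sets M = sigma_sets X gen" and sp: "space M = X"
    using M topspace_T borel_eq_sigma_gen by (auto simp: normalized_haar_def)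
  have one: "emeasure M (cyl n x) = emeasure M (cyl n \<one>)" if x: "x \<in> X" for n x
  proof -
    have "x <# cyl n \<one> = cyl n x"
      unfolding l_coset_vimage[OF x cylinder_subset]
    proof (intro equalityI subsetI)
      fix y assume "y \<in> cyl n x"
      then show "y \<in> (\<lambda>z. inv x \<otimes> z) -` cyl n \<one> \<inter> X"
        using translation_cylinder[of "inv x" "\<one>" y n] x by (simp add: cylinder_def)
    next
      fix y assume "y \<in> (\<lambda>z. inv x \<otimes> z) -` cyl n \<one> \<inter> X"
      then show "y \<in> cyl n x" using translation_cylinder[of "inv x" "\<one>" y n] x by simp
    qed
    then show ?thesis using M x cyl_in_sigma[of "\<one>" n] sets unfolding normalized_haar_def by (metis one_closed)
  qed
  have "emeasure M (space M) = 1" using M unfolding normalized_haar_def by blast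
  then have "emeasure M X = 1" using sp by metis
  moreover have "emeasure M (cyl n x) = emeasure M (cyl n y)" if "x \<in> X" "y \<in> X" for n x y
    unfolding one[OF that(1)] one[OF that(2)] ..
  ultimately show "equidistributed M" using sets sp unfolding equidistributed_def by blast
next
  assume M: "equidistributed M"
  interpret prob_space M by (rule equidistributed_prob[OF M])
  have "emeasure M A = (SUP K\<in>{K. compactin T K \<and> K \<subseteq> A}. emeasure M K)" if A: "A \<in> sets M" for A
  proof (rule antisym)
    show "(SUP K\<in>{K. compactin T K \<and> K \<subseteq> A}. emeasure M K) \<le> emeasure M A"
      using A by (intro SUP_least) (auto intro: emeasure_mono)
    show "emeasure M A \<le> (SUP K\<in>{K. compactin T K \<and> K \<subseteq> A}. emeasure M K)"
    proof (rule ennreal_le_epsilon)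
      fix e :: real assume "e > 0"
      then obtain K where K: "compactin T K" "K \<subseteq> A" "measure M A \<le> measure M K + e"
        using equidistributed_inner_approx[OF M A] by blast
      then have "emeasure M A \<le> emeasure M K + ennreal e"
        using \<open>e > 0\<close> by (simp add: emeasure_eq_measure flip: ennreal_plus)
      also have "emeasure M K \<le> (SUP K\<in>{K. compactin T K \<and> K \<subseteq> A}. emeasure M K)"
        using K by (intro SUP_upper) auto
      finally show "emeasure M A \<le> (SUP K\<in>{K. compactin T K \<and> K \<subseteq> A}. emeasure M K) + ennreal e"
        by (simp add: add_mono)
    qed
  qed
  then show "normalized_haar G T M"
    using M equidistributed_l_coset[OF M] topspace_T borel_eq_sigma_gen
    unfolding normalized_haar_def equidistributed_def by auto
qed

definition digit_measure :: "(nat \<Rightarrow> int) measure" where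
  "digit_measure = distr (Pi\<^sub>M UNIV (\<lambda>_. uniform_count_measure {0..<int p})) (sigma X gen) \<phi>"

lemma digit_measure_cylinder:
  defines "P \<equiv> Pi\<^sub>M UNIV (\<lambda>_::nat. uniform_count_measure {0..<int p})"
  assumes x: "x \<in> X"
  shows "\<phi> -` cyl n x \<inter> space P \<in> sets P" "emeasure P (\<phi> -` cyl n x \<inter> space P) = ennreal ((1 / real p) ^ Suc n)"
proof -
  let ?u = "uniform_count_measure {0..<int p}"
  have prob: "prob_space ?u" by (rule prob_space_uniform_count_measure) (use p_pos in auto)
  have sp: "space P = {y. \<forall>i. y i \<in> {0..<int p}}"
    by (auto simp: P_def space_PiM space_uniform_count_measure PiE_UNIV_domain)
  obtain d where d: "\<And>i. d i \<in> {0..<int p}"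
     "\<And>y. (\<forall>i. y i \<in> {0..<int p}) \<Longrightarrow> \<phi> y \<in> cyl n x \<longleftrightarrow> (\<forall>i\<le>n. y i = d i)"
    using digits[OF x, of n] by blast
  have eq: "\<phi> -` cyl n x \<inter> space P = prod_emb UNIV (\<lambda>_. ?u) {..n} (Pi\<^sub>E {..n} (\<lambda>i. {d i}))"
    using d(2) unfolding sp
    by (auto simp: prod_emb_def space_uniform_count_measure PiE_iff extensional_def restrict_def)
  show "\<phi> -` cyl n x \<inter> space P \<in> sets P"
    unfolding eq unfolding P_def using d(1) by (intro sets_PiM_I) (auto simp: sets_uniform_count_measure)
  have "emeasure P (\<phi> -` cyl n x \<inter> space P) = (\<Prod>i\<le>n. emeasure ?u {d i})"
    unfolding eq unfolding P_def using d(1) prob by (intro emeasure_PiM_emb) (auto simp: sets_uniform_count_measure)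
  also have "\<dots> = (\<Prod>i\<le>n. ennreal (1 / real p))"
    using d(1) by (intro prod.cong) (auto simp: emeasure_uniform_count_measure)
  also have "\<dots> = ennreal (1 / real p) ^ Suc n" by (simp only: prod_constant card_atMost)
  also have "\<dots> = ennreal ((1 / real p) ^ Suc n)" by (rule ennreal_power) simp
  finally show "emeasure P (\<phi> -` cyl n x \<inter> space P) = ennreal ((1 / real p) ^ Suc n)" .
qed

lemma digit_measure:
  shows equidistributed_digit_measure: "equidistributed digit_measure"
    and emeasure_digit_measure: "x \<in> X \<Longrightarrow> emeasure digit_measure (cyl n x) = ennreal ((1 / real p) ^ Suc n)"
proof -
  let ?u = "uniform_count_measure {0..<int p}"
  let ?P = "Pi\<^sub>M UNIV (\<lambda>_::nat. ?u)"
  interpret P: prob_space ?P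
    by (intro prob_space_PiM prob_space_uniform_count_measure) (use p_pos in auto)
  have sp: "space ?P = {y. \<forall>i. y i \<in> {0..<int p}}"
    by (auto simp: space_PiM space_uniform_count_measure PiE_UNIV_domain)
  have sg: "sets (sigma X gen) = sigma_sets X gen" "space (sigma X gen) = X"
    using gen_subset by (auto simp: sets_measure_of space_measure_of)
  have meas: "\<phi> \<in> measurable ?P (sigma X gen)"
  proof (rule measurable_sigma_sets[OF sg(1) gen_subset])
    show "\<phi> \<in> space ?P \<rightarrow> X" using digits_closed sp by auto
    fix C assume "C \<in> gen"
    then consider "C = {}" | "C = X" | n x where "x \<in> X" "C = cyl n x" by (auto simp: gen_def cyls_def)
    then show "\<phi> -` C \<inter> space ?P \<in> sets ?P"
    proof cases
      case 2
      then have "\<phi> -` C \<inter> space ?P = space ?P" using digits_closed sp by auto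
      then show ?thesis by (metis sets.top)
    next
      case (3 n x) then show ?thesis using digit_measure_cylinder(1) by simp
    qed simp
  qed
  show cyl: "emeasure digit_measure (cyl n x) = ennreal ((1 / real p) ^ Suc n)" if "x \<in> X" for x n
    unfolding digit_measure_def using meas that cyl_in_sigma sg digit_measure_cylinder(2)
    by (subst emeasure_distr) auto
  have "\<phi> -` X \<inter> space ?P = space ?P" using digits_closed sp by auto
  moreover have "X \<in> sets (sigma X gen)" using sg by (metis sets.top)
  ultimately have "emeasure digit_measure X = 1"
    unfolding digit_measure_def using meas by (subst emeasure_distr) (auto simp: P.emeasure_space_1)
  then show "equidistributed digit_measure"
    using cyl sg unfolding equidistributed_def by (simp add: digit_measure_def)
qed

theorem haar_measure_eq: "haar_measure G T = digit_measure"
  unfolding haar_measure_def equidistributed_iff_normalized_haar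
  by (rule the_equality) (auto intro: equidistributed_digit_measure equidistributed_unique)

abbreviation "\<mu> \<equiv> haar_measure G T"

lemma haar_equidistributed: "equidistributed \<mu>"
  by (simp add: haar_measure_eq equidistributed_digit_measure)

lemma haar_cylinder: "x \<in> X \<Longrightarrow> measure \<mu> (cyl n x) = 1 / real p ^ Suc n"
  by (simp add: haar_measure_eq measure_def emeasure_digit_measure power_one_over)

lemma haar_sets_cylinder: "x \<in> X \<Longrightarrow> cyl n x \<in> sets \<mu>"
  using haar_equidistributed cyl_in_sigma by (simp add: equidistributed_def)

lemma haar_space: "space \<mu> = X"
  using haar_equidistributed by (simp add: equidistributed_def)

lemma haar_prob: "prob_space \<mu>"
  by (rule equidistributed_prob[OF haar_equidistributed])

lemma haar_UN_cylinders:
  assumes fin: "finite I" and r: "\<And>i. i \<in> I \<Longrightarrow> r i \<in> X"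
    and disj: "\<And>i j. i \<in> I \<Longrightarrow> j \<in> I \<Longrightarrow> i \<noteq> j \<Longrightarrow> cyl n (r i) \<inter> cyl n (r j) = {}"
  shows "(\<Union>i\<in>I. cyl n (r i)) \<in> sets \<mu>"
    and "measure \<mu> (\<Union>i\<in>I. cyl n (r i)) = real (card I) / real p ^ Suc n"
proof -
  interpret prob_space \<mu> by (rule haar_prob)
  show "(\<Union>i\<in>I. cyl n (r i)) \<in> sets \<mu>" using fin haar_sets_cylinder r by (intro sets.finite_UN) auto
  have "measure \<mu> (\<Union>i\<in>I. cyl n (r i)) = (\<Sum>i\<in>I. measure \<mu> (cyl n (r i)))"
    using fin haar_sets_cylinder r disj
    by (intro finite_measure_finite_Union) (auto simp: disjoint_family_on_def)
  also have "\<dots> = (\<Sum>i\<in>I. 1 / real p ^ Suc n)" using r by (intro sum.cong haar_cylinder refl) auto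
  finally show "measure \<mu> (\<Union>i\<in>I. cyl n (r i)) = real (card I) / real p ^ Suc n" by simp
qed

lemma haar_le_card_cylinders:
  assumes K: "K \<subseteq> X"
  shows "measure \<mu> K \<le> real (card (cyl n ` K)) / real p ^ Suc n"
proof -
  interpret prob_space \<mu> by (rule haar_prob)
  have fin: "finite (cyl n ` K)" using finite_cyls[of n] K unfolding cyls_def by (meson finite_subset image_mono)
  have M: "C \<in> sets \<mu>" if "C \<in> cyl n ` K" for C using that haar_sets_cylinder K by blast
  have "measure \<mu> K \<le> measure \<mu> (\<Union>(cyl n ` K))"
    using K M fin mem_cylinder_self by (intro finite_measure_mono) blast+
  also have "\<dots> \<le> (\<Sum>C\<in>cyl n ` K. measure \<mu> C)"
    using finite_measure_subadditive_finite[OF fin, of "\<lambda>C. C"] M by auto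
  also have "\<dots> = (\<Sum>C\<in>cyl n ` K. 1 / real p ^ Suc n)"
    using haar_cylinder K by (intro sum.cong) auto
  finally show ?thesis by simp
qed

text \<open>
  For each pair \<open>(x, y)\<close> some cylinder around the product misses the closed set \<open>K\<close>. The pairs that can
  use level \<open>n\<close> form an open set that increases with \<open>n\<close>, so compactness of \<open>K \<times> K\<close> gives one level
  for all pairs.
\<close>

lemma closed_product_free_separated:
  assumes K: "closedin T K" and free: "\<And>x y. x \<in> K \<Longrightarrow> y \<in> K \<Longrightarrow> x \<otimes> y \<notin> K"
  obtains n where "\<And>x y. x \<in> K \<Longrightarrow> y \<in> K \<Longrightarrow> cyl n (x \<otimes> y) \<inter> K = {}"
proof -
  have KX: "K \<subseteq> X" using closedin_subset[OF K] topspace_T by simp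
  define W where "W n = {(x, y). x \<in> X \<and> y \<in> X \<and> cyl n (x \<otimes> y) \<inter> K = {}}" for n
  have "openin (prod_topology T T) (W n)" for n
    unfolding openin_prod_topology_alt
  proof (intro allI impI)
    fix x y assume xy: "(x, y) \<in> W n"
    then have X: "x \<in> X" "y \<in> X" by (auto simp: W_def)
    have "cyl n x \<times> cyl n y \<subseteq> W n"
    proof (rule subsetI)
      fix z assume "z \<in> cyl n x \<times> cyl n y"
      then obtain u v where uv: "z = (u, v)" "u \<in> cyl n x" "v \<in> cyl n y" by blast
      then have uvX: "u \<in> X" "v \<in> X" using cylinder_subset by blast+
      have "u \<otimes> v \<in> cyl n (u \<otimes> y)" using mult_cylinder[OF uvX(1) X(2) uv(3)] .
      moreover have "y \<otimes> u \<in> cyl n (y \<otimes> x)" using mult_cylinder[OF X(2) X(1) uv(2)] .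
      ultimately have "cyl n (u \<otimes> v) = cyl n (x \<otimes> y)"
        using m_comm[OF X(2) X(1)] m_comm[OF X(2) uvX(1)] by (metis cylinder_eq)
      then show "z \<in> W n" using xy uv uvX by (simp add: W_def)
    qed
    then show "\<exists>U V. openin T U \<and> openin T V \<and> x \<in> U \<and> y \<in> V \<and> U \<times> V \<subseteq> W n"
      using openin_cylinder mem_cylinder_self[OF X(1)] mem_cylinder_self[OF X(2)]
      by (intro exI[of _ "cyl n x"] exI[of _ "cyl n y"] conjI)
  qed
  then have opens: "openin (prod_topology T T) S" if "S \<in> range W" for S using that by blast
  have comp: "compactin (prod_topology T T) (K \<times> K)"
    using closedin_compact_space[OF compact_T K] by (simp add: compactin_Times)
  have "K \<times> K \<subseteq> (\<Union>n. W n)"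
  proof (rule subsetI)
    fix z assume "z \<in> K \<times> K"
    then obtain x y where xy: "z = (x, y)" "x \<in> K" "y \<in> K" by blast
    have "openin T (X - K)" using K topspace_T by (simp add: closedin_def)
    moreover have "x \<otimes> y \<in> X - K" using free[OF xy(2,3)] xy KX by auto
    ultimately obtain n where "cyl n (x \<otimes> y) \<subseteq> X - K" unfolding openin_T by blast
    then have "(x, y) \<in> W n" using xy KX by (auto simp: W_def)
    then show "z \<in> (\<Union>n. W n)" using xy by blast
  qed
  from compactinD[OF comp opens this]
  obtain F where F: "finite F" "F \<subseteq> range W" "K \<times> K \<subseteq> \<Union>F" by blast
  then obtain I where I: "finite I" "F = W ` I" by (meson finite_subset_image)
  obtain n where n: "\<And>i. i \<in> I \<Longrightarrow> i \<le> n" using I(1) by (auto simp: finite_nat_set_iff_bounded_le)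
  show ?thesis
  proof (rule that[of n])
    fix x y assume "x \<in> K" "y \<in> K"
    then have "(x, y) \<in> \<Union>F" using F(3) by blast
    then obtain i where "i \<in> I" "(x, y) \<in> W i" using I(2) by blast
    then show "cyl n (x \<otimes> y) \<inter> K = {}"
      using cylinder_antimono[OF n[of i], of X "x \<otimes> y"] by (auto simp: W_def)
  qed
qed

lemma product_free_measure_eqI:
  assumes upper: "\<And>A. A \<in> sets \<mu> \<Longrightarrow> product_free G A \<Longrightarrow> measure \<mu> A \<le> c"
    and lower: "\<And>e::real. e > 0 \<Longrightarrow> \<exists>A\<in>sets \<mu>. product_free G A \<and> c - e \<le> measure \<mu> A"
  shows "product_free_measure G T = c"
proof -
  let ?F = "{A \<in> sets \<mu>. product_free G A}"
  have "product_free G {}" by (simp add: product_free_def)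
  then have ne: "?F \<noteq> {}" by blast
  have bdd: "bdd_above (measure \<mu> ` ?F)" using upper by (intro bdd_aboveI2[of _ _ c]) auto
  have le: "(SUP A\<in>?F. measure \<mu> A) \<le> c" using upper by (intro cSUP_least[OF ne]) auto
  have eps: "c \<le> (SUP A\<in>?F. measure \<mu> A) + e" if e: "e > 0" for e
  proof -
    obtain A where A: "A \<in> sets \<mu>" "product_free G A" "c - e \<le> measure \<mu> A" using lower[OF e] by blast
    have "measure \<mu> A \<le> (SUP A\<in>?F. measure \<mu> A)" using A by (intro cSUP_upper[OF _ bdd]) auto
    with A(3) show ?thesis by simp
  qed
  have "c \<le> (SUP A\<in>?F. measure \<mu> A)" by (rule field_le_epsilon) (rule eps)
  with le show ?thesis unfolding product_free_measure_def by (rule antisym)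
qed

end

lemma middle_interval_sumfree:
  fixes a b N s t :: int
  assumes "b < 2 * a" "2 * b < N + a" "b < N" and "s \<in> {a..b}" "t \<in> {a..b}"
  shows "(s + t) mod N \<notin> {a..b}"
proof (cases "s + t < N")
  case True
  moreover have "s + t \<ge> 0" using assms by simp
  ultimately show ?thesis using assms by (simp add: mod_pos_pos_trivial)
next
  case False
  have "(s + t) mod N = (s + t - N) mod N" by simp
  also have "\<dots> = s + t - N" using False assms by (intro mod_pos_pos_trivial) auto
  finally show ?thesis using assms by auto
qed

text \<open>
  The map \<open>c\<close> stands for the projection onto a cyclic quotient of order \<open>N\<close>, and the set is the
  preimage of a middle third.
\<close>

lemma (in digit_group) product_free_interval:
  fixes c :: "(nat \<Rightarrow> int) \<Rightarrow> int" and a b N :: int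
  assumes cyl: "\<And>x y. x \<in> X \<Longrightarrow> y \<in> X \<Longrightarrow> y \<in> cyl n x \<longleftrightarrow> c y = c x"
    and hom: "\<And>x y. x \<in> X \<Longrightarrow> y \<in> X \<Longrightarrow> c (x \<otimes> y) = (c x + c y) mod N"
    and surj: "\<And>t. t \<in> {0..<N} \<Longrightarrow> \<exists>x\<in>X. c x = t"
    and ab: "0 \<le> a" "a \<le> b + 1" "b < N" "b < 2 * a" "2 * b < N + a"
  shows "\<exists>A\<in>sets \<mu>. product_free G A \<and> measure \<mu> A = of_int (b - a + 1) / real p ^ Suc n"
proof -
  have "\<forall>t\<in>{a..b}. \<exists>x. x \<in> X \<and> c x = t"
  proof
    fix t assume "t \<in> {a..b}"
    then have "t \<in> {0..<N}" using ab by simp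
    then show "\<exists>x. x \<in> X \<and> c x = t" using surj by blast
  qed
  then have "\<exists>r. \<forall>t\<in>{a..b}. r t \<in> X \<and> c (r t) = t" by (rule bchoice)
  then obtain r where rX: "\<And>t. t \<in> {a..b} \<Longrightarrow> r t \<in> X" and cr: "\<And>t. t \<in> {a..b} \<Longrightarrow> c (r t) = t"
    by blast
  define A where "A = (\<Union>t\<in>{a..b}. cyl n (r t))"
  have mem: "x \<in> A \<longleftrightarrow> x \<in> X \<and> c x \<in> {a..b}" for x
  proof
    assume "x \<in> A"
    then obtain t where t: "t \<in> {a..b}" "x \<in> cyl n (r t)" by (auto simp: A_def)
    then have "x \<in> X" using cylinder_subset[of X n "r t"] by auto
    then show "x \<in> X \<and> c x \<in> {a..b}" using cyl[OF rX[OF t(1)]] t cr[OF t(1)] by simp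
  next
    assume x: "x \<in> X \<and> c x \<in> {a..b}"
    then have "x \<in> cyl n (r (c x))" using cyl[OF rX, of "c x" x] cr[of "c x"] by simp
    then show "x \<in> A" using x by (auto simp: A_def)
  qed
  have disj: "cyl n (r s) \<inter> cyl n (r t) = {}" if st: "s \<in> {a..b}" "t \<in> {a..b}" "s \<noteq> t" for s t
  proof -
    have False if x: "x \<in> cyl n (r s)" "x \<in> cyl n (r t)" for x
    proof -
      have xX: "x \<in> X" using x cylinder_subset[of X n "r t"] by auto
      have "c x = s" using cyl[OF rX[OF st(1)] xX] x(1) cr[OF st(1)] by simp
      moreover have "c x = t" using cyl[OF rX[OF st(2)] xX] x(2) cr[OF st(2)] by simp
      ultimately show False using st(3) by simp
    qed
    then show ?thesis by blast
  qed
  have "A \<in> sets \<mu>" unfolding A_def by (rule haar_UN_cylinders(1)) (use rX disj in auto)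
  moreover have "measure \<mu> A = real (card {a..b}) / real p ^ Suc n"
    unfolding A_def by (rule haar_UN_cylinders(2)) (use rX disj in auto)
  moreover have "real (card {a..b}) = of_int (b - a + 1)" using ab by simp
  moreover have "product_free G A"
    unfolding product_free_def
  proof (intro conjI notI)
    show "A \<subseteq> X" using mem by auto
    assume "\<exists>x\<in>A. \<exists>y\<in>A. \<exists>z\<in>A. x \<otimes> y = z"
    then obtain x y where xy: "x \<in> A" "y \<in> A" "x \<otimes> y \<in> A" by blast
    then have "(c x + c y) mod N \<in> {a..b}" using mem hom by metis
    then show False using middle_interval_sumfree[OF ab(4,5,3)] xy mem by blast
  qed
  ultimately show ?thesis by metis
qed

section \<open>The \<open>p\<close>-adic integers\<close>

abbreviation padic_group :: "nat \<Rightarrow> (nat \<Rightarrow> int) monoid" where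
  "padic_group p \<equiv> add_monoid (padic_int_ring p)"

lemma padic_carrier:
  "x \<in> carrier (padic_int_ring p) \<longleftrightarrow>
    (\<forall>n. 0 \<le> x n \<and> x n < int p ^ Suc n \<and> x (Suc n) mod int p ^ Suc n = x n)"
  by (auto simp: padic_int_ring_def residue_ring_def)

lemma padic_add: "x \<oplus>\<^bsub>padic_int_ring p\<^esub> y = (\<lambda>n. (x n + y n) mod int p ^ Suc n)"
  by (simp add: padic_int_ring_def residue_ring_def)

lemma padic_mod:
  assumes "x \<in> carrier (padic_int_ring p)" "i \<le> n"
  shows "x n mod int p ^ Suc i = x i"
  using assms(2)
proof (induction n rule: dec_induct)
  case base
  then show ?case using assms(1) by (simp add: padic_carrier)
next
  case (step n)
  have "x (Suc n) mod int p ^ Suc i = (x (Suc n) mod int p ^ Suc n) mod int p ^ Suc i"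
    using step by (intro mod_mod_cancel[symmetric] le_imp_power_dvd) simp
  also have "\<dots> = x n mod int p ^ Suc i" using assms(1) by (simp only: padic_carrier)
  finally show ?case using step by simp
qed

lemma padic_mem_cylinder:
  assumes "x \<in> carrier (padic_int_ring p)" "y \<in> carrier (padic_int_ring p)"
  shows "y \<in> cylinder (carrier (padic_int_ring p)) n x \<longleftrightarrow> y n = x n"
  using assms padic_mod[of x p _ n] padic_mod[of y p _ n] unfolding cylinder_def by auto

definition digit_sum :: "nat \<Rightarrow> (nat \<Rightarrow> int) \<Rightarrow> nat \<Rightarrow> int" where
  "digit_sum p d n = (\<Sum>i\<le>n. d i * int p ^ i)"

lemma digit_sum_bounds:
  assumes d: "\<And>i. d i \<in> {0..<int p}" shows "0 \<le> digit_sum p d n \<and> digit_sum p d n < int p ^ Suc n"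
proof (induction n)
  case 0
  then show ?case using d[of 0] by (simp add: digit_sum_def)
next
  case (Suc n)
  have "d (Suc n) * int p ^ Suc n \<le> (int p - 1) * int p ^ Suc n"
    using d[of "Suc n"] by (intro mult_right_mono) auto
  moreover have "0 \<le> d (Suc n) * int p ^ Suc n" using d[of "Suc n"] by simp
  moreover have "digit_sum p d (Suc n) = digit_sum p d n + d (Suc n) * int p ^ Suc n"
    by (simp add: digit_sum_def)
  ultimately show ?case using Suc by (simp add: algebra_simps)
qed

lemma digit_sum_carrier:
  assumes d: "\<And>i. d i \<in> {0..<int p}" shows "digit_sum p d \<in> carrier (padic_int_ring p)"
proof -
  have "digit_sum p d (Suc n) mod int p ^ Suc n = digit_sum p d n" for n
  proof -
    have "digit_sum p d (Suc n) = digit_sum p d n + d (Suc n) * int p ^ Suc n" by (simp add: digit_sum_def)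
    then have "digit_sum p d (Suc n) mod int p ^ Suc n = digit_sum p d n mod int p ^ Suc n" by simp
    then show ?thesis using digit_sum_bounds[where d = d and n = n, OF d] by simp
  qed
  then show ?thesis using digit_sum_bounds[where d = d, OF d] by (simp add: padic_carrier)
qed

lemma digit_sum_eq_iff:
  assumes "p > 0" shows "(\<forall>m\<le>n. digit_sum p c m = digit_sum p d m) \<longleftrightarrow> (\<forall>i\<le>n. c i = d i)"
proof (induction n)
  case (Suc n)
  have "(\<forall>m\<le>Suc n. P m) \<longleftrightarrow> (\<forall>m\<le>n. P m) \<and> P (Suc n)" for P by (auto simp: le_Suc_eq)
  moreover have "digit_sum p c (Suc n) = digit_sum p d (Suc n) \<longleftrightarrow> c (Suc n) = d (Suc n)"
    if "digit_sum p c n = digit_sum p d n"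
    using that assms by (simp add: digit_sum_def)
  ultimately show ?case using Suc by auto
qed (simp add: digit_sum_def)

lemma digit_sum_expansion:
  assumes p: "p > 0" and x: "x \<in> carrier (padic_int_ring p)"
  shows "\<exists>d. (\<forall>i. d i \<in> {0..<int p}) \<and> digit_sum p d = x"
proof -
  define d where "d i = x i div int p ^ i" for i
  have "d i \<in> {0..<int p}" for i
  proof -
    have "0 \<le> x i" "x i < int p ^ i * int p" using x by (auto simp: padic_carrier mult.commute)
    have P: "int p ^ i > 0" using p by simp
    have "x i div int p ^ i * int p ^ i \<le> x i" using P by (simp add: minus_mod_eq_div_mult[symmetric])
    also have "\<dots> < int p * int p ^ i" using \<open>x i < int p ^ i * int p\<close> by (simp add: mult.commute)
    finally have "x i div int p ^ i < int p" using P by (simp add: mult_less_cancel_right_pos)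
    then show ?thesis using P \<open>0 \<le> x i\<close> by (simp add: d_def pos_imp_zdiv_nonneg_iff)
  qed
  moreover have "digit_sum p d n = x n" for n
  proof (induction n)
    case (Suc n)
    have "digit_sum p d (Suc n) = x n + x (Suc n) div int p ^ Suc n * int p ^ Suc n"
      using Suc by (simp add: digit_sum_def d_def)
    also have "x n = x (Suc n) mod int p ^ Suc n" using x by (simp add: padic_carrier)
    finally show ?case by (simp only: mod_div_mult_eq)
  qed (simp add: digit_sum_def d_def)
  ultimately show ?thesis by blast
qed

lemma padic_digit_group:
  assumes p: "prime p"
  shows "digit_group (padic_group p) (padic_int_topology p) p (\<lambda>n. int p ^ Suc n) (digit_sum p)"
proof -
  have p1: "p > 1" using prime_gt_1_nat[OF p] .
  interpret R: cring "padic_int_ring p" by (rule cring_padic_int_ring[OF p1])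
  let ?S = "\<lambda>n. carrier (residue_ring (int p ^ Suc n))"
  let ?X = "carrier (padic_int_ring p)"
  have S: "?S n = {0..<int p ^ Suc n}" for n by (auto simp: residue_ring_def)
  have X: "?X \<subseteq> {x. \<forall>n. x n \<in> ?S n}" unfolding S by (auto simp: padic_carrier)
  interpret G: comm_group "padic_group p" by (rule R.a_comm_group)
  show ?thesis
  proof
    show "p > 0" using p1 by simp
    show "x n \<in> {0..<int p ^ Suc n}" if "x \<in> carrier (padic_group p)" for x n
      using that by (simp add: padic_carrier)
    show "openin (padic_int_topology p) U \<longleftrightarrow> U \<subseteq> carrier (padic_group p) \<and>
        (\<forall>x\<in>U. \<exists>n. cylinder (carrier (padic_group p)) n x \<subseteq> U)" for U
      using openin_prefix_topology[OF X, of U] by (simp add: padic_int_topology_def)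
    show "compact_space (padic_int_topology p)"
      unfolding padic_int_topology_def
    proof (rule compact_prefix_topology[OF X])
      show "finite (?S n)" for n unfolding S by simp
      fix x assume x: "\<forall>n. x n \<in> ?S n" "x \<notin> ?X"
      then obtain n where "x (Suc n) mod int p ^ Suc n \<noteq> x n" unfolding S by (auto simp: padic_carrier)
      then have "cylinder ?X (Suc n) x = {}" by (auto simp: cylinder_def padic_carrier) (metis le_SucI order_refl power_Suc)
      then show "\<exists>n. cylinder ?X n x = {}" by blast
    qed
    show "g \<otimes>\<^bsub>padic_group p\<^esub> y \<in> cylinder (carrier (padic_group p)) n (g \<otimes>\<^bsub>padic_group p\<^esub> x)"
      if "g \<in> carrier (padic_group p)" "x \<in> carrier (padic_group p)"
        "y \<in> cylinder (carrier (padic_group p)) n x" for g x y n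
      using that R.add.m_closed[of g y] by (simp add: cylinder_def padic_add)
    show "digit_sum p d \<in> carrier (padic_group p)" if "\<And>i. d i \<in> {0..<int p}" for d
      using digit_sum_carrier[of d p] that by simp
    fix x n assume "x \<in> carrier (padic_group p)"
    then obtain d where d: "\<forall>i. d i \<in> {0..<int p}" "digit_sum p d = x"
      using digit_sum_expansion[of p x] p1 by auto
    have "digit_sum p y \<in> cylinder ?X n x \<longleftrightarrow> (\<forall>i\<le>n. y i = d i)" if "\<forall>i. y i \<in> {0..<int p}" for y
      using digit_sum_carrier[of y p] that digit_sum_eq_iff[of p n y d] p1 d(2) by (simp add: cylinder_def)
    then show "\<exists>d. (\<forall>i. d i \<in> {0..<int p}) \<and> (\<forall>y. (\<forall>i. y i \<in> {0..<int p}) \<longrightarrow>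
        (digit_sum p y \<in> cylinder (carrier (padic_group p)) n x \<longleftrightarrow> (\<forall>i\<le>n. y i = d i)))"
      using d(1) by auto
  qed
qed

text \<open>
  For a closed set \<open>K\<close> that is product-free at level \<open>n\<close>, the residues \<open>S\<close> of its elements modulo
  \<open>p\<close> to the power \<open>n + 1\<close> are sum-free, and the count of \<open>S\<close> bounds the number of cylinders that
  cover \<open>K\<close>. This leaves \<open>c / p\<^sup>i\<close> with \<open>3 c \<le> p\<^sup>i + 1\<close> and \<open>i \<ge> 1\<close>. Equality is possible only
  when \<open>p\<^sup>i\<close> is 2 modulo 3, which fails for \<open>p\<close> congruent to 0 or 1.
\<close>

lemma padic_product_free_le:
  assumes p: "prime p" and A: "A \<in> sets (haar_measure (padic_group p) (padic_int_topology p))"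
    and free: "product_free (padic_group p) A"
  shows "measure (haar_measure (padic_group p) (padic_int_topology p)) A
    \<le> (if [p = 2] (mod 3) then 1 / 3 + 1 / (3 * real p) else 1 / 3)" (is "_ \<le> ?bound")
proof -
  interpret digit_group "padic_group p" "padic_int_topology p" p "\<lambda>n. int p ^ Suc n" "digit_sum p"
    by (rule padic_digit_group[OF p])
  have p1: "p > 1" using prime_gt_1_nat[OF p] .
  let ?X = "carrier (padic_int_ring p)"
  have bound: "measure \<mu> K \<le> ?bound"
    if K: "closedin (padic_int_topology p) K" "K \<subseteq> A" for K
  proof (cases "K = {}")
    case True
    then show ?thesis by simp
  next
    case False
    have KX: "K \<subseteq> ?X" using closedin_subset[OF K(1)] topspace_padic_int_topology by simp
    have "x \<otimes>\<^bsub>padic_group p\<^esub> y \<notin> K" if "x \<in> K" "y \<in> K" for x y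
      using that free K(2) unfolding product_free_def by blast
    then obtain n where n: "\<And>x y. x \<in> K \<Longrightarrow> y \<in> K \<Longrightarrow> cyl n (x \<otimes>\<^bsub>padic_group p\<^esub> y) \<inter> K = {}"
      using closed_product_free_separated[OF K(1)] by blast
    define N where "N = int p ^ Suc n"
    have N: "N > 0" using p1 by (simp add: N_def)
    define S where "S = {t. \<exists>x\<in>K. t mod N = x n}"
    have xN: "x n mod N = x n" "0 \<le> x n" "x n < N" if "x \<in> K" for x
      using that KX padic_carrier[of x p] unfolding N_def by (auto intro!: mod_pos_pos_trivial)
    have perS: "periodic N S" by (simp add: S_def periodic_def)
    obtain x0 where "x0 \<in> K" using False by blast
    then have "x0 n \<in> S" using xN(1) by (auto simp: S_def)
    then have "S \<noteq> {}" by blast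
    have "(S + S) \<inter> S = {}"
    proof -
      have False if st: "s \<in> S" "t \<in> S" "s + t \<in> S" for s t
      proof -
        obtain x y z where xyz: "x \<in> K" "y \<in> K" "z \<in> K" "s mod N = x n" "t mod N = y n" "(s + t) mod N = z n"
          using st by (auto simp: S_def)
        have "z n = (x n + y n) mod N" using xyz by (metis mod_add_eq)
        then have "z n = (x \<oplus>\<^bsub>padic_int_ring p\<^esub> y) n" by (simp add: padic_add N_def)
        moreover have "x \<oplus>\<^bsub>padic_int_ring p\<^esub> y \<in> ?X" using m_closed[of x y] xyz KX by auto
        ultimately have "z \<in> cyl n (x \<otimes>\<^bsub>padic_group p\<^esub> y)"
          using padic_mem_cylinder[of "x \<oplus>\<^bsub>padic_int_ring p\<^esub> y" p z n] xyz KX by auto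
        then show False using n[OF xyz(1,2)] xyz(3) by blast
      qed
      then show ?thesis by (auto simp: set_plus_def)
    qed
    then obtain i c :: nat where ic: "1 \<le> i" "i \<le> Suc n" "3 * c \<le> p ^ i + 1"
        "count_mod N S \<le> p ^ (Suc n - i) * c"
      using count_sumfree_prime_power[OF p N_def perS \<open>S \<noteq> {}\<close>] by blast
    have "card (cyl n ` K) \<le> card ((\<lambda>x. x n) ` K)"
    proof (rule surj_card_le)
      have "(\<lambda>x. x n) ` K \<subseteq> {0..<N}" using xN by auto
      then show "finite ((\<lambda>x. x n) ` K)" by (rule finite_subset) simp
      define rep where "rep r = (SOME x. x \<in> K \<and> x n = r)" for r
      show "cyl n ` K \<subseteq> (\<lambda>r. cyl n (rep r)) ` (\<lambda>x. x n) ` K"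
      proof
        fix C assume "C \<in> cyl n ` K"
        then obtain x where x: "x \<in> K" "C = cyl n x" by blast
        have "rep (x n) \<in> K \<and> rep (x n) n = x n" unfolding rep_def by (rule someI[of _ x]) (use x in simp)
        then have "x \<in> cyl n (rep (x n))" using padic_mem_cylinder[of "rep (x n)" p x n] x KX by auto
        then have "C = cyl n (rep (x n))" using cylinder_eq x(2) by blast
        then show "C \<in> (\<lambda>r. cyl n (rep r)) ` (\<lambda>x. x n) ` K" using x by blast
      qed
    qed
    also have "(\<lambda>x. x n) ` K = S \<inter> {0..<N}"
    proof (intro equalityI subsetI)
      fix t assume "t \<in> S \<inter> {0..<N}"
      then show "t \<in> (\<lambda>x. x n) ` K" by (auto simp: S_def)
    next
      fix t assume "t \<in> (\<lambda>x. x n) ` K"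
      then obtain x where x: "x \<in> K" "t = x n" by blast
      then show "t \<in> S \<inter> {0..<N}" using xN[OF x(1)] by (auto simp: S_def)
    qed
    also have "card (S \<inter> {0..<N}) = count_mod N S" by (simp add: count_mod_def)
    finally have card: "card (cyl n ` K) \<le> p ^ (Suc n - i) * c" using ic(4) by simp
    have "measure \<mu> K \<le> real (card (cyl n ` K)) / real p ^ Suc n"
      using haar_le_card_cylinders[of K n] KX by simp
    also have "\<dots> \<le> real (p ^ (Suc n - i) * c) / real p ^ Suc n"
      using card by (intro divide_right_mono) (auto simp del: of_nat_mult of_nat_power)
    also have "real p ^ Suc n = real p ^ (Suc n - i) * real p ^ i"
      using ic(2) by (simp flip: power_add)
    also have "real (p ^ (Suc n - i) * c) / \<dots> = real c / real p ^ i" using p1 by simp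
    finally have mu: "measure \<mu> K \<le> real c / real p ^ i" .
    have pi: "real p ^ i > 0" using p1 by simp
    show ?thesis
    proof (cases "[p = 2] (mod 3)")
      case True
      have "real (3 * c) \<le> real (p ^ i + 1)" using ic(3) by (simp only: of_nat_le_iff)
      then have "3 * real c \<le> real p ^ i + 1" by simp
      then have "real c / real p ^ i \<le> 1 / 3 + 1 / (3 * real p ^ i)" using pi by (simp add: field_simps)
      also have "\<dots> \<le> 1 / 3 + 1 / (3 * real p)"
      proof -
        have "real p ^ 1 \<le> real p ^ i" using p1 ic(1) by (intro power_increasing) auto
        then show ?thesis using p1 by (intro add_left_mono divide_left_mono) auto
      qed
      finally show ?thesis using mu True by simp
    next
      case False
      have "3 * c \<le> p ^ i"
      proof (rule ccontr)
        assume "\<not> 3 * c \<le> p ^ i"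
        then have "3 * c = p ^ i + 1" using ic(3) by simp
        then have "(p ^ i + 1) mod 3 = 0" by (metis mod_mult_self1_is_0)
        moreover have "p mod 3 \<noteq> 2" using False by (simp add: cong_def)
        then have "p mod 3 = 0 \<or> p mod 3 = 1" by linarith
        then have "p ^ i mod 3 = 0 \<or> p ^ i mod 3 = 1"
        proof
          assume "p mod 3 = 0"
          then have "3 dvd p" by presburger
          then have "3 dvd p ^ i" using ic(1) by (cases i) (auto intro: dvd_mult2)
          then show ?thesis by auto
        next
          assume "p mod 3 = 1"
          then have "p ^ i mod 3 = 1 ^ i mod 3" by (metis power_mod)
          then show ?thesis by simp
        qed
        ultimately show False by presburger
      qed
      then have "real (3 * c) \<le> real (p ^ i)" by (simp only: of_nat_le_iff)
      then have "3 * real c \<le> real p ^ i" by simp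
      then have "real c / real p ^ i \<le> 1 / 3" using pi by (simp add: field_simps)
      with mu have "measure \<mu> K \<le> 1 / 3" by (rule order_trans)
      then show ?thesis using False by (simp only: if_False)
    qed
  qed
  have "measure \<mu> A \<le> ?bound + e" if e: "e > 0" for e
  proof -
    obtain K where K: "closedin (padic_int_topology p) K" "K \<subseteq> A" "measure \<mu> A \<le> measure \<mu> K + e"
      using equidistributed_inner_approx[OF haar_equidistributed A e] by blast
    then show ?thesis using bound[OF K(1,2)] by linarith
  qed
  then show ?thesis by (rule field_le_epsilon)
qed

lemma padic_interval:
  fixes a b :: int
  assumes p: "prime p" and ab: "0 \<le> a" "a \<le> b + 1" "b < int p ^ Suc n" "b < 2 * a" "2 * b < int p ^ Suc n + a"
  shows "\<exists>A\<in>sets (haar_measure (padic_group p) (padic_int_topology p)). product_free (padic_group p) A \<and>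
    measure (haar_measure (padic_group p) (padic_int_topology p)) A = of_int (b - a + 1) / real p ^ Suc n"
proof -
  interpret digit_group "padic_group p" "padic_int_topology p" p "\<lambda>n. int p ^ Suc n" "digit_sum p"
    by (rule padic_digit_group[OF p])
  have p1: "p > 1" using prime_gt_1_nat[OF p] .
  show ?thesis
  proof (rule product_free_interval[where c = "\<lambda>x. x n" and N = "int p ^ Suc n", OF _ _ _ ab])
    show "y \<in> cyl n x \<longleftrightarrow> y n = x n" if "x \<in> X" "y \<in> X" for x y
      using padic_mem_cylinder[of x p y n] that by simp
    show "(x \<otimes>\<^bsub>padic_group p\<^esub> y) n = (x n + y n) mod int p ^ Suc n" for x y by (simp add: padic_add)
    fix t assume t: "t \<in> {0..<int p ^ Suc n}"
    have "(\<lambda>m. t mod int p ^ Suc m) \<in> carrier (padic_int_ring p)"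
      unfolding padic_carrier using p1 by (auto intro: mod_mod_cancel)
    then show "\<exists>x\<in>X. x n = t"
      using t by (intro bexI[of _ "\<lambda>m. t mod int p ^ Suc m"]) (auto simp: mod_pos_pos_trivial)
  qed
qed

text \<open>
  If \<open>p\<close> is 1 modulo 3 the supremum is not attained by a single quotient: middle thirds modulo \<open>N\<close>,
  a power of \<open>p\<close>, have measure \<open>(1 - 1/N)/3\<close>.
\<close>

lemma padic_product_free_measure:
  assumes p: "prime p"
  shows "product_free_measure (padic_group p) (padic_int_topology p) =
    (if [p = 2] (mod 3) then 1 / 3 + 1 / (3 * real p) else 1 / 3)" (is "_ = ?bound")
proof -
  interpret digit_group "padic_group p" "padic_int_topology p" p "\<lambda>n. int p ^ Suc n" "digit_sum p"
    by (rule padic_digit_group[OF p])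
  have p1: "p > 1" using prime_gt_1_nat[OF p] .
  show ?thesis
  proof (rule product_free_measure_eqI)
    show "measure \<mu> A \<le> ?bound" if "A \<in> sets \<mu>" "product_free (padic_group p) A" for A
      using that by (rule padic_product_free_le[OF p])
    fix e :: real assume e: "e > 0"
    show "\<exists>A\<in>sets \<mu>. product_free (padic_group p) A \<and> ?bound - e \<le> measure \<mu> A"
    proof -
      consider "p mod 3 = 2" | "p mod 3 = 0" | "p mod 3 = 1" by linarith
      then show ?thesis
      proof cases
        case 1
        define k where "k = int (p div 3) + 1"
        have k: "int p = 3 * k - 1" "k > 0" unfolding k_def using 1 by presburger+
        obtain A where A: "A \<in> sets \<mu>" "product_free (padic_group p) A"
            "measure \<mu> A = of_int ((2 * k - 1) - k + 1) / real p ^ Suc 0"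
          using padic_interval[OF p, of k "2 * k - 1" 0] k by auto
        have "real_of_int (int p) = real_of_int (3 * k - 1)" by (simp only: k(1))
        then have "real_of_int k = (real p + 1) / 3" by simp
        then have "measure \<mu> A = ?bound" using A(3) 1 p1 by (simp add: cong_def field_simps)
        then show ?thesis using A e by (intro bexI[of _ A]) auto
      next
        case 2
        then have "3 dvd p" by presburger
        moreover have "prime (3::nat)" by simp
        ultimately have p3: "p = 3" using primes_dvd_imp_eq[of 3 p] p by simp
        obtain A where A: "A \<in> sets \<mu>" "product_free (padic_group p) A"
            "measure \<mu> A = of_int (1 - 1 + 1) / real p ^ Suc 0"
          using padic_interval[OF p, of 1 1 0] p3 by auto
        then have "measure \<mu> A = ?bound" using p3 by (simp add: cong_def)
        then show ?thesis using A e by (intro bexI[of _ A]) auto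
      next
        case 3
        obtain n where n: "(1 / real p) ^ n < e" using e p1 real_arch_pow_inv[of e "1 / real p"] by auto
        define N where "N = int p ^ Suc n"
        have "N mod 3 = (int p mod 3) ^ Suc n mod 3" by (simp add: N_def power_mod del: power_Suc)
        also have "int p mod 3 = 1" using 3 by presburger
        finally have "N mod 3 = 1" by simp
        then obtain m where m: "N = 3 * m + 1" by (metis mult_div_mod_eq)
        have "N > 1" unfolding N_def using p1 by (intro one_less_power) auto
        then have m0: "m > 0" using m by simp
        obtain A where A: "A \<in> sets \<mu>" "product_free (padic_group p) A"
            "measure \<mu> A = of_int (2 * m - (m + 1) + 1) / real p ^ Suc n"
          using padic_interval[OF p, of "m + 1" "2 * m" n] m m0 unfolding N_def by auto
        have realN: "real p ^ Suc n = of_int N" by (simp add: N_def)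
        have "measure \<mu> A = of_int m / of_int N" using A(3) unfolding realN by simp
        also have "\<dots> = 1 / 3 - 1 / (3 * of_int N)" using m m0 by (simp add: field_simps)
        also have "\<dots> \<ge> 1 / 3 - e"
        proof -
          have "1 / (3 * real_of_int N) \<le> 1 / real_of_int N" using \<open>N > 1\<close> by (simp add: field_simps)
          also have "\<dots> \<le> (1 / real p) ^ n"
            unfolding realN[symmetric] power_one_over using p1
            by (intro divide_left_mono) (auto intro: power_increasing)
          finally show ?thesis using n by simp
        qed
        finally have "1 / 3 - e \<le> measure \<mu> A" by simp
        moreover have "?bound = 1 / 3" using 3 by (simp add: cong_def)
        ultimately show ?thesis using A by (intro bexI[of _ A]) auto
      qed
    qed
  qed
qed

section \<open>Power series over a prime field\<close>

abbreviation power_series_group :: "nat \<Rightarrow> (nat \<Rightarrow> int) monoid" where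
  "power_series_group p \<equiv> add_monoid (power_series_ring (residue_ring (int p)))"

abbreviation prime_power_series_topology :: "nat \<Rightarrow> (nat \<Rightarrow> int) topology" where
  "prime_power_series_topology p \<equiv> power_series_topology (residue_ring (int p))"

lemma power_series_carrier:
  "x \<in> carrier (power_series_ring (residue_ring (int p))) \<longleftrightarrow> (\<forall>n. x n \<in> {0..<int p})"
  by (auto simp: power_series_ring_def residue_ring_def)

lemma power_series_add:
  "x \<oplus>\<^bsub>power_series_ring (residue_ring (int p))\<^esub> y = (\<lambda>n. (x n + y n) mod int p)"
  by (simp add: power_series_ring_def residue_ring_def)

lemma power_series_digit_group:
  assumes p: "prime p"
  shows "digit_group (power_series_group p) (prime_power_series_topology p) p (\<lambda>_. int p) (\<lambda>d. d)"
proof -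
  have p1: "p > 1" using prime_gt_1_nat[OF p] .
  let ?R = "power_series_ring (residue_ring (int p))"
  interpret R0: residues "int p" "residue_ring (int p)" by (unfold_locales) (use p1 in auto)
  interpret R: abelian_group ?R
    by (rule abelian_group_power_series_ring) (rule R0.abelian_group_axioms)
  interpret G: comm_group "power_series_group p" by (rule R.a_comm_group)
  let ?S = "\<lambda>n::nat. carrier (residue_ring (int p))"
  let ?X = "carrier ?R"
  have S: "?S n = {0..<int p}" for n by (auto simp: residue_ring_def)
  have X: "?X = {x. \<forall>n. x n \<in> ?S n}" unfolding S by (auto simp: power_series_carrier)
  have T: "prime_power_series_topology p = subtopology (product_topology (\<lambda>n. discrete_topology (?S n)) UNIV) ?X"
  proof -
    have "topspace (product_topology (\<lambda>n. discrete_topology (?S n)) UNIV) = ?X"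
      unfolding X by (auto simp: PiE_UNIV_domain)
    then show ?thesis unfolding power_series_topology_def by (metis subtopology_topspace)
  qed
  show ?thesis
  proof
    show "p > 0" using p1 by simp
    show "x n \<in> {0..<int p}" if "x \<in> carrier (power_series_group p)" for x n
      using that by (simp add: power_series_carrier)
    show "openin (prime_power_series_topology p) U \<longleftrightarrow> U \<subseteq> carrier (power_series_group p) \<and>
        (\<forall>x\<in>U. \<exists>n. cylinder (carrier (power_series_group p)) n x \<subseteq> U)" for U
      unfolding T using openin_prefix_topology[of ?X ?S U] X by simp
    show "compact_space (prime_power_series_topology p)"
      unfolding T
    proof (rule compact_prefix_topology)
      show "?X \<subseteq> {x. \<forall>n. x n \<in> ?S n}" using X by (rule equalityD1)
      show "finite (?S n)" for n unfolding S by simp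
      show "\<exists>n. cylinder ?X n x = {}" if "\<forall>n. x n \<in> ?S n" "x \<notin> ?X" for x
        using that unfolding X by blast
    qed
    show "g \<otimes>\<^bsub>power_series_group p\<^esub> y \<in> cylinder (carrier (power_series_group p)) n (g \<otimes>\<^bsub>power_series_group p\<^esub> x)"
      if "g \<in> carrier (power_series_group p)" "x \<in> carrier (power_series_group p)"
        "y \<in> cylinder (carrier (power_series_group p)) n x" for g x y n
      using that R.add.m_closed[of g y] by (simp add: cylinder_def power_series_add)
    show "d \<in> carrier (power_series_group p)" if "\<And>i. d i \<in> {0..<int p}" for d
      using that by (simp add: power_series_carrier)
    fix x n assume "x \<in> carrier (power_series_group p)"
    then show "\<exists>d. (\<forall>i. d i \<in> {0..<int p}) \<and> (\<forall>y. (\<forall>i. y i \<in> {0..<int p}) \<longrightarrow>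
        (y \<in> cylinder (carrier (power_series_group p)) n x \<longleftrightarrow> (\<forall>i\<le>n. y i = d i)))"
      by (intro exI[of _ x]) (auto simp: power_series_carrier cylinder_def)
  qed
qed

text \<open>
  Double counting: integrate the number of sets to which a point belongs.
\<close>

lemma (in prob_space) sum_measure_le_multiplicity:
  assumes fin: "finite I" and S: "\<And>i. i \<in> I \<Longrightarrow> S i \<in> sets M"
    and le: "\<And>w. w \<in> space M \<Longrightarrow> real (card {i \<in> I. w \<in> S i}) \<le> c"
  shows "(\<Sum>i\<in>I. measure M (S i)) \<le> c"
proof -
  have "(\<Sum>i\<in>I. measure M (S i)) = (\<Sum>i\<in>I. \<integral>w. indicator (S i) w \<partial>M)"
    using S sets.sets_into_space by (intro sum.cong) (auto simp: Int_absorb2)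
  also have "\<dots> = (\<integral>w. (\<Sum>i\<in>I. indicator (S i) w) \<partial>M)"
    by (rule Bochner_Integration.integral_sum[symmetric]) (use S in \<open>auto intro: integrable_real_indicator simp: emeasure_eq_measure\<close>)
  also have "\<dots> \<le> c"
  proof (rule integral_le_const)
    show "integrable M (\<lambda>w. \<Sum>i\<in>I. indicator (S i) w :: real)"
      by (rule Bochner_Integration.integrable_sum) (use S in \<open>auto intro: integrable_real_indicator simp: emeasure_eq_measure\<close>)
    show "AE w in M. (\<Sum>i\<in>I. indicator (S i) w) \<le> c"
    proof (rule AE_I2)
      fix w assume "w \<in> space M"
      moreover have "(\<Sum>i\<in>I. indicator (S i) w :: real) = real (card {i \<in> I. w \<in> S i})"
        using fin by (simp add: indicator_def sum.If_cases Int_def)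
      ultimately show "(\<Sum>i\<in>I. indicator (S i) w) \<le> c" using le by simp
    qed
  qed
  finally show ?thesis .
qed

text \<open>
  For a scalar \<open>i\<close> prime to \<open>p\<close>, the map \<open>x \<mapsto> i x + t\<close> acts entrywise by permutations of the
  residues, so it permutes the cylinders of every level.
\<close>

lemma power_series_affine_measure:
  fixes t :: "nat \<Rightarrow> int"
  assumes p: "prime p" and i: "coprime i (int p)"
    and A: "A \<in> sets (haar_measure (power_series_group p) (prime_power_series_topology p))"
  defines "S \<equiv> {x \<in> carrier (power_series_group p). (\<lambda>n. (i * x n + t n) mod int p) \<in> A}"
  shows "S \<in> sets (haar_measure (power_series_group p) (prime_power_series_topology p))"
    and "measure (haar_measure (power_series_group p) (prime_power_series_topology p)) S =
      measure (haar_measure (power_series_group p) (prime_power_series_topology p)) A"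
proof -
  interpret digit_group "power_series_group p" "prime_power_series_topology p" p "\<lambda>_. int p" "\<lambda>d. d"
    by (rule power_series_digit_group[OF p])
  have p0: "int p > 0" using prime_gt_0_nat[OF p] by simp
  define f where "f x = (\<lambda>n. (i * x n + t n) mod int p)" for x
  have Xiff: "x \<in> X \<longleftrightarrow> (\<forall>n. x n \<in> {0..<int p})" for x using power_series_carrier[of x p] by simp
  have fX: "f x \<in> X" for x unfolding Xiff f_def using p0 by simp
  have inj: "u = v" if "u \<in> {0..<int p}" "v \<in> {0..<int p}" "(i * u + s) mod int p = (i * v + s) mod int p" for u v s
  proof -
    have "[i * u = i * v] (mod int p)" using that(3) cong_add_rcancel[of "i * u" s "i * v" "int p"] by (simp add: cong_def)
    then have "[u = v] (mod int p)" using i by (simp add: cong_mult_lcancel)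
    then show ?thesis using that(1,2) by (simp add: cong_def)
  qed
  have pre: "\<exists>x'\<in>X. \<forall>y\<in>X. f y \<in> cyl n x \<longleftrightarrow> y \<in> cyl n x'" if x: "x \<in> X" for n x
  proof -
    have "\<exists>u. u \<in> {0..<int p} \<and> (i * u + t m) mod int p = x m" for m
    proof -
      obtain u where u: "(i * u + t m) mod int p = x m mod int p" using affine_surj_mod[OF i] by blast
      have "(i * (u mod int p) + t m) mod int p = (i * u + t m) mod int p"
        by (metis mod_add_left_eq mod_mult_right_eq)
      moreover have "x m mod int p = x m" using x Xiff by (simp add: mod_pos_pos_trivial)
      ultimately show ?thesis using u p0 by (intro exI[of _ "u mod int p"]) simp
    qed
    then obtain x' where x': "\<And>m. x' m \<in> {0..<int p}" "\<And>m. (i * x' m + t m) mod int p = x m" by metis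
    have "f y \<in> cyl n x \<longleftrightarrow> y \<in> cyl n x'" if y: "y \<in> X" for y
    proof -
      have "f y m = x m \<longleftrightarrow> y m = x' m" for m
        using inj[of "y m" "x' m" "t m"] y x' Xiff unfolding f_def by metis
      then show ?thesis using fX y by (simp add: cylinder_def)
    qed
    then show ?thesis using x'(1) Xiff by blast
  qed
  have f: "f \<in> measurable \<mu> \<mu>" "distr \<mu> \<mu> f = \<mu>"
    using equidistributed_map[OF haar_equidistributed, of f] fX pre by blast+
  have S: "S = f -` A \<inter> space \<mu>" unfolding S_def f_def haar_space by blast
  show "S \<in> sets \<mu>" unfolding S using f(1) A by (rule measurable_sets)
  have "measure \<mu> A = measure (distr \<mu> \<mu> f) A" by (simp only: f(2))
  also have "\<dots> = measure \<mu> S" unfolding S by (rule measure_distr[OF f(1) A])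
  finally show "measure \<mu> S = measure \<mu> A" by simp
qed

text \<open>
  The set \<open>row v w j\<close> describes the points of \<open>A\<close> on the translate by \<open>j w\<close> of the line spanned by
  \<open>v\<close>. Each point \<open>j w + i v\<close> with \<open>j\<close> prime to \<open>p\<close> runs through the group uniformly as
  \<open>w\<close> does, so averages of row sizes over \<open>w\<close> are multiples of the measure of \<open>A\<close>.
\<close>

lemma power_series_product_free_le:
  assumes p: "prime p" and A: "A \<in> sets (haar_measure (power_series_group p) (prime_power_series_topology p))"
    and free: "product_free (power_series_group p) A"
  shows "measure (haar_measure (power_series_group p) (prime_power_series_topology p)) A
    \<le> real ((p + 1) div 3) / real p"
proof -
  interpret digit_group "power_series_group p" "prime_power_series_topology p" p "\<lambda>_. int p" "\<lambda>d. d"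
    by (rule power_series_digit_group[OF p])
  interpret P: prob_space \<mu> by (rule haar_prob)
  have p1: "p > 1" using prime_gt_1_nat[OF p] .
  let ?N = "int p"
  have N: "?N > 0" using p1 by simp
  define K where "K = (p + 1) div 3"
  have K: "K > 0" "K \<le> p" using p1 unfolding K_def by presburger+
  define comb where "comb j w i v = (\<lambda>n. (j * w n + i * v n) mod ?N)" for j i :: int and w v :: "nat \<Rightarrow> int"
  define row where "row v w j = {i. comb j w i v \<in> A}" for v w j
  have row_per: "periodic ?N (row v w j)" for v w j
  proof -
    have "j * w n + (i + ?N) * v n = (j * w n + i * v n) + ?N * v n" for n i by (simp add: algebra_simps)
    then have "comb j w (i + ?N) v = comb j w i v" for i unfolding comb_def by (simp only: mod_mult_self2)
    then show ?thesis by (simp add: periodic_def row_def)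
  qed
  have row_index: "row v w (j + ?N) = row v w j" for v w j
  proof -
    have "(j + ?N) * w n + i * v n = (j * w n + i * v n) + ?N * w n" for n i by (simp add: algebra_simps)
    then have "comb (j + ?N) w i v = comb j w i v" for i unfolding comb_def by (simp only: mod_mult_self2)
    then show ?thesis by (simp add: row_def)
  qed
  have row_free: "x + y \<notin> row v w (i + j)" if "x \<in> row v w i" "y \<in> row v w j" for v w i j x y
  proof -
    have "comb i w x v \<otimes>\<^bsub>power_series_group p\<^esub> comb j w y v = comb (i + j) w (x + y) v"
      by (simp add: power_series_add comb_def mod_add_eq algebra_simps)
    then show ?thesis using that free unfolding product_free_def row_def by (metis mem_Collect_eq)
  qed
  have cop: "coprime i ?N" if "i \<in> {1..<?N}" for i
  proof (rule coprime_prime_int[OF p])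
    show "\<not> ?N dvd i" using that zdvd_not_zless[of i ?N] by auto
  qed
  \<comment> \<open>The trace of \<open>A\<close> on the line spanned by \<open>v\<close>.\<close>
  define line where "line v = {i. comb 0 v i v \<in> A}" for v
  have row0: "row v w 0 = line v" for v w by (simp add: row_def line_def comb_def)
  have line_le: "count_mod ?N (line v) \<le> K" for v
  proof (cases "line v = {}")
    case True
    then show ?thesis by (simp add: count_mod_def)
  next
    case False
    have "(line v + line v) \<inter> line v = {}"
      using row_free[of _ v v 0 _ 0] by (auto simp: row0 set_plus_def)
    then have "3 * count_mod ?N (line v) \<le> p + 1"
      using cauchy_davenport_avoiding[OF p row_per[of v v 0] _ row_per[of v v 0], of "line v"] False
      by (simp add: row0)
    then show ?thesis unfolding K_def by presburger
  qed
  have zero: "0 \<notin> line v" for v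
    using row_free[of 0 v v 0 0 0] by (auto simp: row0)
  show ?thesis
  proof (cases "\<exists>v\<in>X. count_mod ?N (line v) = K")
    case False
    \<comment> \<open>Average over all lines through the origin.\<close>
    define S where "S i = {v \<in> X. (\<lambda>n. (i * v n + 0) mod ?N) \<in> A}" for i
    have "(\<Sum>i\<in>{1..<?N}. measure \<mu> (S i)) \<le> real K - 1"
    proof (rule P.sum_measure_le_multiplicity)
      show "S i \<in> sets \<mu>" if "i \<in> {1..<?N}" for i
        unfolding S_def by (rule power_series_affine_measure(1)[OF p cop[OF that] A])
      fix v assume "v \<in> space \<mu>"
      then have v: "v \<in> X" by (simp only: haar_space)
      have "{i \<in> {1..<?N}. v \<in> S i} \<subseteq> line v \<inter> {0..<?N}"
        using v by (auto simp: S_def line_def comb_def)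
      then have "card {i \<in> {1..<?N}. v \<in> S i} \<le> count_mod ?N (line v)"
        unfolding count_mod_def by (intro card_mono) auto
      also have "\<dots> \<le> K - 1" using line_le[of v] False v by fastforce
      finally show "real (card {i \<in> {1..<?N}. v \<in> S i}) \<le> real K - 1" using K by linarith
    qed simp
    moreover have "(\<Sum>i\<in>{1..<?N}. measure \<mu> (S i)) = (\<Sum>i\<in>{1..<?N}. measure \<mu> A)"
      unfolding S_def by (intro sum.cong refl power_series_affine_measure(2)[OF p cop A])
    ultimately have le: "(real p - 1) * measure \<mu> A \<le> real K - 1" using p1 by (simp add: of_nat_diff)
    have "(real p - 1) * (real p * measure \<mu> A) = real p * ((real p - 1) * measure \<mu> A)"
      by (simp only: mult.left_commute)
    also have "\<dots> \<le> real p * (real K - 1)" by (intro mult_left_mono le) simp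
    also have "\<dots> \<le> (real p - 1) * real K" using K by (simp add: algebra_simps)
    finally have "real p * measure \<mu> A \<le> real K" using p1 by simp
    then show ?thesis using p1 by (simp add: K_def field_simps)
  next
    case True
    then obtain v where v: "v \<in> X" "count_mod ?N (line v) = K" by blast
    define I where "I = {1..<?N} \<times> {0..<?N}"
    define S where "S ji = {w \<in> X. (\<lambda>n. (fst ji * w n + snd ji * v n) mod ?N) \<in> A}" for ji
    have "(\<Sum>ji\<in>I. measure \<mu> (S ji)) \<le> (real p - 1) * real K"
    proof (rule P.sum_measure_le_multiplicity)
      show "finite I" by (simp add: I_def)
      show "S ji \<in> sets \<mu>" if "ji \<in> I" for ji
        unfolding S_def using that by (intro power_series_affine_measure(1)[OF p cop A]) (auto simp: I_def)
      fix w assume "w \<in> space \<mu>"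
      then have w: "w \<in> X" by (simp only: haar_space)
      have "{ji \<in> I. w \<in> S ji} = (SIGMA j:{1..<?N}. row v w j \<inter> {0..<?N})"
        using w by (auto simp: I_def S_def row_def comb_def)
      then have "card {ji \<in> I. w \<in> S ji} = (\<Sum>j\<in>{1..<?N}. count_mod ?N (row v w j))"
        by (simp add: count_mod_def)
      moreover have "(\<Sum>j\<in>{0..<?N}. count_mod ?N (row v w j)) \<le> K * p"
        using row_per row_index row_free v(2) by (intro plane_bound[OF p]) (auto simp: K_def row0)
      moreover have "{0..<?N} = insert 0 {1..<?N}" using p1 by auto
      then have "(\<Sum>j\<in>{0..<?N}. count_mod ?N (row v w j)) = K + (\<Sum>j\<in>{1..<?N}. count_mod ?N (row v w j))"
        using v(2) by (simp add: row0)
      ultimately have "card {ji \<in> I. w \<in> S ji} + K \<le> K * p" by linarith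
      then have "real (card {ji \<in> I. w \<in> S ji} + K) \<le> real (K * p)" by (simp only: of_nat_le_iff)
      then show "real (card {ji \<in> I. w \<in> S ji}) \<le> (real p - 1) * real K" by (simp add: algebra_simps)
    qed
    moreover have "(\<Sum>ji\<in>I. measure \<mu> (S ji)) = (\<Sum>ji\<in>I. measure \<mu> A)"
      unfolding S_def by (intro sum.cong refl power_series_affine_measure(2)[OF p cop A]) (auto simp: I_def)
    moreover have "real (card I) = (real p - 1) * real p" using p1 by (simp add: I_def of_nat_diff)
    ultimately have "(real p - 1) * (real p * measure \<mu> A) \<le> (real p - 1) * real K" by simp
    then have "real p * measure \<mu> A \<le> real K" using p1 by simp
    then show ?thesis using p1 by (simp add: K_def field_simps)
  qed
qed

lemma power_series_product_free_measure:
  assumes p: "prime p"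
  shows "product_free_measure (power_series_group p) (prime_power_series_topology p)
    = real ((p + 1) div 3) / real p"
proof -
  interpret digit_group "power_series_group p" "prime_power_series_topology p" p "\<lambda>_. int p" "\<lambda>d. d"
    by (rule power_series_digit_group[OF p])
  have p1: "p > 1" using prime_gt_1_nat[OF p] .
  define k where "k = int ((p + 1) div 3)"
  define a where "a = (if p mod 3 = 1 then k + 1 else k)"
  have mod3: "p mod 3 = 2 \<or> p mod 3 = 1 \<or> p = 3"
  proof -
    have "p = 3" if "p mod 3 = 0"
    proof -
      have "3 dvd p" using that by presburger
      moreover have "prime (3::nat)" by simp
      ultimately show ?thesis using primes_dvd_imp_eq[of 3 p] p by simp
    qed
    then show ?thesis by linarith
  qed
  have ab: "0 \<le> a" "a \<le> (a + k - 1) + 1" "a + k - 1 < int p" "a + k - 1 < 2 * a" "2 * (a + k - 1) < int p + a"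
    using mod3 p1 unfolding a_def k_def by (auto split: if_splits; presburger)+
  have "\<exists>A\<in>sets \<mu>. product_free (power_series_group p) A \<and>
      measure \<mu> A = of_int ((a + k - 1) - a + 1) / real p ^ Suc 0"
  proof (rule product_free_interval[where c = "\<lambda>x. x 0" and N = "int p", OF _ _ _ ab])
    show "y \<in> cyl 0 x \<longleftrightarrow> y 0 = x 0" if "x \<in> X" "y \<in> X" for x y using that by (simp add: cylinder_def)
    show "(x \<otimes>\<^bsub>power_series_group p\<^esub> y) 0 = (x 0 + y 0) mod int p" for x y by (simp add: power_series_add)
    show "\<exists>x\<in>X. x 0 = t" if "t \<in> {0..<int p}" for t
      using that by (intro bexI[of _ "\<lambda>_. t"]) (auto simp: power_series_carrier)
  qed
  then obtain A where A: "A \<in> sets \<mu>" "product_free (power_series_group p) A"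
    "measure \<mu> A = real ((p + 1) div 3) / real p" by (auto simp: k_def)
  show ?thesis
  proof (rule product_free_measure_eqI)
    show "measure \<mu> B \<le> real ((p + 1) div 3) / real p" if "B \<in> sets \<mu>" "product_free (power_series_group p) B" for B
      using that by (rule power_series_product_free_le[OF p])
    show "\<exists>A\<in>sets \<mu>. product_free (power_series_group p) A \<and> real ((p + 1) div 3) / real p - e \<le> measure \<mu> A"
      if "e > 0" for e
      using A that by (intro bexI[of _ A]) auto
  qed
qed

theorem theorem7:
  fixes p :: nat
  assumes "prime p"
  shows "product_free_measure (add_monoid (padic_int_ring p)) (padic_int_topology p) =
           (if [p = 2] (mod 3) then 1 / 3 + 1 / (3 * real p) else 1 / 3) \<and>
         ([p = 2] (mod 3) \<longrightarrow>
           product_free_measure (add_monoid (power_series_ring (residue_ring (int p))))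
             (power_series_topology (residue_ring (int p))) = 1 / 3 + 1 / (3 * real p)) \<and>
         (p = 3 \<longrightarrow>
           product_free_measure (add_monoid (power_series_ring (residue_ring (int p))))
             (power_series_topology (residue_ring (int p))) = 1 / 3) \<and>
         ([p = 1] (mod 3) \<longrightarrow>
           product_free_measure (add_monoid (power_series_ring (residue_ring (int p))))
             (power_series_topology (residue_ring (int p))) = 1 / 3 - 1 / (3 * real p))"
proof -
  have p1: "p > 1" using prime_gt_1_nat[OF assms] .
  have two: "real ((p + 1) div 3) / real p = 1 / 3 + 1 / (3 * real p)" if "[p = 2] (mod 3)"
  proof -
    have "3 * ((p + 1) div 3) = p + 1" using that unfolding cong_def by presburger
    then have "real (3 * ((p + 1) div 3)) = real (p + 1)" by (simp only:)
    then have "real ((p + 1) div 3) = (real p + 1) / 3" by simp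
    then show ?thesis using p1 by (simp add: field_simps)
  qed
  have one: "real ((p + 1) div 3) / real p = 1 / 3 - 1 / (3 * real p)" if "[p = 1] (mod 3)"
  proof -
    have "3 * ((p + 1) div 3) + 1 = p" using that unfolding cong_def by presburger
    then have "real (3 * ((p + 1) div 3) + 1) = real p" by (simp only:)
    then have "real ((p + 1) div 3) = (real p - 1) / 3" by simp
    then show ?thesis using p1 by (simp add: field_simps)
  qed
  have three: "real ((p + 1) div 3) / real p = 1 / 3" if "p = 3" using that by simp
  show ?thesis
    unfolding padic_product_free_measure[OF assms] power_series_product_free_measure[OF assms]
    using one two three by blast
qed

end
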